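(* Let $\Lambda, M \subset \mathbb{R}$ be multisets and let $L>0$ be a fixed number. Let $r:\Lambda\to\mathbb{Z}_{\ge 0}$ and $k: M\to \mathbb{Z}_{\ge 0}$ be functions, and let $a_\lambda, b_\mu:\mathbb{R}\to\mathbb{C}$ ($\lambda\in\Lambda$, $\mu\in M$) be functions. Assume that for every compactly supported $C^\infty$ function $f:\mathbb{R}\to\mathbb{C}$ and every $x\in\mathbb{R}$ the series below converge and $$ f(x) = \sum_{\lambda\in\Lambda} f^{(r(\lambda))}(\lambda)\,a_\lambda(x) + \sum_{\mu\in M} \hat f^{(k(\mu))}(\mu)\, b_\mu(x). $$ Assume moreover that: (i) $k(\mu)\le L$ for all $\mu\in M$; (ii) $n_M(R)\le R^L$ for all sufficiently large $R$; (iii) $b_\mu(x)$ is polynomially bounded in $\mu$ and $x$, i.e. there exist $K,U>0$ with $|b_\mu(x)|\le K(1+|x|)^U(1+|\mu|)^U$ for all $\mu\in M$, $x\in\mathbb{R}$. Then for every $\varepsilon>0$ there exists $C>0$ (depending on $\varepsilon$ and on the interpolation formula) such that for all $R_1,R_2>1$, $$ n_\Lambda(R_1)+n_M(R_2)\ \ge\ 4R_1R_2 - C\log^{2+\varepsilon}(4R_1R_2). $$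
   Context: The Fourier transform is $\hat f(\xi)=\int_{\mathbb{R}} f(x)e^{-2\pi i x\xi}\,dx$, and $\hat f^{(m)}$ denotes its $m$-th derivative. For a multiset $A\subset\mathbb{R}$ and $R>0$, the counting function is $n_A(R)=|A\cap[-R,R]|$, counted with multiplicity. *)

theory Defs
  imports "HOL-Analysis.Analysis"
begin

definition nth_deriv :: "nat \<Rightarrow> (real \<Rightarrow> complex) \<Rightarrow> real \<Rightarrow> complex" where
  "nth_deriv m f = ((\<lambda>g x. vector_derivative g (at x)) ^^ m) f"

definition smooth_fun :: "(real \<Rightarrow> complex) \<Rightarrow> bool" where
  "smooth_fun f \<longleftrightarrow> (\<forall>m x. (nth_deriv m f has_vector_derivative nth_deriv (Suc m) f x) (at x))"

definition compact_support :: "(real \<Rightarrow> complex) \<Rightarrow> bool" where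
  "compact_support f \<longleftrightarrow> compact (closure {x. f x \<noteq> 0})"

definition fourier :: "(real \<Rightarrow> complex) \<Rightarrow> real \<Rightarrow> complex" where
  "fourier f \<xi> = (LINT x|lborel. f x * exp (- 2 * pi * \<i> * complex_of_real (x * \<xi>)))"

text \<open>Counting function of the multiset given by the family (A i) indexed by I,
  counted with multiplicity; infinite if infinitely many points lie in [-R,R].\<close>
definition count_fn :: "'i set \<Rightarrow> ('i \<Rightarrow> real) \<Rightarrow> real \<Rightarrow> ereal" where
  "count_fn I A R = (if finite {i\<in>I. \<bar>A i\<bar> \<le> R} then ereal (real (card {i\<in>I. \<bar>A i\<bar> \<le> R})) else \<infinity>)"

end

theory Submission
  imports Defs "HOL-Computational_Algebra.Fundamental_Theorem_Algebra" "HOL-Library.Real_Mod"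
begin

text \<open>Write \<open>W = 4 R\<^sub>1 R\<^sub>2\<close>. It suffices to find a space of test functions supported in
  \<open>[-R\<^sub>1, R\<^sub>1]\<close>, of dimension \<open>W - O(log\<^sup>2 W)\<close>, whose Fourier transforms are smaller than any fixed
  power of \<open>1/W\<close> outside \<open>[-R\<^sub>2, R\<^sub>2]\<close>: if there were fewer nodes than dimensions, some normalized
  \<open>f\<close> in it would be annihilated by all the functionals at nodes with \<open>|\<lambda>| \<le> R\<^sub>1\<close> and
  \<open>|\<mu>| \<le> R\<^sub>2\<close>, and the formula would represent \<open>f\<close> by the tiny remaining terms.

  The test functions are \<open>f = \<Sum> c\<^sub>n \<eta>((x - t\<^sub>n) / s)\<close> with a fixed bump \<open>\<eta>\<close> and a fine grid
  \<open>t\<^sub>n\<close>. Then the Fourier transform of \<open>f\<close> is a decaying factor times a trigonometric polynomial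
  \<open>p\<close> with coefficients \<open>c\<^sub>n\<close>, and the energy of \<open>p\<close> at the grid frequencies outside
  \<open>[-R\<^sub>2, R\<^sub>2]\<close> is the quadratic form of a compression \<open>T\<close> of a discrete band projection. The
  trace of \<open>T\<close> gives the count \<open>W\<close> once \<open>T\<close> has few eigenvalues away from \<open>0\<close> and \<open>1\<close>. Now
  \<open>T - T\<^sup>2\<close> is the Gram form of the off-diagonal block of the projection, which is built from
  Cauchy matrices \<open>1 / (x\<^sub>n - x\<^sub>m)\<close>. A Whitney decomposition of the time interval into \<open>O(log W)\<close>
  pieces, with \<open>O(log W)\<close> Taylor terms on each, shows that this block has numerical rank
  \<open>O(log\<^sup>2 W)\<close>.\<close>

section \<open>Linear algebra of Hermitian forms\<close>

text \<open>The formula involves derivatives of the Fourier transform up to some order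
  \<open>n\<close>, while concentration only controls the transform itself. Derivatives are
  recovered by a Landau type inequality, at the price of a square root each. So the exponents are
  fixed backwards: \<open>P\<close> absorbs the growth of \<open>b\<close>, the number of nodes and
  the derivative constants; \<open>Q = P * 2 ^ n\<close> leaves \<open>P\<close> after
  \<open>n\<close> square roots; \<open>q = 4 * Q + 5\<close> is the precision needed for
  \<open>p\<close> on the frequency grid; and \<open>l\<close>, of order \<open>q\<close> times
  \<open>ln D\<close>, is the number of Taylor terms reaching that precision. These exponents depend
  on the formula only, so the loss is a fixed multiple of the squared logarithm. A trigonometric
  polynomial with grid frequencies is periodic and cannot be small at all large arguments. Its
  smallness is used within one period; beyond, the decay of the transform of the bump takes over.
  That \<open>f\<close> is not itself tiny follows from Parseval: its energy has to sit at the inner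
  frequencies.\<close>

lemma homogeneous_system:
  fixes A :: "'e \<Rightarrow> 'i \<Rightarrow> 'a::field"
  assumes "finite E" "finite S" "card E < card S"
  shows "\<exists>c. (\<exists>i\<in>S. c i \<noteq> 0) \<and> (\<forall>e\<in>E. (\<Sum>i\<in>S. A e i * c i) = 0)"
  using assms
proof (induction E arbitrary: S A rule: finite_induct)
  case empty
  then have "S \<noteq> {}" by auto
  then show ?case by (intro exI[of _ "\<lambda>_. 1"]) auto
next
  case (insert e E)
  show ?case
  proof (cases "\<forall>i\<in>S. A e i = 0")
    case True
    have "card E < card S" using insert by simp
    from insert.IH[OF insert.prems(1) this, of A] True show ?thesis by auto
  next
    case False
    then obtain j where j: "j \<in> S" "A e j \<noteq> 0" by auto
    define S' where "S' = S - {j}"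
    have fin: "finite S'" and card: "card E < card S'"
      using insert j by (auto simp: S'_def)
    \<comment> \<open>Equation \<open>e\<close> is solved for the unknown \<open>j\<close> and
      substituted into the others; these are the coefficients of the reduced system.\<close>
    obtain c' where c': "\<exists>i\<in>S'. c' i \<noteq> 0"
      "\<And>f. f \<in> E \<Longrightarrow> (\<Sum>i\<in>S'. (A f i - A f j * A e i / A e j) * c' i) = 0"
      using insert.IH[OF fin card, of "\<lambda>f i. A f i - A f j * A e i / A e j"] by auto
    define s where "s = (\<Sum>i\<in>S'. A e i * c' i)"
    define c where "c = (\<lambda>i. if i = j then - s / A e j else c' i)"
    have split: "(\<Sum>i\<in>S. A f i * c i) = (\<Sum>i\<in>S'. A f i * c' i) - A f j * s / A e j" for f
    proof -
      have "(\<Sum>i\<in>S. A f i * c i) = A f j * c j + (\<Sum>i\<in>S'. A f i * c i)"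
        unfolding S'_def using j insert.prems(1) by (simp add: sum.remove)
      also have "(\<Sum>i\<in>S'. A f i * c i) = (\<Sum>i\<in>S'. A f i * c' i)"
        by (intro sum.cong) (auto simp: c_def S'_def)
      finally show ?thesis by (simp add: c_def)
    qed
    have "(\<Sum>i\<in>S. A f i * c i) = 0" if "f \<in> insert e E" for f
    proof (cases "f = e")
      case True
      then show ?thesis using j by (simp add: split s_def)
    next
      case False
      then have "0 = (\<Sum>i\<in>S'. (A f i - A f j * A e i / A e j) * c' i)"
        using c'(2) that by auto
      also have "\<dots> = (\<Sum>i\<in>S'. A f i * c' i) - A f j * s / A e j"
        by (simp add: s_def algebra_simps sum_subtractf sum_distrib_left sum_divide_distrib)
      finally show ?thesis by (simp add: split)
    qed
    moreover have "\<exists>i\<in>S. c i \<noteq> 0"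
      using c'(1) by (auto simp: c_def S'_def)
    ultimately show ?thesis by blast
  qed
qed

section \<open>Vectors and orthonormal families in C^N\<close>

definition cip :: "nat \<Rightarrow> (nat \<Rightarrow> complex) \<Rightarrow> (nat \<Rightarrow> complex) \<Rightarrow> complex" where
  "cip N x y = (\<Sum>m<N. x m * cnj (y m))"

text \<open>The row index \<open>m\<close> is not confined to \<open>m < N\<close>: rows below
  \<open>N\<close> give the compressed operator, rows in \<open>{N..<M}\<close> the off-diagonal
  block, both from one kernel.\<close>

definition mat_app :: "nat \<Rightarrow> (nat \<Rightarrow> nat \<Rightarrow> complex) \<Rightarrow> (nat \<Rightarrow> complex) \<Rightarrow> nat \<Rightarrow> complex" where
  "mat_app N T v m = (\<Sum>n<N. T m n * v n)"

definition orthonormal :: "nat \<Rightarrow> 'i set \<Rightarrow> ('i \<Rightarrow> nat \<Rightarrow> complex) \<Rightarrow> bool" where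
  "orthonormal N S u \<longleftrightarrow> (\<forall>i\<in>S. \<forall>j\<in>S. cip N (u i) (u j) = (if i = j then 1 else 0))"

lemma cip_self: "cip N x x = of_real (\<Sum>m<N. (norm (x m))\<^sup>2)"
  unfolding cip_def of_real_sum complex_norm_square ..

lemma cip_cnj: "cnj (cip N x y) = cip N y x"
  by (simp add: cip_def cnj_sum mult.commute)

lemma cip_sum_left: "cip N (\<lambda>m. \<Sum>i\<in>S. d i * u i m) y = (\<Sum>i\<in>S. d i * cip N (u i) y)"
  unfolding cip_def sum_distrib_left sum_distrib_right
  by (subst sum.swap) (simp add: mult_ac)

lemma cip_sum_right: "cip N y (\<lambda>m. \<Sum>i\<in>S. d i * u i m) = (\<Sum>i\<in>S. cnj (d i) * cip N y (u i))"
proof -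
  have "cip N y (\<lambda>m. \<Sum>i\<in>S. d i * u i m) = cnj (cip N (\<lambda>m. \<Sum>i\<in>S. d i * u i m) y)"
    by (simp add: cip_cnj)
  also have "\<dots> = (\<Sum>i\<in>S. cnj (d i) * cip N y (u i))"
    by (simp add: cip_sum_left cnj_sum cip_cnj)
  finally show ?thesis .
qed

lemma orthonormal_cip_sum:
  assumes "finite S" "orthonormal N S u"
  shows "cip N (\<lambda>m. \<Sum>i\<in>S. a i * u i m) (\<lambda>m. \<Sum>i\<in>S. b i * u i m) = (\<Sum>i\<in>S. a i * cnj (b i))"
proof -
  have "cip N (\<lambda>m. \<Sum>i\<in>S. a i * u i m) (\<lambda>m. \<Sum>i\<in>S. b i * u i m)
      = (\<Sum>i\<in>S. a i * (\<Sum>j\<in>S. cnj (b j) * cip N (u i) (u j)))"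
    by (simp add: cip_sum_left cip_sum_right)
  also have "\<dots> = (\<Sum>i\<in>S. a i * (\<Sum>j\<in>S. if i = j then cnj (b j) else 0))"
    using assms(2) by (intro sum.cong refl arg_cong2[where f="(*)"]) (auto simp: orthonormal_def)
  also have "\<dots> = (\<Sum>i\<in>S. a i * cnj (b i))"
    using assms(1) by (simp add: sum.delta)
  finally show ?thesis .
qed

lemma orthonormal_norm_comb:
  assumes "finite S" "orthonormal N S u"
  shows "(\<Sum>m<N. (norm (\<Sum>i\<in>S. d i * u i m))\<^sup>2) = (\<Sum>i\<in>S. (norm (d i))\<^sup>2)"
proof -
  have "complex_of_real (\<Sum>m<N. (norm (\<Sum>i\<in>S. d i * u i m))\<^sup>2) = (\<Sum>i\<in>S. d i * cnj (d i))"
    unfolding cip_self[symmetric] by (rule orthonormal_cip_sum[OF assms])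
  also have "\<dots> = of_real (\<Sum>i\<in>S. (norm (d i))\<^sup>2)"
    by (simp only: of_real_sum complex_norm_square)
  finally show ?thesis using of_real_eq_iff by blast
qed

lemma mat_app_sum:
  "mat_app N T (\<lambda>m. \<Sum>i\<in>S. d i * u i m) m = (\<Sum>i\<in>S. d i * mat_app N T (u i) m)"
  unfolding mat_app_def sum_distrib_left
  by (subst sum.swap) (simp add: mult_ac)

lemma bessel:
  assumes "finite S" "orthonormal N S u"
  shows "(\<Sum>i\<in>S. (norm (cip N x (u i)))\<^sup>2) \<le> (\<Sum>m<N. (norm (x m))\<^sup>2)"
proof -
  define p where "p = (\<lambda>m. \<Sum>i\<in>S. cip N x (u i) * u i m)"
  define s where "s = (\<Sum>i\<in>S. (norm (cip N x (u i)))\<^sup>2)"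
  have pp: "cip N p p = of_real s"
    using orthonormal_cip_sum[OF assms, of "\<lambda>i. cip N x (u i)" "\<lambda>i. cip N x (u i)"]
    unfolding p_def s_def of_real_sum complex_norm_square .
  have xp: "cip N x p = of_real s"
    unfolding p_def cip_sum_right s_def of_real_sum complex_norm_square
    by (simp only: mult.commute)
  have px: "cip N p x = of_real s"
    using cip_cnj[of N x p] xp by simp
  have "cip N (\<lambda>m. x m - p m) (\<lambda>m. x m - p m) = cip N x x - cip N x p - cip N p x + cip N p p"
    by (simp add: cip_def algebra_simps sum.distrib sum_subtractf)
  then have "of_real (\<Sum>m<N. (norm (x m - p m))\<^sup>2) = complex_of_real ((\<Sum>m<N. (norm (x m))\<^sup>2) - s)"
    by (simp only: pp xp px) (simp only: cip_self of_real_diff of_real_add, simp)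
  then have "(\<Sum>m<N. (norm (x m - p m))\<^sup>2) = (\<Sum>m<N. (norm (x m))\<^sup>2) - s"
    using of_real_eq_iff by blast
  moreover have "(\<Sum>m<N. (norm (x m - p m))\<^sup>2) \<ge> 0" by (intro sum_nonneg) auto
  ultimately show ?thesis by (simp add: s_def)
qed

section \<open>Krylov vectors and the spectral theorem\<close>

definition poly_app :: "nat \<Rightarrow> (nat \<Rightarrow> nat \<Rightarrow> complex) \<Rightarrow> complex poly \<Rightarrow> (nat \<Rightarrow> complex) \<Rightarrow> nat \<Rightarrow> complex" where
  "poly_app N T p w m = (\<Sum>i\<le>degree p. coeff p i * (mat_app N T ^^ i) w m)"

lemma poly_app_alt:
  assumes "degree p \<le> d"
  shows "poly_app N T p w m = (\<Sum>i\<le>d. coeff p i * (mat_app N T ^^ i) w m)"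
  unfolding poly_app_def
  by (rule sum.mono_neutral_left) (use assms in \<open>auto simp: coeff_eq_0\<close>)

lemma poly_app_linear_factor:
  "poly_app N T ([:- z, 1:] * q) w m = mat_app N T (poly_app N T q w) m - z * poly_app N T q w m"
proof -
  define d where "d = degree q"
  have "degree ([:- z, 1:] * q) \<le> Suc d"
    using degree_mult_le[of "[:- z, 1:]" q] by (simp add: d_def)
  then have "poly_app N T ([:- z, 1:] * q) w m
      = (\<Sum>i\<le>Suc d. coeff ([:- z, 1:] * q) i * (mat_app N T ^^ i) w m)"
    by (rule poly_app_alt)
  also have "\<dots> = (\<Sum>i\<le>Suc d. coeff (pCons 0 q) i * (mat_app N T ^^ i) w m)
      - z * (\<Sum>i\<le>Suc d. coeff q i * (mat_app N T ^^ i) w m)"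
    by (simp add: mult_pCons_left algebra_simps sum_subtractf sum_distrib_left del: sum.atMost_Suc)
  also have "(\<Sum>i\<le>Suc d. coeff q i * (mat_app N T ^^ i) w m) = poly_app N T q w m"
    by (rule poly_app_alt[symmetric]) (simp add: d_def)
  also have "(\<Sum>i\<le>Suc d. coeff (pCons 0 q) i * (mat_app N T ^^ i) w m)
      = (\<Sum>i\<le>d. coeff q i * mat_app N T ((mat_app N T ^^ i) w) m)"
    by (subst sum.atMost_Suc_shift) simp
  also have "\<dots> = mat_app N T (poly_app N T q w) m"
    unfolding poly_app_def d_def mat_app_sum[symmetric] by simp
  finally show ?thesis .
qed

text \<open>Take a polynomial of least degree annihilating \<open>w\<close>, split off a root \<open>z\<close>, and apply the
  cofactor to \<open>w\<close>.\<close>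

lemma krylov_eigenvector:
  assumes w: "\<exists>m<N. w m \<noteq> 0"
  shows "\<exists>q z. (\<exists>m<N. poly_app N T q w m \<noteq> 0) \<and>
           (\<forall>m<N. mat_app N T (poly_app N T q w) m = z * poly_app N T q w m)"
proof -
  define P where "P = (\<lambda>p. p \<noteq> 0 \<and> (\<forall>m<N. poly_app N T p w m = 0))"
  obtain c where c: "\<exists>i\<in>{..N}. c i \<noteq> 0"
      "\<forall>m\<in>{..<N}. (\<Sum>i\<in>{..N}. (mat_app N T ^^ i) w m * c i) = 0"
    using homogeneous_system[of "{..<N}" "{..N}" "\<lambda>m i. (mat_app N T ^^ i) w m"] by auto
  define p0 where "p0 = (\<Sum>i\<le>N. monom (c i) i)"
  have coeff0: "coeff p0 j = (if j \<le> N then c j else 0)" for j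
    by (simp add: p0_def coeff_sum)
  have "degree p0 \<le> N" by (rule degree_le) (simp add: coeff0)
  then have "P p0"
    using c coeff0 by (auto simp: P_def poly_app_alt mult.commute) metis
  then obtain p where p: "P p" "\<And>q. P q \<Longrightarrow> degree p \<le> degree q"
    using ex_has_least_nat[of P p0 degree] by blast
  have "degree p \<noteq> 0"
  proof
    assume d0: "degree p = 0"
    then have "coeff p 0 \<noteq> 0" using p(1) by (metis P_def leading_coeff_0_iff)
    then show False using w p(1) d0 by (auto simp: P_def poly_app_def)
  qed
  then obtain z where "poly p z = 0"
    using fundamental_theorem_of_algebra[of p] constant_degree[of p] by metis
  then obtain q where q: "p = [:- z, 1:] * q" by (metis poly_eq_0_iff_dvd dvdE)
  have "q \<noteq> 0" using p(1) q by (auto simp: P_def)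
  then have "degree q < degree p" unfolding q by (subst degree_mult_eq) auto
  then have "\<not> P q" using p(2) by force
  then have "\<exists>m<N. poly_app N T q w m \<noteq> 0" using \<open>q \<noteq> 0\<close> by (auto simp: P_def)
  moreover have "\<forall>m<N. mat_app N T (poly_app N T q w) m = z * poly_app N T q w m"
    using p(1) unfolding P_def q poly_app_linear_factor by simp
  ultimately show ?thesis by blast
qed

lemma hermitian_cip:
  assumes "\<And>m n. m < N \<Longrightarrow> n < N \<Longrightarrow> T n m = cnj (T m n)"
  shows "cip N (mat_app N T x) y = cip N x (mat_app N T y)"
proof -
  have "cip N (mat_app N T x) y = (\<Sum>m<N. \<Sum>n<N. T m n * x n * cnj (y m))"
    by (simp add: cip_def mat_app_def sum_distrib_right)
  also have "\<dots> = (\<Sum>n<N. \<Sum>m<N. T m n * x n * cnj (y m))" by (rule sum.swap)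
  also have "\<dots> = (\<Sum>n<N. \<Sum>m<N. x n * cnj (T n m * y m))"
  proof (intro sum.cong refl)
    fix m n assume "m \<in> {..<N}" "n \<in> {..<N}"
    then have "T m n = cnj (T n m)" using assms by blast
    then show "T m n * x n * cnj (y m) = x n * cnj (T n m * y m)" by simp
  qed
  also have "\<dots> = cip N x (mat_app N T y)"
    by (simp add: cip_def mat_app_def sum_distrib_left cnj_sum)
  finally show ?thesis .
qed

lemma cip_scale: "cip N (\<lambda>m. a * x m) y = a * cip N x y" "cip N x (\<lambda>m. a * y m) = cnj a * cip N x y"
  by (simp_all add: cip_def sum_distrib_left mult_ac)

lemma cip_cong:
  assumes "\<And>m. m < N \<Longrightarrow> x m = x' m" "\<And>m. m < N \<Longrightarrow> y m = y' m"
  shows "cip N x y = cip N x' y'"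
  unfolding cip_def using assms by (intro sum.cong) auto

lemma mat_app_scale: "mat_app N T (\<lambda>n. a * v n) m = a * mat_app N T v m"
  by (simp add: mat_app_def sum_distrib_left mult_ac)

text \<open>Induction on the number of eigenvectors found. A vector \<open>w\<close> orthogonal to
  them exists by counting equations, and self-adjointness keeps all iterates of \<open>w\<close>
  under \<open>T\<close> orthogonal to them. The eigenvector from \<open>krylov_eigenvector\<close>
  is a polynomial in \<open>T\<close> applied to \<open>w\<close>, so it inherits this
  orthogonality.\<close>

lemma hermitian_eigenbasis:
  assumes herm: "\<And>m n. m < N \<Longrightarrow> n < N \<Longrightarrow> T n m = cnj (T m n)"
  shows "\<exists>u l. orthonormal N {..<N} u \<and>
    (\<forall>i<N. \<forall>m<N. mat_app N T (u i) m = complex_of_real (l i) * u i m)"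
proof -
  have "\<exists>u l. orthonormal N {..<k} u \<and>
    (\<forall>i<k. \<forall>m<N. mat_app N T (u i) m = complex_of_real (l i) * u i m)" if "k \<le> N" for k
    using that
  proof (induction k)
    case 0
    show ?case by (simp add: orthonormal_def)
  next
    case (Suc k)
    then obtain u and l :: "nat \<Rightarrow> real" where on: "orthonormal N {..<k} u"
      and eig: "\<And>i m. i < k \<Longrightarrow> m < N \<Longrightarrow> mat_app N T (u i) m = of_real (l i) * u i m" by auto
    obtain w where w: "\<exists>m\<in>{..<N}. w m \<noteq> 0"
      "\<forall>e\<in>{..<k}. (\<Sum>m<N. cnj (u e m) * w m) = 0"
      using homogeneous_system[of "{..<k}" "{..<N}" "\<lambda>e m. cnj (u e m)"] Suc.prems by auto
    have worth: "cip N w (u e) = 0" if "e < k" for e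
      using w(2) that by (simp add: cip_def mult.commute)
    have orth_app: "cip N (mat_app N T v) (u e) = of_real (l e) * cip N v (u e)" if "e < k" for e v
    proof -
      have "cip N (mat_app N T v) (u e) = cip N v (mat_app N T (u e))"
        by (rule hermitian_cip) (rule herm)
      also have "\<dots> = cip N v (\<lambda>m. of_real (l e) * u e m)"
        by (rule cip_cong) (simp_all add: eig that)
      finally show ?thesis by (simp add: cip_scale)
    qed
    have krylov_orth: "cip N ((mat_app N T ^^ j) w) (u e) = 0" if "e < k" for e j
      by (induction j) (simp_all add: worth orth_app that)
    obtain q z where qz: "\<exists>m<N. poly_app N T q w m \<noteq> 0"
       "\<forall>m<N. mat_app N T (poly_app N T q w) m = z * poly_app N T q w m"
      using krylov_eigenvector[of N w T] w(1) by auto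
    define v where "v = poly_app N T q w"
    have vorth: "cip N v (u e) = 0" if "e < k" for e
    proof -
      have "cip N v (u e) = (\<Sum>i\<le>degree q. coeff q i * cip N ((mat_app N T ^^ i) w) (u e))"
        unfolding v_def poly_app_def[abs_def] by (rule cip_sum_left)
      then show ?thesis by (simp add: krylov_orth that)
    qed
    define s where "s = (\<Sum>m<N. (norm (v m))\<^sup>2)"
    obtain m0 where "m0 < N" "v m0 \<noteq> 0" using qz(1) by (auto simp: v_def)
    then have s: "s > 0" unfolding s_def
      by (intro sum_pos2[of _ m0]) auto
    have veig: "mat_app N T v m = z * v m" if "m < N" for m
      using qz(2) that by (simp add: v_def)
    have "z * cip N v v = cip N (mat_app N T v) v"
      using veig by (simp add: cip_scale(1)[symmetric] cong: cip_cong)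
    also have "\<dots> = cip N v (mat_app N T v)" by (rule hermitian_cip) (rule herm)
    also have "\<dots> = cnj z * cip N v v"
      using veig by (simp add: cip_scale(2)[symmetric] cong: cip_cong)
    finally have "z = cnj z" using s by (simp add: cip_self s_def[symmetric] del: of_real_sum)
    then have zre: "z = of_real (Re z)" by (simp add: complex_eq_iff)
    define v' where "v' = (\<lambda>m. of_real (1 / sqrt s) * v m)"
    have v'1: "cip N v' v' = 1"
    proof -
      have "cip N v' v' = complex_of_real (1 / sqrt s * (1 / sqrt s * s))"
        unfolding v'_def cip_scale by (simp only: cip_self s_def[symmetric] complex_cnj_complex_of_real of_real_mult)
      also have "1 / sqrt s * (1 / sqrt s * s) = 1"
        using s by (simp add: divide_simps)
      finally show ?thesis by simp
    qed
    have v'orth: "cip N v' (u e) = 0" "cip N (u e) v' = 0" if "e < k" for e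
      using vorth[OF that] cip_cnj[of N v "u e"] unfolding v'_def cip_scale by simp_all
    have v'eig: "mat_app N T v' m = of_real (Re z) * v' m" if "m < N" for m
      unfolding v'_def mat_app_scale veig[OF that] using zre by simp
    have "orthonormal N {..<Suc k} (u(k := v'))"
      unfolding orthonormal_def lessThan_Suc
      using on v'1 v'orth by (auto simp: orthonormal_def)
    moreover have "\<forall>i<Suc k. \<forall>m<N. mat_app N T ((u(k := v')) i) m
        = complex_of_real ((l(k := Re z)) i) * (u(k := v')) i m"
      using eig v'eig by (auto simp: less_Suc_eq)
    ultimately show ?case by blast
  qed
  from this[of N] show ?thesis by simp
qed

section \<open>Discrete time-frequency localization\<close>

definition unity_pow :: "nat \<Rightarrow> int \<Rightarrow> complex" where
  "unity_pow M j = cis (2 * pi * of_int j / of_nat M)"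

lemma unity_pow_add: "unity_pow M (a + b) = unity_pow M a * unity_pow M b"
  by (simp add: unity_pow_def cis_mult add_divide_distrib algebra_simps)

lemma cnj_unity_pow: "cnj (unity_pow M a) = unity_pow M (- a)"
  by (simp add: unity_pow_def cis_cnj)

lemma norm_unity_pow [simp]: "norm (unity_pow M a) = 1"
  by (simp add: unity_pow_def)

lemma unity_pow_power: "unity_pow M a ^ n = unity_pow M (int n * a)"
  by (simp add: unity_pow_def Complex.DeMoivre mult_ac)

lemma unity_pow_0 [simp]: "unity_pow M 0 = 1"
  by (simp add: unity_pow_def)

lemma unity_pow_eq_1:
  assumes "M > 0"
  shows "unity_pow M a = 1 \<longleftrightarrow> int M dvd a"
proof
  assume "unity_pow M a = 1"
  then obtain n where "2 * pi * of_int a / of_nat M = of_int n * (2 * pi)"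
    unfolding unity_pow_def cis_eq_1_iff by blast
  then have "(of_int a :: real) = of_int (n * int M)"
    using assms by (simp add: field_simps)
  then have "a = n * int M" by (simp only: of_int_eq_iff)
  then show "int M dvd a" by simp
next
  assume "int M dvd a"
  then obtain n where n: "a = int M * n" by (auto elim: dvdE)
  have "2 * pi * of_int a / of_nat M = 2 * pi * of_int n"
    using assms by (simp add: n)
  then show "unity_pow M a = 1"
    unfolding unity_pow_def by (simp add: cis_multiple_2pi)
qed

lemma sum_unity_pow:
  assumes "M > 0"
  shows "(\<Sum>n<M. unity_pow M (a * int n)) = (if int M dvd a then of_nat M else 0)"
proof -
  have eq: "unity_pow M (a * int n) = unity_pow M a ^ n" for n
    by (simp add: unity_pow_power mult.commute)
  show ?thesis
  proof (cases "int M dvd a")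
    case True
    then have "unity_pow M a = 1" using unity_pow_eq_1[OF assms] by simp
    then show ?thesis unfolding eq using True by simp
  next
    case False
    then have "unity_pow M a \<noteq> 1" using unity_pow_eq_1[OF assms] by simp
    moreover have "unity_pow M a ^ M = 1"
      unfolding unity_pow_power using assms by (simp add: unity_pow_eq_1)
    ultimately show ?thesis unfolding eq using False
      by (simp add: geometric_sum)
  qed
qed

lemma parseval:
  assumes "G \<subseteq> {..<M}"
  shows "(\<Sum>n<M. (norm (\<Sum>g\<in>G. a g * unity_pow M (int g * int n)))\<^sup>2) = of_nat M * (\<Sum>g\<in>G. (norm (a g))\<^sup>2)"
proof (cases "M = 0")
  case False
  have fin: "finite G" using assms finite_subset by blast
  have delta: "int M dvd (int g - int h) \<longleftrightarrow> g = h" if "g \<in> G" "h \<in> G" for g h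
  proof
    assume "int M dvd (int g - int h)"
    moreover have "\<bar>int g - int h\<bar> < int M" using subsetD[OF assms that(1)] subsetD[OF assms that(2)] by auto
    ultimately show "g = h" using zdvd_imp_le[of "int M" "\<bar>int g - int h\<bar>"] by fastforce
  qed simp
  have split: "unity_pow M ((int g - int h) * int n) = unity_pow M (int g * int n) * cnj (unity_pow M (int h * int n))" for g h n
    by (simp add: left_diff_distrib cnj_unity_pow flip: unity_pow_add)
  have "complex_of_real (\<Sum>n<M. (norm (\<Sum>g\<in>G. a g * unity_pow M (int g * int n)))\<^sup>2)
     = (\<Sum>n<M. (\<Sum>g\<in>G. a g * unity_pow M (int g * int n)) * cnj (\<Sum>g\<in>G. a g * unity_pow M (int g * int n)))"
    by (simp only: of_real_sum complex_norm_square)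
  also have "\<dots> = (\<Sum>n<M. \<Sum>g\<in>G. \<Sum>h\<in>G. (a g * cnj (a h)) * unity_pow M ((int g - int h) * int n))"
    unfolding cnj_sum sum_product
    by (intro sum.cong refl) (simp add: split)
  also have "\<dots> = (\<Sum>g\<in>G. \<Sum>n<M. \<Sum>h\<in>G. (a g * cnj (a h)) * unity_pow M ((int g - int h) * int n))"
    by (rule sum.swap)
  also have "\<dots> = (\<Sum>g\<in>G. \<Sum>h\<in>G. \<Sum>n<M. (a g * cnj (a h)) * unity_pow M ((int g - int h) * int n))"
    by (intro sum.cong refl sum.swap)
  also have "\<dots> = (\<Sum>g\<in>G. \<Sum>h\<in>G. if g = h then a g * cnj (a h) * of_nat M else 0)"
    using False by (intro sum.cong refl)
      (simp add: sum_distrib_left[symmetric] sum_unity_pow delta)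
  also have "\<dots> = (\<Sum>g\<in>G. a g * cnj (a g) * of_nat M)"
    using fin by simp
  also have "\<dots> = of_real (of_nat M * (\<Sum>g\<in>G. (norm (a g))\<^sup>2))"
    unfolding complex_norm_square[symmetric]
    by (simp add: sum_distrib_left mult.commute)
  finally show ?thesis using of_real_eq_iff by blast
qed simp

definition dft :: "nat \<Rightarrow> nat \<Rightarrow> (nat \<Rightarrow> complex) \<Rightarrow> nat \<Rightarrow> complex" where
  "dft M N c g = (\<Sum>m<N. c m * unity_pow M (- (int g * int m)))"

text \<open>For \<open>G\<close> inside \<open>{..<M}\<close> this is the kernel of the orthogonal
  projection of C^M onto the span of the characters with frequency in \<open>G\<close>. Restricting
  both indices to below \<open>N\<close> compresses it to the time window.\<close>

definition band_mat :: "nat \<Rightarrow> nat set \<Rightarrow> nat \<Rightarrow> nat \<Rightarrow> complex" where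
  "band_mat M G n m = (\<Sum>g\<in>G. unity_pow M (int g * (int n - int m))) / of_nat M"

lemma band_mat_hermitian: "band_mat M G n m = cnj (band_mat M G m n)"
  unfolding band_mat_def by (simp add: cnj_sum cnj_unity_pow algebra_simps)

lemma mat_app_band_mat:
  "mat_app N (band_mat M G) c n = (\<Sum>g\<in>G. dft M N c g / of_nat M * unity_pow M (int g * int n))"
proof -
  have split: "unity_pow M (int g * (int n - int m)) = unity_pow M (- (int g * int m)) * unity_pow M (int g * int n)" for g m
    by (simp add: right_diff_distrib flip: unity_pow_add)
  have "mat_app N (band_mat M G) c n
      = (\<Sum>m<N. \<Sum>g\<in>G. c m * unity_pow M (- (int g * int m)) / of_nat M * unity_pow M (int g * int n))"
    unfolding mat_app_def band_mat_def sum_divide_distrib sum_distrib_right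
    by (intro sum.cong refl) (simp add: split mult_ac)
  also have "\<dots> = (\<Sum>g\<in>G. \<Sum>m<N. c m * unity_pow M (- (int g * int m)) / of_nat M * unity_pow M (int g * int n))"
    by (rule sum.swap)
  finally show ?thesis
    by (simp add: dft_def sum_divide_distrib sum_distrib_right)
qed

text \<open>Together with \<open>cip_band_mat\<close> this says that the kernel is a self-adjoint
  idempotent: for a vector supported below \<open>N\<close>, the squared norm of the image over all
  \<open>M\<close> rows equals the quadratic form.\<close>

lemma norm_mat_app_band_mat:
  assumes "G \<subseteq> {..<M}"
  shows "(\<Sum>n<M. (norm (mat_app N (band_mat M G) c n))\<^sup>2) = (\<Sum>g\<in>G. (norm (dft M N c g))\<^sup>2) / of_nat M"
  unfolding mat_app_band_mat parseval[OF assms]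
  by (simp add: norm_divide power_divide sum_divide_distrib[symmetric] power2_eq_square)

lemma cip_band_mat:
  "cip N (mat_app N (band_mat M G) c) c = of_real ((\<Sum>g\<in>G. (norm (dft M N c g))\<^sup>2) / of_nat M)"
proof -
  have "cip N (mat_app N (band_mat M G) c) c
      = (\<Sum>g\<in>G. dft M N c g / of_nat M * cip N (\<lambda>n. unity_pow M (int g * int n)) c)"
    unfolding mat_app_band_mat[abs_def] by (rule cip_sum_left)
  also have "\<dots> = (\<Sum>g\<in>G. dft M N c g / of_nat M * cnj (dft M N c g))"
    by (simp add: cip_def dft_def cnj_sum cnj_unity_pow mult.commute)
  also have "\<dots> = of_real ((\<Sum>g\<in>G. (norm (dft M N c g))\<^sup>2) / of_nat M)"
    unfolding of_real_divide of_real_sum complex_norm_square sum_divide_distrib by simp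
  finally show ?thesis .
qed

lemma dft_parseval:
  assumes "N \<le> M"
  shows "(\<Sum>g<M. (norm (dft M N c g))\<^sup>2) = of_nat M * (\<Sum>n<N. (norm (c n))\<^sup>2)"
proof -
  have "norm (dft M N c g) = norm (\<Sum>n<N. cnj (c n) * unity_pow M (int n * int g))" for g
  proof -
    have "(\<Sum>n<N. cnj (c n) * unity_pow M (int n * int g)) = cnj (dft M N c g)"
      by (simp add: dft_def cnj_sum cnj_unity_pow mult.commute)
    then show ?thesis by simp
  qed
  then show ?thesis using parseval[of "{..<N}" M "\<lambda>n. cnj (c n)"] assms by auto
qed

lemma dft_conv_cip: "dft M N c g = cip N c (\<lambda>n. unity_pow M (int g * int n))"
  by (simp add: dft_def cip_def cnj_unity_pow)

section \<open>Chords of the unit circle and expansion of the Cauchy kernel\<close>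

lemma norm_unity_pow_diff: "norm (unity_pow M a - unity_pow M b) = 2 * \<bar>sin (pi * of_int (a - b) / of_nat M)\<bar>"
proof -
  have "unity_pow M a - unity_pow M b = unity_pow M b * (unity_pow M (a - b) - 1)"
    by (simp add: right_diff_distrib flip: unity_pow_add)
  then have "norm (unity_pow M a - unity_pow M b) = norm (exp (\<i> * of_real (2 * pi * of_int (a - b) / of_nat M)) - 1)"
    by (simp add: norm_mult) (simp add: unity_pow_def cis_conv_exp)
  also have "\<dots> = 2 * \<bar>sin (pi * of_int (a - b) / of_nat M)\<bar>"
    unfolding dist_exp_i_1 by (simp add: mult.assoc)
  finally show ?thesis .
qed

lemma half_le_sin:
  assumes "0 \<le> x" "x \<le> pi / 2"
  shows "x / 2 \<le> sin x"
proof -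
  have "\<bar>sin x - (\<Sum>m<3. sin_coeff m * x ^ m)\<bar> \<le> inverse (fact 3) * \<bar>x\<bar> ^ 3"
    by (rule Maclaurin_sin_bound)
  then have "\<bar>sin x - x\<bar> \<le> x ^ 3 / 6"
    using assms by (simp add: eval_nat_numeral sin_coeff_def)
  moreover have "x ^ 3 / 6 \<le> x / 2"
  proof -
    \<comment> \<open>The cubic error is at most half of \<open>x\<close> as soon as
      \<open>x * x \<le> 3\<close>, and \<open>1.6 * 1.6 = 2.56\<close>.\<close>
    have "pi \<le> 3.2" using pi_approx by simp
    then have "x \<le> 1.6" using assms by linarith
    then have "x * x \<le> 1.6 * 1.6" using assms by (intro mult_mono) auto
    then have "x * (x * x) \<le> x * 3" using assms by (intro mult_left_mono) auto
    then show ?thesis by (simp add: power3_eq_cube mult.assoc)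
  qed
  ultimately show ?thesis by linarith
qed

lemma unity_pow_diff_upper: "norm (unity_pow M a - unity_pow M b) \<le> 2 * pi * \<bar>of_int (a - b)\<bar> / of_nat M"
  unfolding norm_unity_pow_diff
  using abs_sin_x_le_abs_x[of "pi * of_int (a - b) / of_nat M"] by (simp add: abs_mult)

text \<open>\<open>d\<close> bounds from below the distance of \<open>a - b\<close> to both ends of
  a full turn. Past half a turn the sine is reflected, so the shorter arc decides.\<close>

lemma unity_pow_diff_lower:
  assumes "0 \<le> d" "d \<le> a - b" "a - b \<le> int M - d" "M > 0"
  shows "norm (unity_pow M a - unity_pow M b) \<ge> pi * of_int d / of_nat M"
proof -
  define j where "j = a - b"
  have M: "real M > 0" using assms by simp
  define x where "x = pi * of_int j / of_nat M"
  define e where "e = pi * of_int d / of_nat M"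
  have "e / 2 \<le> sin x"
  proof (cases "2 * j \<le> int M")
    case True
    have "2 * real_of_int j \<le> real M" using True by linarith
    then have "x \<le> pi / 2" using M by (simp add: field_simps x_def)
    moreover have "x \<ge> 0" using assms by (simp add: j_def x_def)
    ultimately have "x / 2 \<le> sin x" by (intro half_le_sin) auto
    moreover have "e \<le> x"
      using assms unfolding e_def x_def by (intro divide_right_mono mult_left_mono) (auto simp: j_def)
    ultimately show ?thesis by linarith
  next
    case False
    have x: "pi - x = pi * of_int (int M - j) / of_nat M"
      using M by (simp add: x_def field_simps)
    have "real_of_int (2 * (int M - j)) \<le> real_of_int (int M)"
      unfolding of_int_le_iff using False by simp
    then have "2 * real_of_int (int M - j) \<le> real M" by simp
    then have "pi - x \<le> pi / 2" unfolding x using M by (simp add: field_simps)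
    moreover have "pi - x \<ge> 0" using assms unfolding x by (simp add: j_def)
    ultimately have "(pi - x) / 2 \<le> sin (pi - x)" by (intro half_le_sin) auto
    moreover have "e \<le> pi - x"
      using assms unfolding e_def x by (intro divide_right_mono mult_left_mono) (auto simp: j_def)
    ultimately show ?thesis by simp
  qed
  then show ?thesis unfolding norm_unity_pow_diff j_def[symmetric] x_def[symmetric] e_def[symmetric] by linarith
qed

text \<open>The moment conditions kill the first \<open>l\<close> terms of the geometric series of the Cauchy kernel
  about \<open>a\<close>, so only its tail contributes.\<close>

lemma cauchy_sum_tail:
  fixes x :: "'i \<Rightarrow> complex" and X a :: complex
  assumes fin: "finite \<Gamma>"
    and moments: "\<And>j. j < l \<Longrightarrow> (\<Sum>m\<in>\<Gamma>. \<beta> m * (x m - a) ^ j) = 0"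
    and ratio: "\<And>m. m \<in> \<Gamma> \<Longrightarrow> norm (x m - a) \<le> \<rho> * norm (X - a)"
    and ne: "X \<noteq> a" "\<And>m. m \<in> \<Gamma> \<Longrightarrow> X \<noteq> x m" and \<rho>: "\<rho> \<ge> 0"
  shows "norm (\<Sum>m\<in>\<Gamma>. \<beta> m / (X - x m)) \<le> \<rho> ^ l * (\<Sum>m\<in>\<Gamma>. norm (\<beta> m) / norm (X - x m))"
proof -
  define q where "q = (\<lambda>m. (x m - a) / (X - a))"
  have expand: "1 / (X - x m) = (\<Sum>j<l. q m ^ j) / (X - a) + q m ^ l / (X - x m)" if m: "m \<in> \<Gamma>" for m
  proof -
    have qd: "X - x m = (X - a) * (1 - q m)" using ne by (simp add: q_def field_simps)
    have ne': "1 - q m \<noteq> 0" using qd ne m by auto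
    have "(\<Sum>j<l. q m ^ j) = (1 - q m ^ l) / (1 - q m)"
      using sum_gp_strict[of "q m" l] ne' by auto
    then have "(\<Sum>j<l. q m ^ j) / (X - a) = (1 - q m ^ l) / (X - x m)"
      unfolding qd by simp
    then show ?thesis by (simp add: diff_divide_distrib)
  qed
  have "(\<Sum>m\<in>\<Gamma>. \<beta> m * ((\<Sum>j<l. q m ^ j) / (X - a))) = 0"
  proof -
    have "(\<Sum>m\<in>\<Gamma>. \<beta> m * ((\<Sum>j<l. q m ^ j) / (X - a)))
        = (\<Sum>m\<in>\<Gamma>. \<Sum>j<l. \<beta> m * (x m - a) ^ j * (1 / (X - a) ^ Suc j))"
      by (simp add: q_def sum_distrib_left sum_divide_distrib power_divide field_simps)
    also have "\<dots> = (\<Sum>j<l. \<Sum>m\<in>\<Gamma>. \<beta> m * (x m - a) ^ j * (1 / (X - a) ^ Suc j))"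
      by (rule sum.swap)
    also have "\<dots> = (\<Sum>j<l. (\<Sum>m\<in>\<Gamma>. \<beta> m * (x m - a) ^ j) * (1 / (X - a) ^ Suc j))"
      by (simp only: sum_distrib_right)
    also have "\<dots> = 0" using moments by (intro sum.neutral) simp
    finally show ?thesis .
  qed
  moreover have "(\<Sum>m\<in>\<Gamma>. \<beta> m / (X - x m)) = (\<Sum>m\<in>\<Gamma>. \<beta> m * ((\<Sum>j<l. q m ^ j) / (X - a)) + \<beta> m * (q m ^ l / (X - x m)))"
    by (intro sum.cong refl) (metis distrib_left expand mult.right_neutral times_divide_eq_right)
  ultimately have "(\<Sum>m\<in>\<Gamma>. \<beta> m / (X - x m)) = (\<Sum>m\<in>\<Gamma>. \<beta> m * (q m ^ l / (X - x m)))"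
    by (simp add: sum.distrib)
  also have "norm \<dots> \<le> (\<Sum>m\<in>\<Gamma>. norm (\<beta> m * (q m ^ l / (X - x m))))"
    by (rule norm_sum)
  also have "\<dots> \<le> (\<Sum>m\<in>\<Gamma>. \<rho> ^ l * (norm (\<beta> m) / norm (X - x m)))"
  proof (intro sum_mono)
    fix m assume m: "m \<in> \<Gamma>"
    have "norm (q m) \<le> \<rho>"
      using ratio[OF m] ne(1) by (simp add: q_def norm_divide divide_le_eq)
    then have "norm (q m) ^ l \<le> \<rho> ^ l" by (intro power_mono) auto
    then have "norm (q m) ^ l * (norm (\<beta> m) / norm (X - x m)) \<le> \<rho> ^ l * (norm (\<beta> m) / norm (X - x m))"
      by (intro mult_right_mono) auto
    then show "norm (\<beta> m * (q m ^ l / (X - x m))) \<le> \<rho> ^ l * (norm (\<beta> m) / norm (X - x m))"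
      by (simp add: norm_mult norm_divide norm_power mult_ac)
  qed
  finally show ?thesis by (simp add: sum_distrib_left)
qed

text \<open>A geometric sum has two end terms, and each splits into a factor in \<open>n\<close>
  times a factor in \<open>m\<close> over the common denominator. Thus the off-diagonal block is a
  difference of two Cauchy matrices with unimodular row and column weights.\<close>

lemma band_mat_cauchy:
  assumes "n < M" "m < n" "2 * (K + 1) \<le> M"
  shows "band_mat M {K+1..<M-K} n m =
     (unity_pow M (int (M-K) * int n) * unity_pow M (int m - int (M-K) * int m)
      - unity_pow M (int (K+1) * int n) * unity_pow M (int m - int (K+1) * int m))
      / (unity_pow M (int n) - unity_pow M (int m)) / of_nat M"
proof -
  define z where "z = unity_pow M (int n - int m)"
  have "\<not> int M dvd (int n - int m)"
    using assms zdvd_imp_le[of "int M" "int n - int m"] by auto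
  then have z1: "z \<noteq> 1" using unity_pow_eq_1 assms by (simp add: z_def)
  have xn: "unity_pow M (int n) = unity_pow M (int m) * z"
    by (simp add: z_def flip: unity_pow_add)
  have "(\<Sum>g\<in>{K+1..<M-K}. unity_pow M (int g * (int n - int m))) = (\<Sum>g\<in>{K+1..<M-K}. z ^ g)"
    by (simp add: z_def unity_pow_power)
  also have "\<dots> = (z ^ (M-K) - z ^ (K+1)) / (z - 1)"
  proof -
    have "(\<Sum>g\<in>{K+1..<M-K}. z ^ g) * (z - 1) = (\<Sum>g\<in>{K+1..<M-K}. z ^ Suc g - z ^ g)"
      unfolding sum_distrib_right by (intro sum.cong refl) (simp add: algebra_simps)
    also have "\<dots> = z ^ (M-K) - z ^ (K+1)"
      by (rule sum_Suc_diff') (use assms in simp)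
    finally show ?thesis using z1 by (simp add: eq_divide_eq)
  qed
  also have "\<dots> = unity_pow M (int m) * (z ^ (M-K) - z ^ (K+1)) / (unity_pow M (int n) - unity_pow M (int m))"
  proof -
    have "unity_pow M (int m) \<noteq> 0" using norm_unity_pow by (metis norm_zero zero_neq_one)
    moreover have "unity_pow M (int n) - unity_pow M (int m) = unity_pow M (int m) * (z - 1)"
      by (simp add: xn algebra_simps)
    ultimately show ?thesis using z1 by simp
  qed
  finally have *: "(\<Sum>g\<in>{K+1..<M-K}. unity_pow M (int g * (int n - int m)))
     = unity_pow M (int m) * (z ^ (M-K) - z ^ (K+1)) / (unity_pow M (int n) - unity_pow M (int m))" .
  have **: "unity_pow M (int m) * z ^ A = unity_pow M (int A * int n) * unity_pow M (int m - int A * int m)" for A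
    by (simp add: z_def unity_pow_power algebra_simps flip: unity_pow_add)
  show ?thesis
    unfolding band_mat_def * unfolding right_diff_distrib[of "unity_pow M (int m)"] ** ..
qed

text \<open>The classes of \<open>log_class N\<close> form a Whitney decomposition of \<open>{0..<N}\<close>:
  every class is short compared with its distance to the complement.\<close>

definition log_class :: "nat \<Rightarrow> nat \<Rightarrow> bool \<times> nat" where
  "log_class N m = (if 2 * m + 1 \<le> N then (True, nat \<lfloor>log (5/4) (real (m + 1))\<rfloor>)
                    else (False, nat \<lfloor>log (5/4) (real (N - m))\<rfloor>))"

text \<open>Integers on the same level lie between \<open>(5/4) ^ k\<close> and
  \<open>(5/4) ^ (k + 1)\<close>, an interval whose length is a quarter of its left end. This is the
  reason for the base \<open>5/4\<close>.\<close>

lemma nat_floor_log_eqD: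
  assumes "nat \<lfloor>log (5/4) (real x)\<rfloor> = nat \<lfloor>log (5/4) (real y)\<rfloor>" "x > 0" "y > 0"
  shows "4 * \<bar>real x - real y\<bar> \<le> min (real x) (real y)"
proof -
  define k where "k = nat \<lfloor>log (5/4) (real x)\<rfloor>"
  have *: "(5/4) ^ k \<le> real z \<and> real z < (5/4) * (5/4) ^ k" if "k = nat \<lfloor>log (5/4) (real z)\<rfloor>" "z > 0" for z :: nat
  proof -
    have "log (5/4) (real z) \<ge> 0" using that by (intro zero_le_log_cancel_iff[THEN iffD2]) auto
    then have "real k \<le> log (5/4) (real z)" "log (5/4) (real z) < real k + 1"
      using that(1) by linarith+
    then have "(5/4) powr real k \<le> real z" "real z < (5/4) powr (real k + 1)"
      using that(2) by (simp_all add: le_log_iff log_less_iff)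
    then show ?thesis by (simp add: powr_realpow powr_add)
  qed
  have "(5/4) ^ k \<le> real x \<and> real x < (5/4) * (5/4) ^ k" "(5/4) ^ k \<le> real y \<and> real y < (5/4) * (5/4) ^ k"
    by (rule *; use assms in \<open>simp add: k_def\<close>)+
  then show ?thesis by (auto simp: min_def abs_if)
qed

text \<open>The minimum is the distance from \<open>a\<close> to the nearest integer outside
  \<open>{0..<N}\<close>. The factor 4 makes up for the factor 2 between the upper and lower chord
  bounds and still leaves the expansion ratio \<open>1/2\<close>.\<close>

lemma log_class_eqD:
  assumes "log_class N a = log_class N m" "a < N" "m < N"
  shows "4 * \<bar>int m - int a\<bar> \<le> min (int a + 1) (int (N - a))"
proof (cases "2 * a + 1 \<le> N")
  case True
  then have eq: "2 * m + 1 \<le> N" "nat \<lfloor>log (5/4) (real (a + 1))\<rfloor> = nat \<lfloor>log (5/4) (real (m + 1))\<rfloor>"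
    using assms(1) by (auto simp: log_class_def split: if_splits)
  then have "4 * \<bar>real (a + 1) - real (m + 1)\<bar> \<le> real (a + 1)"
    using nat_floor_log_eqD[of "a + 1" "m + 1"] by force
  then have "real_of_int (4 * \<bar>int m - int a\<bar>) \<le> real_of_int (int a + 1)"
    by (simp add: abs_minus_commute add.commute)
  then have "4 * \<bar>int m - int a\<bar> \<le> int a + 1" by (simp only: of_int_le_iff)
  then show ?thesis using True assms by linarith
next
  case False
  then have eq: "\<not> 2 * m + 1 \<le> N" "nat \<lfloor>log (5/4) (real (N - a))\<rfloor> = nat \<lfloor>log (5/4) (real (N - m))\<rfloor>"
    using assms(1) by (auto simp: log_class_def split: if_splits)
  then have "4 * \<bar>real (N - a) - real (N - m)\<bar> \<le> real (N - a)"
    using nat_floor_log_eqD[of "N - a" "N - m"] assms by force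
  then have "real_of_int (4 * \<bar>int m - int a\<bar>) \<le> real_of_int (int (N - a))"
    using assms by (simp add: of_nat_diff)
  then have "4 * \<bar>int m - int a\<bar> \<le> int (N - a)" by (simp only: of_int_le_iff)
  then show ?thesis using False assms by linarith
qed

definition log_classes :: "nat \<Rightarrow> (bool \<times> nat) set" where
  "log_classes N = UNIV \<times> {..nat \<lfloor>log (5/4) (real N)\<rfloor>}"

lemma log_class_in: "m < N \<Longrightarrow> log_class N m \<in> log_classes N"
  unfolding log_class_def log_classes_def
  by (auto intro!: nat_mono floor_mono)

lemma finite_log_classes: "finite (log_classes N)"
  by (simp add: log_classes_def)

lemma card_log_classes: "card (log_classes N) = 2 * (nat \<lfloor>log (5/4) (real N)\<rfloor> + 1)"
  by (simp add: log_classes_def card_cartesian_product)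

text \<open>Any member of a class serves as expansion point, so an arbitrary choice replaces a
  midpoint.\<close>

definition class_centre :: "nat \<Rightarrow> bool \<times> nat \<Rightarrow> nat" where
  "class_centre N \<gamma> = (SOME m. m < N \<and> log_class N m = \<gamma>)"

lemma class_centre:
  assumes "m < N" shows "class_centre N (log_class N m) < N"
    "log_class N (class_centre N (log_class N m)) = log_class N m"
  using someI[of "\<lambda>m'. m' < N \<and> log_class N m' = log_class N m" m] assms
  unfolding class_centre_def by auto

text \<open>The index \<open>A\<close> selects one of the two exponentials in the numerator of \<open>band_mat_cauchy\<close>.\<close>

definition moment_weight ::
    "nat \<Rightarrow> nat \<Rightarrow> nat \<times> (bool \<times> nat) \<times> nat \<Rightarrow> nat \<Rightarrow> complex" where
  "moment_weight M N = (\<lambda>(A, \<gamma>, j) m. if log_class N m = \<gamma>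
      then unity_pow M (int m - int A * int m) *
           (unity_pow M (int m) - unity_pow M (int (class_centre N \<gamma>))) ^ j else 0)"

text \<open>The kernel is expanded on each class about its chosen member. For \<open>n\<close>
  outside the window the ratio is at most \<open>1/2\<close>, so \<open>l\<close> vanishing moments
  gain \<open>(1/2) ^ l\<close>; the remaining denominators are bounded crudely by
  \<open>3 / real M\<close>, using \<open>pi > 3\<close>.\<close>

lemma cauchy_sum_small:
  assumes n: "N \<le> n" "n < M"
    and moments: "\<And>\<gamma> j. \<gamma> \<in> log_classes N \<Longrightarrow> j < l \<Longrightarrow> (\<Sum>m<N. moment_weight M N (A, \<gamma>, j) m * c m) = 0"
  shows "norm (\<Sum>m<N. c m * unity_pow M (int m - int A * int m) / (unity_pow M (int n) - unity_pow M (int m)))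
     \<le> (1/2) ^ l * (real M / 3 * (\<Sum>m<N. norm (c m)))"
proof -
  define x where "x = (\<lambda>m. unity_pow M (int m))"
  define \<beta> where "\<beta> = (\<lambda>m. c m * unity_pow M (int m - int A * int m))"
  define \<Gamma> where "\<Gamma> = (\<lambda>\<gamma>. {m\<in>{..<N}. log_class N m = \<gamma>})"
  have M: "M > 0" using n by simp
  have lower: "norm (x n - x m) \<ge> pi * of_int (min (int m + 1) (int (N - m))) / real M" if "m < N" for m
    unfolding x_def using that n by (intro unity_pow_diff_lower) auto
  have lower3: "norm (x n - x m) \<ge> 3 / real M" if "m < N" for m
  proof -
    have "3 * 1 \<le> pi * of_int (min (int m + 1) (int (N - m)))"
      using that pi_gt3 by (intro mult_mono) auto
    then have "3 / real M \<le> pi * of_int (min (int m + 1) (int (N - m))) / real M"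
      by (intro divide_right_mono) (simp_all only: mult_1_right of_nat_0_le_iff)
    then show ?thesis using lower[OF that] by linarith
  qed
  have ne: "x n \<noteq> x m" if "m < N" for m
    using lower3[OF that] M by auto
  have piece: "norm (\<Sum>m\<in>\<Gamma> \<gamma>. \<beta> m / (x n - x m)) \<le> (1/2) ^ l * (\<Sum>m\<in>\<Gamma> \<gamma>. norm (\<beta> m) / norm (x n - x m))"
    if \<gamma>: "\<gamma> \<in> log_classes N" for \<gamma>
  proof (cases "\<Gamma> \<gamma> = {}")
    case False
    define a where "a = class_centre N \<gamma>"
    obtain m0 where "m0 < N" "log_class N m0 = \<gamma>" using False by (auto simp: \<Gamma>_def)
    then have a: "a < N" "log_class N a = \<gamma>" using class_centre[of m0 N] by (auto simp: a_def)
    show ?thesis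
    proof (rule cauchy_sum_tail[where a = "x a"])
      show "finite (\<Gamma> \<gamma>)" by (simp add: \<Gamma>_def)
      show "(\<Sum>m\<in>\<Gamma> \<gamma>. \<beta> m * (x m - x a) ^ j) = 0" if "j < l" for j
      proof -
        have "(\<Sum>m\<in>\<Gamma> \<gamma>. \<beta> m * (x m - x a) ^ j) = (\<Sum>m<N. if log_class N m = \<gamma> then \<beta> m * (x m - x a) ^ j else 0)"
          unfolding \<Gamma>_def by (rule sum.inter_filter) simp
        also have "\<dots> = (\<Sum>m<N. moment_weight M N (A, \<gamma>, j) m * c m)"
          by (intro sum.cong refl) (simp add: moment_weight_def \<beta>_def x_def a_def)
        finally show ?thesis using moments[OF \<gamma> that] by simp
      qed
      show "norm (x m - x a) \<le> 1/2 * norm (x n - x a)" if m: "m \<in> \<Gamma> \<gamma>" for m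
      proof -
        define d where "d = min (int a + 1) (int (N - a))"
        have "4 * \<bar>int m - int a\<bar> \<le> d"
          using m a log_class_eqD[of N a m] by (auto simp: \<Gamma>_def d_def)
        then have "real_of_int (4 * \<bar>int m - int a\<bar>) \<le> real_of_int d"
          by (simp only: of_int_le_iff)
        then have "pi * (4 * real_of_int \<bar>int m - int a\<bar>) / M \<le> pi * real_of_int d / M"
          by (intro divide_right_mono mult_left_mono) auto
        then have "4 * (pi * real_of_int \<bar>int m - int a\<bar> / real M) \<le> pi * real_of_int d / M"
          by (simp add: mult_ac)
        moreover have "norm (x m - x a) \<le> 2 * (pi * real_of_int \<bar>int m - int a\<bar> / real M)"
          unfolding x_def using unity_pow_diff_upper[of M "int m" "int a"] by simp
        moreover have "norm (x n - x a) \<ge> pi * real_of_int d / M"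
          using lower[OF a(1)] by (simp add: d_def)
        ultimately show ?thesis by linarith
      qed
      show "x n \<noteq> x a" using ne a by auto
      show "x n \<noteq> x m" if "m \<in> \<Gamma> \<gamma>" for m using ne that by (auto simp: \<Gamma>_def)
    qed simp
  qed simp
  have group: "(\<Sum>m<N. h m) = (\<Sum>\<gamma>\<in>log_classes N. \<Sum>m\<in>\<Gamma> \<gamma>. h m)" for h :: "nat \<Rightarrow> 'b::comm_monoid_add"
    unfolding \<Gamma>_def
    by (rule sum.group[symmetric]) (auto simp: finite_log_classes log_class_in)
  have "norm (\<Sum>m<N. \<beta> m / (x n - x m)) \<le> (\<Sum>\<gamma>\<in>log_classes N. norm (\<Sum>m\<in>\<Gamma> \<gamma>. \<beta> m / (x n - x m)))"
    unfolding group by (rule norm_sum)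
  also have "\<dots> \<le> (\<Sum>\<gamma>\<in>log_classes N. (1/2) ^ l * (\<Sum>m\<in>\<Gamma> \<gamma>. norm (\<beta> m) / norm (x n - x m)))"
    by (intro sum_mono piece)
  also have "\<dots> = (1/2) ^ l * (\<Sum>m<N. norm (\<beta> m) / norm (x n - x m))"
    unfolding group by (simp add: sum_distrib_left)
  also have "\<dots> \<le> (1/2) ^ l * (\<Sum>m<N. real M / 3 * norm (c m))"
  proof (intro mult_left_mono sum_mono)
    fix m assume m: "m \<in> {..<N}"
    have "norm (\<beta> m) / norm (x n - x m) \<le> norm (\<beta> m) / (3 / real M)"
      using m M lower3[of m] by (intro divide_left_mono mult_pos_pos) auto
    then show "norm (\<beta> m) / norm (x n - x m) \<le> real M / 3 * norm (c m)"
      by (simp add: \<beta>_def norm_mult mult_ac)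
  qed simp
  finally show ?thesis by (simp add: \<beta>_def x_def sum_distrib_left)
qed

text \<open>Rows outside the window see only the tails of the two Cauchy sums. Cauchy-Schwarz costs
  a factor \<open>N\<close>, the number of rows a factor \<open>M\<close>, and squaring turns
  \<open>(1/2) ^ l\<close> into \<open>(1/4) ^ l\<close>.\<close>

lemma band_mat_leak_small:
  assumes N: "0 < N" "N \<le> M" and K: "2 * (K + 1) \<le> M"
    and moments: "\<And>e. e \<in> {M - K, K + 1} \<times> log_classes N \<times> {..<l} \<Longrightarrow> (\<Sum>m<N. moment_weight M N e m * c m) = 0"
  shows "(\<Sum>n\<in>{N..<M}. (norm (mat_app N (band_mat M {K+1..<M-K}) c n))\<^sup>2)
    \<le> real M * (real N * (1/4) ^ l) * (\<Sum>m<N. (norm (c m))\<^sup>2)"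
proof -
  define s where "s = (\<Sum>m<N. (norm (c m))\<^sup>2)"
  have M: "M > 0" using N by simp
  have s0: "s \<ge> 0" by (simp add: s_def sum_nonneg)
  have l1: "(\<Sum>m<N. norm (c m))\<^sup>2 \<le> real N * s"
    using Cauchy_Schwarz_ineq_sum[of "\<lambda>_. 1" "\<lambda>m. norm (c m)" "{..<N}"] by (simp add: s_def)
  have "(norm (mat_app N (band_mat M {K+1..<M-K}) c n))\<^sup>2 \<le> real N * (1/4) ^ l * s" if n: "n \<in> {N..<M}" for n
  proof -
    define F where "F = (\<lambda>A. \<Sum>m<N. c m * unity_pow M (int m - int A * int m) / (unity_pow M (int n) - unity_pow M (int m)))"
    have F: "norm (F A) \<le> (1/2) ^ l * (real M / 3 * (\<Sum>m<N. norm (c m)))" if "A \<in> {M - K, K + 1}" for A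
      unfolding F_def using n moments that by (intro cauchy_sum_small) auto
    have factor: "(p * q - p' * q') / D / w * b = (p * (b * q / D) - p' * (b * q' / D)) / w"
      for p q p' q' D w b :: complex
      by (simp add: diff_divide_distrib left_diff_distrib right_diff_distrib mult_ac)
    have "mat_app N (band_mat M {K+1..<M-K}) c n
        = (unity_pow M (int (M-K) * int n) * F (M-K) - unity_pow M (int (K+1) * int n) * F (K+1)) / of_nat M"
      unfolding mat_app_def F_def sum_distrib_left sum_subtractf[symmetric] sum_divide_distrib
    proof (intro sum.cong refl)
      fix m assume "m \<in> {..<N}"
      then have "band_mat M {K+1..<M-K} n m =
       (unity_pow M (int (M-K) * int n) * unity_pow M (int m - int (M-K) * int m)
        - unity_pow M (int (K+1) * int n) * unity_pow M (int m - int (K+1) * int m))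
        / (unity_pow M (int n) - unity_pow M (int m)) / of_nat M"
        using n K by (intro band_mat_cauchy) auto
      then show "band_mat M {K+1..<M-K} n m * c m =
        (unity_pow M (int (M-K) * int n) * (c m * unity_pow M (int m - int (M-K) * int m) / (unity_pow M (int n) - unity_pow M (int m)))
        - unity_pow M (int (K+1) * int n) * (c m * unity_pow M (int m - int (K+1) * int m) / (unity_pow M (int n) - unity_pow M (int m)))) / of_nat M"
        by (simp only: factor)
    qed
    also have "norm \<dots> \<le> (norm (F (M-K)) + norm (F (K+1))) / real M"
      unfolding norm_divide by (intro divide_mono order_trans[OF norm_triangle_ineq4]) (use M in \<open>auto simp: norm_mult\<close>)
    also have "\<dots> \<le> (2 * ((1/2) ^ l * (real M / 3 * (\<Sum>m<N. norm (c m))))) / real M"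
      using F[of "M-K"] F[of "K+1"] by (intro divide_right_mono) auto
    also have "\<dots> = 2 / 3 * ((1/2) ^ l * (\<Sum>m<N. norm (c m)))"
      using M by simp
    also have "\<dots> \<le> 1 * ((1/2) ^ l * (\<Sum>m<N. norm (c m)))"
      by (intro mult_right_mono mult_nonneg_nonneg sum_nonneg) auto
    finally have bound: "norm (mat_app N (band_mat M {K+1..<M-K}) c n) \<le> (1/2) ^ l * (\<Sum>m<N. norm (c m))"
      by simp
    have half_pow: "((1/2::real) ^ l)\<^sup>2 = (1/4) ^ l"
      by (simp add: power2_eq_square flip: power_mult_distrib)
    have "(norm (mat_app N (band_mat M {K+1..<M-K}) c n))\<^sup>2 \<le> ((1/2) ^ l * (\<Sum>m<N. norm (c m)))\<^sup>2"
      by (intro power_mono bound) auto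
    also have "\<dots> = (1/4) ^ l * (\<Sum>m<N. norm (c m))\<^sup>2"
      by (simp add: half_pow power_mult_distrib)
    also have "\<dots> \<le> (1/4) ^ l * (real N * s)"
      using l1 by (intro mult_left_mono) auto
    finally show ?thesis by (simp add: mult_ac)
  qed
  then have "(\<Sum>n\<in>{N..<M}. (norm (mat_app N (band_mat M {K+1..<M-K}) c n))\<^sup>2) \<le> of_nat (card {N..<M}) * (real N * (1/4) ^ l * s)"
    by (intro sum_bounded_above)
  also have "\<dots> \<le> real M * (real N * (1/4) ^ l * s)"
    using s0 by (intro mult_right_mono mult_nonneg_nonneg) auto
  finally show ?thesis by (simp add: s_def mult_ac)
qed

section \<open>Eigenvalue count for the outer band\<close>

text \<open>The projection is onto the outer band, so the wanted vectors are those with eigenvalue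
  at most \<open>\<delta>\<close>, whose outer energy is then bounded directly. The first subtracted
  term counts eigenvalues near 1 through the trace, the second the intermediate ones.\<close>

lemma time_frequency_subspace:
  fixes N M K l :: nat and \<delta> :: real
  assumes N: "0 < N" "N \<le> M" and K: "2 * (K + 1) \<le> M"
    and \<delta>: "0 < \<delta>" "\<delta> \<le> 1/2" and l: "real M * (real N * (1/4) ^ l) < \<delta> / 2"
  shows "\<exists>(S :: nat set) u. finite S \<and> orthonormal N S u
    \<and> real (card S) \<ge> real N - real N * real (M - K - (K + 1)) / real M / (1 - \<delta>)
          - real (4 * l * (nat \<lfloor>log (5/4) (real N)\<rfloor> + 1))
    \<and> (\<forall>d. (\<Sum>g\<in>{K+1..<M-K}. (norm (dft M N (\<lambda>m. \<Sum>i\<in>S. d i * u i m) g))\<^sup>2)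
          \<le> real M * (\<delta> * (\<Sum>i\<in>S. (norm (d i))\<^sup>2)))"
proof -
  define G where "G = {K+1..<M-K}"
  have G: "G \<subseteq> {..<M}" by (auto simp: G_def)
  have M: "real M > 0" using N by simp
  define T where "T = band_mat M G"
  obtain u and lam :: "nat \<Rightarrow> real" where on: "orthonormal N {..<N} u"
    and eig: "\<And>i m. i < N \<Longrightarrow> m < N \<Longrightarrow> mat_app N T (u i) m = of_real (lam i) * u i m"
    using hermitian_eigenbasis[of N T] band_mat_hermitian unfolding T_def by metis
  have on_sub: "orthonormal N S u" if "S \<subseteq> {..<N}" for S
    using on that unfolding orthonormal_def by blast
  define comb where "comb = (\<lambda>S d m. \<Sum>i\<in>S. d i * u i m)"
  have Tcomb: "mat_app N T (comb S d) m = comb S (\<lambda>i. d i * of_real (lam i)) m" if "S \<subseteq> {..<N}" "m < N" for S d m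
    unfolding comb_def mat_app_sum using eig that by (intro sum.cong refl) auto
  have normsq: "(\<Sum>m<N. (norm (comb S d m))\<^sup>2) = (\<Sum>i\<in>S. (norm (d i))\<^sup>2)" if "S \<subseteq> {..<N}" for S d
    unfolding comb_def using on_sub[OF that] finite_subset[OF that]
    by (intro orthonormal_norm_comb) auto
  have energy: "(\<Sum>g\<in>G. (norm (dft M N (comb S d) g))\<^sup>2) / real M = (\<Sum>i\<in>S. lam i * (norm (d i))\<^sup>2)"
    if "S \<subseteq> {..<N}" for S d
  proof -
    have "finite S" using that finite_subset by blast
    have "complex_of_real ((\<Sum>g\<in>G. (norm (dft M N (comb S d) g))\<^sup>2) / real M)
        = cip N (mat_app N T (comb S d)) (comb S d)"
      by (simp only: T_def cip_band_mat)
    also have "\<dots> = cip N (comb S (\<lambda>i. d i * of_real (lam i))) (comb S d)"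
      using Tcomb[OF that] by (intro cip_cong) auto
    also have "\<dots> = (\<Sum>i\<in>S. d i * of_real (lam i) * cnj (d i))"
      unfolding comb_def by (rule orthonormal_cip_sum) (use on_sub[OF that] \<open>finite S\<close> in auto)
    also have "\<dots> = of_real (\<Sum>i\<in>S. lam i * (norm (d i))\<^sup>2)"
      unfolding of_real_sum of_real_mult complex_norm_square by (simp only: mult_ac)
    finally show ?thesis using of_real_eq_iff by blast
  qed
  \<comment> \<open>Over all \<open>M\<close> rows the squared norm is the quadratic form, with
    weights \<open>lam i\<close>; the rows below \<open>N\<close> account for
    \<open>(lam i)\<^sup>2\<close>. The difference leaks out of the window.\<close>
  have leak: "(\<Sum>n\<in>{N..<M}. (norm (mat_app N T (comb S d) n))\<^sup>2) = (\<Sum>i\<in>S. lam i * (1 - lam i) * (norm (d i))\<^sup>2)"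
    if "S \<subseteq> {..<N}" for S d
  proof -
    have "(\<Sum>n<M. (norm (mat_app N T (comb S d) n))\<^sup>2)
        = (\<Sum>n<N. (norm (mat_app N T (comb S d) n))\<^sup>2) + (\<Sum>n\<in>{N..<M}. (norm (mat_app N T (comb S d) n))\<^sup>2)"
      using N(2) by (simp add: lessThan_atLeast0 sum.atLeastLessThan_concat)
    moreover have "(\<Sum>n<M. (norm (mat_app N T (comb S d) n))\<^sup>2) = (\<Sum>i\<in>S. lam i * (norm (d i))\<^sup>2)"
      unfolding T_def norm_mat_app_band_mat[OF G] by (rule energy[OF that])
    moreover have "(\<Sum>n<N. (norm (mat_app N T (comb S d) n))\<^sup>2) = (\<Sum>n<N. (norm (comb S (\<lambda>i. d i * of_real (lam i)) n))\<^sup>2)"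
      using Tcomb[OF that] by (intro sum.cong) auto
    moreover have "\<dots> = (\<Sum>i\<in>S. (lam i)\<^sup>2 * (norm (d i))\<^sup>2)"
      unfolding normsq[OF that] by (simp add: norm_mult power_mult_distrib mult.commute)
    ultimately have "(\<Sum>n\<in>{N..<M}. (norm (mat_app N T (comb S d) n))\<^sup>2)
       = (\<Sum>i\<in>S. lam i * (norm (d i))\<^sup>2) - (\<Sum>i\<in>S. (lam i)\<^sup>2 * (norm (d i))\<^sup>2)"
      by linarith
    then show ?thesis by (simp add: sum_subtractf[symmetric] algebra_simps power2_eq_square)
  qed
  have comb1: "comb {i} (\<lambda>_. 1) = u i" for i by (simp add: comb_def)
  have lam_eq: "lam i = (\<Sum>g\<in>G. (norm (dft M N (u i) g))\<^sup>2) / real M" if "i < N" for i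
    using energy[of "{i}" "\<lambda>_. 1"] that by (simp add: comb1)
  have lam0: "lam i \<ge> 0" if "i < N" for i
    unfolding lam_eq[OF that] by (simp add: sum_nonneg)
  have trace: "(\<Sum>i<N. lam i) \<le> real N * real (card G) / real M"
  proof -
    have "(\<Sum>i<N. lam i) = (\<Sum>i<N. \<Sum>g\<in>G. (norm (dft M N (u i) g))\<^sup>2) / real M"
      by (simp add: lam_eq sum_divide_distrib)
    also have "(\<Sum>i<N. \<Sum>g\<in>G. (norm (dft M N (u i) g))\<^sup>2) = (\<Sum>g\<in>G. \<Sum>i<N. (norm (dft M N (u i) g))\<^sup>2)"
      by (rule sum.swap)
    also have "\<dots> \<le> (\<Sum>g\<in>G. real N)"
    proof (rule sum_mono)
      fix g
      \<comment> \<open>By Bessel, the coefficients of a character against the orthonormal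
        \<open>u\<close> have total energy at most its squared norm \<open>N\<close>, so each
        frequency adds at most \<open>N / M\<close> to the trace.\<close>
      define e where "e = (\<lambda>n. unity_pow M (int g * int n))"
      have "norm (dft M N (u i) g) = norm (cip N e (u i))" for i
        unfolding dft_conv_cip e_def[symmetric] using cip_cnj[of N e "u i"] by (metis complex_mod_cnj)
      then show "(\<Sum>i<N. (norm (dft M N (u i) g))\<^sup>2) \<le> real N"
        using bessel[OF _ on, of e] by (simp add: e_def)
    qed
    finally show ?thesis using M by (simp add: divide_right_mono mult.commute)
  qed
  define Lo where "Lo = {i. i < N \<and> lam i \<le> \<delta>}"
  define Mid where "Mid = {i. i < N \<and> \<delta> < lam i \<and> lam i < 1 - \<delta>}"
  define Hi where "Hi = {i. i < N \<and> 1 - \<delta> \<le> lam i \<and> \<delta> < lam i}"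
  have sub: "Lo \<subseteq> {..<N}" "Mid \<subseteq> {..<N}" "Hi \<subseteq> {..<N}" by (auto simp: Lo_def Mid_def Hi_def)
  have fin: "finite Lo" "finite Mid" "finite Hi" using sub finite_subset by blast+
  have "{..<N} = Lo \<union> (Mid \<union> Hi)" by (auto simp: Lo_def Mid_def Hi_def)
  then have "N \<le> card Lo + (card Mid + card Hi)"
    by (metis card_Un_le card_lessThan add_left_mono order_trans)
  moreover have "real (card Hi) \<le> real N * real (M - K - (K + 1)) / real M / (1 - \<delta>)"
  proof -
    have "real (card Hi) * (1 - \<delta>) \<le> (\<Sum>i\<in>Hi. lam i)"
      by (rule sum_bounded_below) (auto simp: Hi_def)
    also have "\<dots> \<le> (\<Sum>i<N. lam i)"
      using sub lam0 by (intro sum_mono2) auto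
    also have "\<dots> \<le> real N * real (M - K - (K + 1)) / real M" using trace by (simp add: G_def)
    finally show ?thesis using \<delta> by (subst pos_le_divide_eq) auto
  qed
  moreover have "card Mid \<le> 4 * l * (nat \<lfloor>log (5/4) (real N)\<rfloor> + 1)"
  proof (rule ccontr)
    assume "\<not> ?thesis"
    \<comment> \<open>\<open>E\<close> lists the moment conditions: two exponentials, all classes,
      \<open>l\<close> powers. With more intermediate eigenvectors than conditions, some nonzero
      combination satisfies them all; it leaks almost nothing, although its eigenvalues force a leak
      of at least \<open>\<delta> / 2\<close> times its energy.\<close>
    moreover define E where "E = {M - K, K + 1} \<times> log_classes N \<times> {..<l}"
    have finE: "finite E" by (simp add: E_def finite_log_classes)
    have "card E \<le> 2 * (card (log_classes N) * l)"
      unfolding E_def card_cartesian_product by (intro mult_mono) (auto simp: card_insert_if)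
    then have "card E \<le> 4 * l * (nat \<lfloor>log (5/4) (real N)\<rfloor> + 1)"
      by (simp add: card_log_classes algebra_simps)
    ultimately have "card E < card Mid" by linarith
    then obtain d where d: "\<exists>i\<in>Mid. d i \<noteq> 0"
      "\<And>e. e \<in> E \<Longrightarrow> (\<Sum>i\<in>Mid. (\<Sum>m<N. moment_weight M N e m * u i m) * d i) = 0"
      using homogeneous_system[OF finE fin(2), of "\<lambda>e i. \<Sum>m<N. moment_weight M N e m * u i m"] by blast
    have mom: "(\<Sum>m<N. moment_weight M N e m * comb Mid d m) = 0" if "e \<in> E" for e
    proof -
      have "(\<Sum>m<N. moment_weight M N e m * comb Mid d m) = (\<Sum>m<N. \<Sum>i\<in>Mid. moment_weight M N e m * u i m * d i)"
        by (simp add: comb_def sum_distrib_left mult_ac)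
      also have "\<dots> = (\<Sum>i\<in>Mid. (\<Sum>m<N. moment_weight M N e m * u i m) * d i)"
        unfolding sum_distrib_right by (rule sum.swap)
      finally show ?thesis using d(2)[OF that] by simp
    qed
    define s where "s = (\<Sum>i\<in>Mid. (norm (d i))\<^sup>2)"
    obtain i0 where "i0 \<in> Mid" "d i0 \<noteq> 0" using d(1) by blast
    then have s: "s > 0" unfolding s_def using fin by (intro sum_pos2[of _ i0]) auto
    have "(\<Sum>i\<in>Mid. \<delta> / 2 * (norm (d i))\<^sup>2) \<le> (\<Sum>i\<in>Mid. lam i * (1 - lam i) * (norm (d i))\<^sup>2)"
    proof (intro sum_mono mult_right_mono)
      fix i assume "i \<in> Mid"
      then have i: "\<delta> < lam i" "lam i < 1 - \<delta>" by (auto simp: Mid_def)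
      \<comment> \<open>Expanding the product shows that \<open>lam i * (1 - lam i)\<close> is at
        least the value of this parabola at the ends \<open>\<delta>\<close> and
        \<open>1 - \<delta>\<close>.\<close>
      have "0 \<le> (lam i - \<delta>) * (1 - \<delta> - lam i)" using i by simp
      then have "\<delta> * (1 - \<delta>) \<le> lam i * (1 - lam i)" by (simp add: algebra_simps)
      moreover have "\<delta> * (1/2) \<le> \<delta> * (1 - \<delta>)" using \<delta> by (intro mult_left_mono) auto
      ultimately show "\<delta> / 2 \<le> lam i * (1 - lam i)" by simp
    qed simp
    also have "\<dots> \<le> real M * (real N * (1/4) ^ l) * s"
      using band_mat_leak_small[OF N K, of l "comb Mid d"] mom
      unfolding leak[OF sub(2), symmetric] s_def normsq[OF sub(2), symmetric] T_def G_def E_def by blast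
    finally have "\<delta> / 2 * s \<le> real M * (real N * (1/4) ^ l) * s"
      by (simp add: s_def sum_distrib_left)
    then show False using l s by simp
  qed
  then have "real (card Mid) \<le> real (4 * l * (nat \<lfloor>log (5/4) (real N)\<rfloor> + 1))"
    by (simp only: of_nat_le_iff)
  ultimately have "real (card Lo) \<ge> real N - real N * real (M - K - (K + 1)) / real M / (1 - \<delta>)
          - real (4 * l * (nat \<lfloor>log (5/4) (real N)\<rfloor> + 1))"
    by linarith
  moreover have "(\<Sum>g\<in>G. (norm (dft M N (comb Lo d) g))\<^sup>2) \<le> real M * (\<delta> * (\<Sum>i\<in>Lo. (norm (d i))\<^sup>2))" for d
  proof -
    have "(\<Sum>g\<in>G. (norm (dft M N (comb Lo d) g))\<^sup>2) / real M \<le> (\<Sum>i\<in>Lo. \<delta> * (norm (d i))\<^sup>2)"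
      unfolding energy[OF sub(1)] by (intro sum_mono mult_right_mono) (auto simp: Lo_def)
    then show ?thesis using M by (simp add: sum_distrib_left divide_le_eq mult.commute)
  qed
  ultimately show ?thesis
    using fin(1) on_sub[OF sub(1)] unfolding G_def comb_def by blast
qed

section \<open>A smooth bump and its Fourier transform\<close>

text \<open>Rational multiples of \<open>exp (- 1 / (1 - x\<^sup>2))\<close> on \<open>{-1<..<1}\<close>; this family is closed under
  differentiation, so its first member is a smooth bump.\<close>

definition bump_fam :: "real poly \<Rightarrow> nat \<Rightarrow> real \<Rightarrow> real" where
  "bump_fam P k x = (if \<bar>x\<bar> < 1 then poly P x * exp (- 1 / (1 - x\<^sup>2)) / (1 - x\<^sup>2) ^ k else 0)"

text \<open>With \<open>w = 1 - x\<^sup>2\<close>, this is the polynomial factor in the derivative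
  of \<open>P * exp (- 1 / w) / w ^ k\<close> once that is written over
  \<open>w ^ (k + 2)\<close>.\<close>

definition bump_step :: "real poly \<Rightarrow> nat \<Rightarrow> real poly" where
  "bump_step P k = pderiv P * [:1, 0, -1:]\<^sup>2 + P * ([:0, 2 * real k:] * [:1, 0, -1:] - [:0, 2:])"

lemma poly_bump_step:
  "poly (bump_step P k) x = poly (pderiv P) x * (1 - x\<^sup>2)\<^sup>2 + poly P x * (2 * real k * x * (1 - x\<^sup>2) - 2 * x)"
  by (simp add: bump_step_def algebra_simps power2_eq_square)

text \<open>Only the term of index \<open>k + 2\<close> of the exponential series at
  \<open>1 / y\<close> is kept. The two powers beyond \<open>k\<close> make the family vanish
  quadratically at the ends of its support, hence differentiable there with derivative 0.\<close>

lemma power_mult_exp_neg_le: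
  fixes y :: real
  assumes "y > 0"
  shows "exp (- 1 / y) / y ^ k \<le> fact (k + 2) * y\<^sup>2"
proof -
  have "(\<Sum>n\<in>{k+2}. (1/y) ^ n /\<^sub>R fact n) \<le> exp (1/y)"
    unfolding exp_def using summable_exp_generic[of "1/y"] assms
    by (intro sum_le_suminf) auto
  then have "(1/y) ^ (k+2) / fact (k+2) \<le> exp (1/y)" by (simp add: divide_inverse mult.commute)
  then have "exp (- 1 / y) * ((1/y) ^ (k+2) / fact (k+2)) \<le> exp (- 1 / y) * exp (1/y)"
    by (intro mult_left_mono) auto
  also have "\<dots> = 1" by (simp flip: exp_add)
  finally have "exp (- 1 / y) / y ^ k \<le> fact (k + 2) * y ^ 2"
    using assms by (simp add: field_simps power_add power_divide power2_eq_square del: fact_Suc)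
  then show ?thesis .
qed

lemma bump_fam_bound:
  "\<exists>C\<ge>0. \<forall>x y. \<bar>x\<bar> = 1 \<longrightarrow> \<bar>bump_fam P k y\<bar> \<le> C * \<bar>y - x\<bar>\<^sup>2"
proof -
  have "compact (poly P ` {-1..1})"
    by (intro compact_continuous_image continuous_intros) auto
  then obtain B where B: "\<And>y. y \<in> {-1..1} \<Longrightarrow> \<bar>poly P y\<bar> \<le> B"
    using compact_imp_bounded[of "poly P ` {-1..1}"] unfolding bounded_iff by (metis imageI real_norm_def)
  have B0: "B \<ge> 0" using B[of 0] by auto
  define C where "C = B * fact (k + 2) * 4"
  have "\<bar>bump_fam P k y\<bar> \<le> C * \<bar>y - x\<bar>\<^sup>2" if x: "\<bar>x\<bar> = 1" for x y
  proof (cases "\<bar>y\<bar> < 1")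
    case True
    have z: "1 - y\<^sup>2 > 0" using True abs_square_less_1[of y] by simp
    \<comment> \<open>Here \<open>x\<close> may be either end: the nearer one is at distance
      \<open>1 - |y|\<close>, and the other only enlarges the right-hand side.\<close>
    have "1 - y\<^sup>2 \<le> 2 * \<bar>y - x\<bar>"
    proof -
      have "1 - y\<^sup>2 = (1 - \<bar>y\<bar>) * (1 + \<bar>y\<bar>)" by (simp add: algebra_simps power2_eq_square)
      also have "\<dots> \<le> (1 - \<bar>y\<bar>) * 2" using True by (intro mult_left_mono) auto
      also have "\<dots> \<le> 2 * \<bar>y - x\<bar>"
        using x abs_triangle_ineq2[of x y] by (simp add: abs_minus_commute)
      finally show ?thesis .
    qed
    then have sq: "(1 - y\<^sup>2)\<^sup>2 \<le> (2 * \<bar>y - x\<bar>)\<^sup>2" using z by (intro power_mono) auto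
    have "\<bar>bump_fam P k y\<bar> = \<bar>poly P y\<bar> * (exp (- 1 / (1 - y\<^sup>2)) / (1 - y\<^sup>2) ^ k)"
      using True z by (simp add: bump_fam_def abs_mult)
    also have "\<dots> \<le> B * (fact (k + 2) * (1 - y\<^sup>2)\<^sup>2)"
      using B[of y] True z B0 by (intro mult_mono power_mult_exp_neg_le) (auto simp: abs_less_iff)
    also have "\<dots> \<le> B * (fact (k + 2) * (2 * \<bar>y - x\<bar>)\<^sup>2)"
      using B0 sq by (intro mult_left_mono) auto
    finally show ?thesis by (simp add: C_def power_mult_distrib mult_ac del: fact_Suc)
  next
    case False
    then show ?thesis using B0 by (simp add: bump_fam_def C_def)
  qed
  moreover have "C \<ge> 0" using B0 by (simp add: C_def)
  ultimately show ?thesis by blast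
qed

lemma has_real_derivative_0_quadratic:
  fixes f :: "real \<Rightarrow> real"
  assumes "\<And>y. \<bar>f y\<bar> \<le> C * \<bar>y - x\<bar>\<^sup>2"
  shows "(f has_real_derivative 0) (at x)"
proof -
  have fx: "f x = 0" using assms[of x] by simp
  have "((\<lambda>y. (f y - f x) / (y - x)) \<longlongrightarrow> 0) (at x)"
  proof (rule Lim_null_comparison)
    show "\<forall>\<^sub>F y in at x. norm ((f y - f x) / (y - x)) \<le> C * \<bar>y - x\<bar>"
      unfolding eventually_at_topological
    proof (intro exI[of _ UNIV] conjI ballI impI)
      fix y assume "y \<noteq> x"
      then have "\<bar>f y\<bar> / \<bar>y - x\<bar> \<le> C * \<bar>y - x\<bar>\<^sup>2 / \<bar>y - x\<bar>"
        by (intro divide_right_mono assms) auto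
      also have "\<dots> = C * \<bar>y - x\<bar>" using \<open>y \<noteq> x\<close>
        unfolding power2_eq_square[of "\<bar>y - x\<bar>"] by (simp del: abs_mult_self_eq)
      finally show "norm ((f y - f x) / (y - x)) \<le> C * \<bar>y - x\<bar>"
        by (simp add: fx abs_divide)
    qed auto
    show "((\<lambda>y. C * \<bar>y - x\<bar>) \<longlongrightarrow> 0) (at x)"
      by (auto intro!: tendsto_eq_intros)
  qed
  then show ?thesis by (simp add: has_field_derivative_iff)
qed

lemma bump_fam_deriv: "(bump_fam P k has_real_derivative bump_fam (bump_step P k) (k + 2) x) (at x)"
proof -
  consider "\<bar>x\<bar> < 1" | "\<bar>x\<bar> = 1" | "\<bar>x\<bar> > 1" by linarith
  then show ?thesis
  proof cases
    case 1
    define w where "w = 1 - x\<^sup>2"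
    have w: "w > 0" using 1 abs_square_less_1[of x] by (simp add: w_def)
    have wk: "real k * w ^ (k - Suc 0) = real k * w ^ k / w" using w by (cases k) auto
    define E where "E = exp (- 1 / w)"
    have dw: "((\<lambda>x. 1 - x\<^sup>2) has_real_derivative - 2 * x) (at x)"
      by (auto intro!: derivative_eq_intros)
    have "((\<lambda>x. - 1 / (1 - x\<^sup>2)) has_real_derivative - 2 * x / w\<^sup>2) (at x)"
      using DERIV_divide[OF DERIV_const[of "- 1"] dw] w by (simp add: w_def power2_eq_square)
    then have dE: "((\<lambda>x. exp (- 1 / (1 - x\<^sup>2))) has_real_derivative E * (- 2 * x / w\<^sup>2)) (at x)"
      unfolding E_def w_def by (rule DERIV_fun_exp)
    have "((\<lambda>x. poly P x * exp (- 1 / (1 - x\<^sup>2)) / (1 - x\<^sup>2) ^ k) has_real_derivative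
        ((poly (pderiv P) x * E + E * (- 2 * x / w\<^sup>2) * poly P x) * w ^ k
          - poly P x * E * (real k * (- 2 * x * w ^ (k - Suc 0)))) / (w ^ k * w ^ k)) (at x)"
      using DERIV_divide[OF DERIV_mult[OF poly_DERIV dE, of P] DERIV_power[OF dw, of k]] w
      unfolding w_def[symmetric] E_def[symmetric] by simp
    also have "((poly (pderiv P) x * E + E * (- 2 * x / w\<^sup>2) * poly P x) * w ^ k
          - poly P x * E * (real k * (- 2 * x * w ^ (k - Suc 0)))) / (w ^ k * w ^ k)
        = ((poly (pderiv P) x * E + E * (- 2 * x / w\<^sup>2) * poly P x) * w ^ k
          - poly P x * E * ((- 2 * x) * (real k * w ^ (k - Suc 0)))) / (w ^ k * w ^ k)"
      by (simp only: mult_ac)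
    also have "\<dots> = bump_fam (bump_step P k) (k + 2) x"
    proof -
      have "((p' * E + E * (- 2 * x / w\<^sup>2) * p) * W - p * E * ((- 2 * x) * (c * W / w))) / (W * W)
          = (p' * w\<^sup>2 + p * (2 * c * x * w - 2 * x)) * E / (W * w\<^sup>2)"
        if "W \<noteq> 0" for p p' W c :: real
      proof -
        define Y where "Y = p' * E + E * (- 2 * x / w\<^sup>2) * p + p * E * (2 * x) * (c / w)"
        have "((p' * E + E * (- 2 * x / w\<^sup>2) * p) * W - p * E * ((- 2 * x) * (c * W / w))) = W * Y"
          unfolding Y_def by (simp add: algebra_simps)
        moreover have "w\<^sup>2 * Y = (p' * w\<^sup>2 + p * (2 * c * x * w - 2 * x)) * E"
        proof -
          have "w\<^sup>2 * Y = p' * E * w\<^sup>2 + E * (- 2 * x) * p * (w\<^sup>2 / w\<^sup>2) + p * E * (2 * x) * c * (w\<^sup>2 / w)"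
            by (simp add: Y_def algebra_simps)
          moreover have "w\<^sup>2 / w\<^sup>2 = 1" "w\<^sup>2 / w = w" using w by (simp_all add: power2_eq_square)
          ultimately show ?thesis by (simp only:) (simp add: algebra_simps)
        qed
        moreover have "w\<^sup>2 > 0" using w by simp
        ultimately show ?thesis using that
          by (simp only: nonzero_divide_mult_cancel_left nonzero_mult_divide_mult_cancel_left)
             (metis less_irrefl mult.commute nonzero_mult_divide_mult_cancel_left)
      qed
      from this[of "w ^ k" "poly (pderiv P) x" "poly P x" "real k"] show ?thesis
        using 1 w unfolding wk bump_fam_def poly_bump_step w_def[symmetric] E_def[symmetric]
        by (simp add: power_add power2_eq_square)
    qed
    finally have "((\<lambda>x. poly P x * exp (- 1 / (1 - x\<^sup>2)) / (1 - x\<^sup>2) ^ k) has_real_derivative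
        bump_fam (bump_step P k) (k + 2) x) (at x)" .
    moreover have "open {x::real. \<bar>x\<bar> < 1}" by (intro open_Collect_less continuous_intros)
    ultimately show ?thesis
      by (rule has_field_derivative_transform_within_open) (use 1 in \<open>auto simp: bump_fam_def\<close>)
  next
    case 2
    obtain C where "\<And>y. \<bar>bump_fam P k y\<bar> \<le> C * \<bar>y - x\<bar>\<^sup>2"
      using bump_fam_bound[of P k] 2 by blast
    then have "(bump_fam P k has_real_derivative 0) (at x)"
      by (rule has_real_derivative_0_quadratic)
    then show ?thesis using 2 by (simp add: bump_fam_def)
  next
    case 3
    have "((\<lambda>_. 0) has_real_derivative 0) (at x)" by simp
    moreover have "open {x::real. \<bar>x\<bar> > 1}" by (intro open_Collect_less continuous_intros)
    ultimately have "(bump_fam P k has_real_derivative 0) (at x)"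
      by (rule has_field_derivative_transform_within_open) (use 3 in \<open>auto simp: bump_fam_def\<close>)
    then show ?thesis using 3 by (simp add: bump_fam_def)
  qed
qed

primrec bump_pair :: "nat \<Rightarrow> real poly \<times> nat" where
  "bump_pair 0 = (1, 0)"
| "bump_pair (Suc n) = (bump_step (fst (bump_pair n)) (snd (bump_pair n)), snd (bump_pair n) + 2)"

definition bump :: "nat \<Rightarrow> real \<Rightarrow> real" where
  "bump n = bump_fam (fst (bump_pair n)) (snd (bump_pair n))"

lemma bump_deriv: "(bump n has_real_derivative bump (Suc n) x) (at x)"
  unfolding bump_def bump_pair.simps fst_conv snd_conv by (rule bump_fam_deriv)

lemma bump_eq_0: "\<bar>x\<bar> \<ge> 1 \<Longrightarrow> bump n x = 0"
  by (simp add: bump_def bump_fam_def)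

lemma bump_0_nonneg: "bump 0 x \<ge> 0"
  by (simp add: bump_def bump_fam_def)

lemma bump_0_pos: "\<bar>x\<bar> < 1 \<Longrightarrow> bump 0 x > 0"
  by (simp add: bump_def bump_fam_def)

lemma continuous_bump: "continuous_on A (bump n)"
  by (intro continuous_at_imp_continuous_on ballI DERIV_isCont[OF bump_deriv])

section \<open>Iterated derivatives and Fourier integrals\<close>

text \<open>Iterated derivatives are identified by exhibiting a whole sequence in which each member
  differentiates to the next. Packet sums and Fourier moments come as such sequences.\<close>

lemma nth_deriv_eqI:
  assumes "\<And>n x. (D n has_vector_derivative D (Suc n) x) (at x)"
  shows "nth_deriv n (D 0) = D n"
proof (induction n)
  case 0
  show ?case by (simp add: nth_deriv_def)
next
  case (Suc n)
  have "nth_deriv (Suc n) (D 0) = (\<lambda>x. vector_derivative (nth_deriv n (D 0)) (at x))"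
    by (simp add: nth_deriv_def)
  also have "\<dots> = D (Suc n)"
    unfolding Suc using assms by (auto intro: vector_derivative_at)
  finally show ?case .
qed

lemma smooth_funI:
  assumes "\<And>n x. (D n has_vector_derivative D (Suc n) x) (at x)"
  shows "smooth_fun (D 0)"
  unfolding smooth_fun_def nth_deriv_eqI[of D, OF assms] using assms by blast

definition fker :: "real \<Rightarrow> real \<Rightarrow> complex" where
  "fker x \<xi> = exp (- 2 * pi * \<i> * complex_of_real (x * \<xi>))"

lemma fker_cis: "fker x \<xi> = cis (- (2 * pi * x * \<xi>))"
  by (simp add: fker_def cis_conv_exp mult_ac)

lemma norm_fker [simp]: "norm (fker x \<xi>) = 1"
  by (simp add: fker_cis)

lemma fker_add: "fker (x + y) \<xi> = fker x \<xi> * fker y \<xi>"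
  by (simp add: fker_cis cis_mult algebra_simps)

lemma continuous_on_fker [continuous_intros]:
  assumes "continuous_on A f" "continuous_on A g"
  shows "continuous_on A (\<lambda>x. fker (f x) (g x))"
  unfolding fker_def by (intro continuous_intros assms)

lemma fker_deriv_right: "(fker x has_vector_derivative (- 2 * pi * \<i> * x) * fker x \<xi>) (at \<xi> within S)"
proof -
  have "((\<lambda>z. exp (- 2 * pi * \<i> * x * z)) has_field_derivative exp (- 2 * pi * \<i> * x * of_real \<xi>) * (- 2 * pi * \<i> * x)) (at (of_real \<xi>))"
    by (auto intro!: derivative_eq_intros)
  then have "((\<lambda>\<xi>. exp (- 2 * pi * \<i> * x * of_real \<xi>)) has_vector_derivative exp (- 2 * pi * \<i> * x * of_real \<xi>) * (- 2 * pi * \<i> * x)) (at \<xi> within S)"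
    using has_vector_derivative_real_field has_vector_derivative_at_within by blast
  moreover have "(\<lambda>\<xi>. exp (- 2 * pi * \<i> * x * of_real \<xi>)) = fker x"
    by (simp add: fker_def fun_eq_iff mult_ac)
  ultimately show ?thesis by (metis mult.commute)
qed

lemma fker_commute: "fker x \<xi> = fker \<xi> x"
  by (simp add: fker_def mult.commute)

lemma fker_deriv_left: "((\<lambda>x. fker x \<xi>) has_vector_derivative (- 2 * pi * \<i> * \<xi>) * fker x \<xi>) (at x within S)"
  using fker_deriv_right[of \<xi> x S] by (simp add: fker_commute[of _ \<xi>] flip: fker_commute[of \<xi>])

text \<open>For continuous \<open>f\<close> supported in \<open>[-R, R]\<close> this is the
  \<open>k\<close>-th derivative of its Fourier transform: each differentiation in
  \<open>\<xi>\<close> brings down a factor \<open>- 2 * pi * \<i> * x\<close>. On a compact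
  interval the Leibniz rule applies directly.\<close>

definition fmom :: "real \<Rightarrow> (real \<Rightarrow> complex) \<Rightarrow> nat \<Rightarrow> real \<Rightarrow> complex" where
  "fmom R f k \<xi> = integral {-R..R} (\<lambda>x. (- 2 * pi * \<i> * x) ^ k * f x * fker x \<xi>)"

lemma integrable_supported:
  fixes f :: "real \<Rightarrow> complex"
  assumes "continuous_on UNIV f" "\<And>x. \<bar>x\<bar> \<ge> R \<Longrightarrow> f x = 0"
  shows "integrable lborel f" "(LINT x|lborel. f x) = integral {-R..R} f"
proof -
  have eq: "indicator {-R..R} x *\<^sub>R f x = f x" for x
    using assms(2)[of x] by (auto simp: indicator_def)
  have si: "set_integrable lborel {-R..R} f"
    by (rule borel_integrable_atLeastAtMost') (rule continuous_on_subset[OF assms(1)], simp)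
  then show "integrable lborel f" by (simp add: set_integrable_def eq)
  show "(LINT x|lborel. f x) = integral {-R..R} f"
    using set_borel_integral_eq_integral(2)[OF si] by (simp add: set_lebesgue_integral_def eq)
qed

lemma fourier_fker: "fourier f \<xi> = (LINT x|lborel. f x * fker x \<xi>)"
  by (simp add: fourier_def fker_def)

lemma fourier_eq_fmom:
  assumes "continuous_on UNIV f" "\<And>x. \<bar>x\<bar> \<ge> R \<Longrightarrow> f x = 0"
  shows "fourier f \<xi> = fmom R f 0 \<xi>"
  unfolding fourier_fker fmom_def power_0 mult_1_left
  by (rule integrable_supported) (auto intro!: continuous_intros assms)

lemma fmom_deriv:
  assumes "continuous_on UNIV f"
  shows "(fmom R f k has_vector_derivative fmom R f (Suc k) \<xi>) (at \<xi>)"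
proof -
  have cf: "continuous_on A f" for A using assms continuous_on_subset by blast
  have cf': "continuous_on A (\<lambda>z. f (snd z))" for A :: "(real \<times> real) set"
    by (rule continuous_on_compose2[OF assms]) (auto intro: continuous_intros)
  have "((\<lambda>\<xi>. integral (cbox (-R) R) (\<lambda>x. (- 2 * pi * \<i> * x) ^ k * f x * fker x \<xi>)) has_vector_derivative
     integral (cbox (-R) R) (\<lambda>x. (- 2 * pi * \<i> * x) ^ Suc k * f x * fker x \<xi>)) (at \<xi> within UNIV)"
  proof (rule leibniz_rule_vector_derivative)
    fix \<xi> x :: real
    show "((\<lambda>\<xi>. (- 2 * pi * \<i> * x) ^ k * f x * fker x \<xi>) has_vector_derivative
       (- 2 * pi * \<i> * x) ^ Suc k * f x * fker x \<xi>) (at \<xi> within UNIV)"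
      by (rule has_vector_derivative_eq_rhs[OF has_vector_derivative_mult_right[OF fker_deriv_right]])
         (simp add: mult_ac)
    show "(\<lambda>x. (- 2 * pi * \<i> * x) ^ k * f x * fker x \<xi>) integrable_on cbox (- R) R"
      by (intro integrable_continuous continuous_intros cf)
  next
    show "continuous_on (UNIV \<times> cbox (- R) R) (\<lambda>(\<xi>, x). (- 2 * pi * \<i> * x) ^ Suc k * f x * fker x \<xi>)"
      unfolding case_prod_unfold by (intro continuous_intros cf')
  qed auto
  then show ?thesis unfolding fmom_def[abs_def] by simp
qed

lemma nth_deriv_fourier:
  assumes "continuous_on UNIV f" "\<And>x. \<bar>x\<bar> \<ge> R \<Longrightarrow> f x = 0"
  shows "nth_deriv k (fourier f) = fmom R f k"
proof -
  have "fourier f = fmom R f 0" using fourier_eq_fmom[OF assms] by (simp add: fun_eq_iff)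
  then show ?thesis using nth_deriv_eqI[of "fmom R f" k] fmom_deriv[OF assms(1)] by simp
qed

lemma norm_fmom_le:
  assumes "continuous_on UNIV f" "\<And>x. norm (f x) \<le> B" "R > 0"
  shows "norm (fmom R f k \<xi>) \<le> (2 * pi * R) ^ k * B * (2 * R)"
proof -
  have cf: "continuous_on A f" for A using assms continuous_on_subset by blast
  have B: "B \<ge> 0" using assms(2)[of 0] norm_ge_zero order_trans by blast
  have "norm (integral {-R..R} (\<lambda>x. (- 2 * pi * \<i> * x) ^ k * f x * fker x \<xi>)) \<le> ((2 * pi * R) ^ k * B) * (R - - R)"
  proof (rule integral_bound)
    show "continuous_on {-R..R} (\<lambda>x. (- 2 * pi * \<i> * x) ^ k * f x * fker x \<xi>)"
      by (intro continuous_intros cf)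
    fix x assume "x \<in> {-R..R}"
    then have "norm (- 2 * pi * \<i> * x) \<le> 2 * pi * R" by (auto simp: norm_mult abs_le_iff)
    then have "norm ((- 2 * pi * \<i> * x) ^ k) \<le> (2 * pi * R) ^ k"
      unfolding norm_power by (intro power_mono) auto
    then have "norm ((- 2 * pi * \<i> * x) ^ k) * norm (f x) \<le> (2 * pi * R) ^ k * B"
      using assms by (intro mult_mono) auto
    then show "norm ((- 2 * pi * \<i> * x) ^ k * f x * fker x \<xi>) \<le> (2 * pi * R) ^ k * B"
      by (simp add: norm_mult)
  qed (use assms in auto)
  then show ?thesis by (simp add: fmom_def)
qed

lemma fmom_sum:
  assumes "finite N" "\<And>n. n \<in> N \<Longrightarrow> continuous_on UNIV (\<psi> n)"
  shows "fmom R (\<lambda>x. \<Sum>n\<in>N. c n * \<psi> n x) k \<xi> = (\<Sum>n\<in>N. c n * fmom R (\<psi> n) k \<xi>)"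
proof -
  have c: "continuous_on A (\<psi> n)" if "n \<in> N" for n A
    using assms(2)[OF that] continuous_on_subset by blast
  have "fmom R (\<lambda>x. \<Sum>n\<in>N. c n * \<psi> n x) k \<xi>
      = integral {-R..R} (\<lambda>x. \<Sum>n\<in>N. c n * ((- 2 * pi * \<i> * x) ^ k * \<psi> n x * fker x \<xi>))"
    unfolding fmom_def by (simp add: sum_distrib_left sum_distrib_right mult_ac)
  also have "\<dots> = (\<Sum>n\<in>N. integral {-R..R} (\<lambda>x. c n * ((- 2 * pi * \<i> * x) ^ k * \<psi> n x * fker x \<xi>)))"
    by (intro integral_sum assms integrable_continuous_real continuous_intros c)
  also have "\<dots> = (\<Sum>n\<in>N. c n * fmom R (\<psi> n) k \<xi>)"
    by (simp add: fmom_def)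
  finally show ?thesis .
qed

section \<open>The transform of the bump and of its packets\<close>

definition cbump :: "nat \<Rightarrow> real \<Rightarrow> complex" where
  "cbump n x = complex_of_real (bump n x)"

lemma cbump_deriv: "(cbump n has_vector_derivative cbump (Suc n) x) (at x within S)"
proof -
  have "(bump n has_vector_derivative bump (Suc n) x) (at x within S)"
    using bump_deriv has_real_derivative_iff_has_vector_derivative has_vector_derivative_at_within by blast
  then show ?thesis unfolding cbump_def[abs_def] by (rule bounded_linear.has_vector_derivative[OF bounded_linear_of_real])
qed

lemma cbump_eq_0: "\<bar>x\<bar> \<ge> 1 \<Longrightarrow> cbump n x = 0"
  by (simp add: cbump_def bump_eq_0)

lemma continuous_cbump: "continuous_on A (cbump n)"
  unfolding cbump_def[abs_def] by (intro continuous_intros continuous_bump)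

lemma cbump_bounded: "\<exists>B>0. \<forall>x. norm (cbump n x) \<le> B"
proof -
  have "compact (cbump n ` {-1..1})"
    by (intro compact_continuous_image continuous_cbump) auto
  then obtain B where B: "B > 0" "\<And>y. y \<in> {-1..1} \<Longrightarrow> norm (cbump n y) \<le> B"
    using compact_imp_bounded bounded_pos by (metis image_eqI)
  have "norm (cbump n y) \<le> B" for y
    using B cbump_eq_0[of y n] by (cases "\<bar>y\<bar> \<le> 1") (auto simp: abs_le_iff)
  then show ?thesis using B(1) by blast
qed

text \<open>Integration by parts; the boundary terms vanish with the bump at \<open>-1\<close> and
  \<open>1\<close>. Iterated, it yields decay of every polynomial order.\<close>

lemma fmom_cbump_Suc: "fmom 1 (cbump (Suc n)) 0 u = (2 * pi * \<i> * u) * fmom 1 (cbump n) 0 u"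
proof -
  define g where "g = (\<lambda>x. cbump n x * fker x u)"
  have "(g has_vector_derivative cbump (Suc n) x * fker x u - (2 * pi * \<i> * u) * (cbump n x * fker x u)) (at x within {-1..1})" for x
    unfolding g_def
    by (rule has_vector_derivative_eq_rhs[OF has_vector_derivative_mult[OF cbump_deriv fker_deriv_left]])
       (simp add: algebra_simps)
  then have "((\<lambda>x. cbump (Suc n) x * fker x u - (2 * pi * \<i> * u) * (cbump n x * fker x u)) has_integral (g 1 - g (- 1))) {-1..1}"
    by (intro fundamental_theorem_of_calculus) auto
  then have "integral {-1..1} (\<lambda>x. cbump (Suc n) x * fker x u - (2 * pi * \<i> * u) * (cbump n x * fker x u)) = 0"
    by (intro integral_unique) (simp add: g_def cbump_eq_0)
  moreover have "integral {-1..1} (\<lambda>x. cbump (Suc n) x * fker x u - (2 * pi * \<i> * u) * (cbump n x * fker x u))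
     = integral {-1..1} (\<lambda>x. cbump (Suc n) x * fker x u) - integral {-1..1} (\<lambda>x. (2 * pi * \<i> * u) * (cbump n x * fker x u))"
    by (intro integral_diff integrable_continuous_real continuous_intros continuous_cbump)
  ultimately show ?thesis by (simp add: fmom_def)
qed

lemma fmom_cbump_decay: "\<exists>C>0. \<forall>u. \<bar>u\<bar> ^ m * norm (fmom 1 (cbump 0) 0 u) \<le> C"
proof -
  have eq: "fmom 1 (cbump m) 0 u = (2 * pi * \<i> * u) ^ m * fmom 1 (cbump 0) 0 u" for u
    by (induction m) (simp_all add: fmom_cbump_Suc mult_ac)
  obtain B where B: "B > 0" "\<And>x. norm (cbump m x) \<le> B" using cbump_bounded[of m] by blast
  have "\<bar>u\<bar> ^ m * norm (fmom 1 (cbump 0) 0 u) \<le> 2 * B" for u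
  proof -
    have "\<bar>u\<bar> ^ m \<le> (2 * pi * \<bar>u\<bar>) ^ m"
      using pi_gt3 by (intro power_mono) (auto simp: mult_le_cancel_right1)
    then have "\<bar>u\<bar> ^ m * norm (fmom 1 (cbump 0) 0 u) \<le> (2 * pi * \<bar>u\<bar>) ^ m * norm (fmom 1 (cbump 0) 0 u)"
      by (intro mult_right_mono) auto
    also have "\<dots> = norm (fmom 1 (cbump m) 0 u)"
      unfolding eq by (simp add: norm_mult norm_power)
    also have "\<dots> \<le> 2 * B"
      using norm_fmom_le[OF continuous_cbump B(2), of 1 0 u] by simp
    finally show ?thesis .
  qed
  then show ?thesis using B(1) by (intro exI[of _ "2 * B"]) auto
qed

text \<open>For \<open>|x| \<le> 1\<close> and \<open>|u| \<le> 1/6\<close> the phase is at most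
  \<open>pi / 3\<close>, where the cosine is at least \<open>1/2\<close>; so at least half the
  integral of the bump survives in the real part.\<close>

lemma fmom_cbump_lower: "\<exists>a>0. \<forall>u. \<bar>u\<bar> \<le> 1/6 \<longrightarrow> a \<le> norm (fmom 1 (cbump 0) 0 u)"
proof -
  define I where "I = integral {-1..1} (bump 0)"
  have int: "bump 0 integrable_on {-1..1}"
    by (intro integrable_continuous_real continuous_bump)
  have "I > 0"
  proof -
    have "I \<ge> 0" unfolding I_def by (intro integral_nonneg int) (simp add: bump_0_nonneg)
    moreover have "I \<noteq> 0"
    proof
      assume "I = 0"
      then have "(bump 0 has_integral 0) (cbox (-1) 1)"
        using int by (simp add: I_def has_integral_iff)
      then have "bump 0 0 = 0"
        by (rule has_integral_0_cbox_imp_0[rotated 2]) (auto simp: bump_0_nonneg intro: continuous_bump)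
      then show False using bump_0_pos[of 0] by simp
    qed
    ultimately show ?thesis by simp
  qed
  moreover have "I / 2 \<le> norm (fmom 1 (cbump 0) 0 u)" if u: "\<bar>u\<bar> \<le> 1/6" for u
  proof -
    have ci: "(\<lambda>x. cbump 0 x * fker x u) integrable_on {-1..1}"
      by (intro integrable_continuous_real continuous_intros continuous_cbump)
    have "integral {-1..1} (\<lambda>x. 1/2 * bump 0 x) \<le> integral {-1..1} (\<lambda>x. Re (cbump 0 x * fker x u))"
    proof (rule integral_le)
      show "(\<lambda>x. Re (cbump 0 x * fker x u)) integrable_on {- 1..1}"
        using integrable_linear[OF ci bounded_linear_Re] by (simp add: o_def)
      show "(\<lambda>x. 1/2 * bump 0 x) integrable_on {- 1..1}" using int by (intro integrable_on_mult_right)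
      fix x :: real assume x: "x \<in> {-1..1}"
      have "\<bar>x\<bar> * \<bar>u\<bar> \<le> 1 * (1/6)" using x u by (intro mult_mono) auto
      then have "2 * pi * (\<bar>x\<bar> * \<bar>u\<bar>) \<le> 2 * pi * (1/6)"
        by (intro mult_left_mono) auto
      then have "\<bar>2 * pi * x * u\<bar> \<le> pi / 3"
        by (simp add: abs_mult mult_ac)
      then have "cos (pi / 3) \<le> cos \<bar>2 * pi * x * u\<bar>"
        by (intro cos_monotone_0_pi_le) auto
      then have "1/2 \<le> Re (fker x u)" by (simp add: fker_cis cos_60)
      then have "1/2 * bump 0 x \<le> Re (fker x u) * bump 0 x"
        by (intro mult_right_mono bump_0_nonneg)
      then show "1/2 * bump 0 x \<le> Re (cbump 0 x * fker x u)"
        by (simp add: cbump_def mult.commute)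
    qed
    also have "\<dots> = Re (fmom 1 (cbump 0) 0 u)"
      using integral_linear[OF ci bounded_linear_Re] by (simp add: o_def fmom_def)
    also have "\<dots> \<le> norm (fmom 1 (cbump 0) 0 u)" by (rule complex_Re_le_cmod)
    finally show ?thesis by (simp add: I_def)
  qed
  ultimately show ?thesis by (intro exI[of _ "I/2"]) auto
qed

text \<open>The bump dilated to half-width \<open>s\<close> and centred at \<open>t\<close>;
  \<open>n\<close> is the order of differentiation, and the power of \<open>1 / s\<close> comes from
  the chain rule.\<close>

definition packet :: "real \<Rightarrow> real \<Rightarrow> nat \<Rightarrow> real \<Rightarrow> complex" where
  "packet s t n x = of_real ((1 / s) ^ n) * cbump n ((x - t) / s)"

lemma packet_deriv:
  "(packet s t n has_vector_derivative packet s t (Suc n) x) (at x)"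
proof -
  have "((\<lambda>x. (x - t) / s) has_real_derivative 1 / s) (at x)"
    by (auto intro!: derivative_eq_intros simp: divide_inverse)
  then have "((cbump n \<circ> (\<lambda>x. (x - t) / s)) has_vector_derivative ((1 / s) *\<^sub>R cbump (Suc n) ((x - t) / s))) (at x)"
    by (intro vector_diff_chain_at cbump_deriv)
       (simp add: has_real_derivative_iff_has_vector_derivative)
  then have "((\<lambda>x. of_real ((1 / s) ^ n) * cbump n ((x - t) / s)) has_vector_derivative
      of_real ((1 / s) ^ n) * ((1 / s) *\<^sub>R cbump (Suc n) ((x - t) / s))) (at x)"
    by (intro has_vector_derivative_mult_right) (simp add: o_def)
  then show ?thesis
    unfolding packet_def[abs_def] by (simp add: scaleR_conv_of_real mult_ac)
qed

lemma continuous_packet: "continuous_on A (packet s t n)"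
  by (intro continuous_at_imp_continuous_on ballI has_vector_derivative_continuous[OF packet_deriv])

lemma packet_eq_0: "s > 0 \<Longrightarrow> \<bar>x - t\<bar> \<ge> s \<Longrightarrow> packet s t n x = 0"
  unfolding packet_def by (subst cbump_eq_0) auto

text \<open>The transform of the bump enters at \<open>s * \<xi>\<close>, free of the centre
  \<open>t\<close>. In a sum of packets it therefore factors out and leaves a trigonometric
  polynomial.\<close>

lemma fourier_packet:
  assumes "s > 0"
  shows "fourier (packet s t 0) \<xi> = s * fker t \<xi> * fmom 1 (cbump 0) 0 (s * \<xi>)"
proof -
  have "fourier (packet s t 0) \<xi> = \<bar>s\<bar> *\<^sub>R (LINT x|lborel. packet s t 0 (t + s * x) * fker (t + s * x) \<xi>)"
    unfolding fourier_fker by (rule lborel_integral_real_affine) (use assms in simp)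
  also have "(\<lambda>x. packet s t 0 (t + s * x) * fker (t + s * x) \<xi>) = (\<lambda>x. fker t \<xi> * (cbump 0 x * fker x (s * \<xi>)))"
  proof
    fix x
    have "fker (s * x) \<xi> = fker x (s * \<xi>)" by (simp add: fker_def mult_ac)
    then show "packet s t 0 (t + s * x) * fker (t + s * x) \<xi> = fker t \<xi> * (cbump 0 x * fker x (s * \<xi>))"
      using assms by (simp add: packet_def fker_add mult_ac)
  qed
  also have "(LINT x|lborel. fker t \<xi> * (cbump 0 x * fker x (s * \<xi>))) = fker t \<xi> * fourier (cbump 0) (s * \<xi>)"
    unfolding fourier_fker
    by (rule integral_mult_right_zero)
  also have "fourier (cbump 0) (s * \<xi>) = fmom 1 (cbump 0) 0 (s * \<xi>)"
    by (rule fourier_eq_fmom) (auto simp: continuous_cbump cbump_eq_0)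
  finally show ?thesis using assms by (simp add: scaleR_conv_of_real)
qed

section \<open>Smallness of derivatives and summation over nodes of polynomial growth\<close>

text \<open>A Landau type inequality: the difference quotient over a step \<open>t\<close>
  approximates \<open>g'\<close> with error at most \<open>M * t\<close>, so a small
  \<open>g\<close> and a bounded \<open>g''\<close> make \<open>g'\<close> small for a well chosen
  \<open>t\<close>.\<close>

lemma derivative_interpolation:
  fixes g g' g'' :: "real \<Rightarrow> complex"
  assumes "\<And>x. (g has_vector_derivative g' x) (at x)" "\<And>x. (g' has_vector_derivative g'' x) (at x)"
    and M: "\<And>x. norm (g'' x) \<le> M" and t: "t > 0"
  shows "norm (g' x) \<le> (norm (g (x + t)) + norm (g x)) / t + M * t"
proof -
  have M0: "M \<ge> 0" using M[of 0] norm_ge_zero order_trans by blast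
  have lip: "norm (g' y - g' x) \<le> M * t" if "y \<in> {x..x + t}" for y
  proof -
    have "norm (g' y - g' x) \<le> M * norm (y - x)"
      by (rule differentiable_bound[of UNIV])
         (use assms(2) M in \<open>auto simp: has_vector_derivative_def onorm_scaleR_left onorm_id\<close>)
    also have "M * norm (y - x) \<le> M * t" using that M0 by (intro mult_left_mono) auto
    finally show ?thesis .
  qed
  have "norm (g (x + t) - g x - (x + t - x) *\<^sub>R g' x) \<le> norm (x + t - x) * (M * t)"
    by (rule vector_differentiable_bound_linearization[of "{x..x+t}"])
       (use assms(1) t lip in \<open>auto simp: closed_segment_eq_real_ivl intro: has_vector_derivative_at_within\<close>)
  then have A: "norm (g (x + t) - g x - t *\<^sub>R g' x) \<le> t * (M * t)" using t by simp
  have "t * norm (g' x) = norm (t *\<^sub>R g' x)" using t by simp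
  also have "\<dots> = norm (g (x + t) - g x - (g (x + t) - g x - t *\<^sub>R g' x))" by simp
  also have "\<dots> \<le> norm (g (x + t) - g x) + norm (g (x + t) - g x - t *\<^sub>R g' x)"
    by (rule norm_triangle_ineq4)
  also have "\<dots> \<le> norm (g (x + t)) + norm (g x) + t * (M * t)"
    using A norm_triangle_ineq4[of "g (x + t)" "g x"] by linarith
  finally have "norm (g' x) \<le> (norm (g (x + t)) + norm (g x) + t * (M * t)) / t"
    using t by (simp add: pos_le_divide_eq mult.commute)
  then show ?thesis using t by (simp add: add_divide_distrib)
qed

text \<open>Each derivative costs a square root of the bound, hence the exponent
  \<open>2 ^ n\<close> at the start and \<open>2 ^ (n - k)\<close> after \<open>k\<close>
  derivatives. The estimate at \<open>x\<close> also uses the point \<open>x + t\<close> to its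
  right, which is why \<open>H\<close> has to be nonincreasing.\<close>

lemma derivatives_small:
  fixes g :: "nat \<Rightarrow> real \<Rightarrow> complex"
  assumes g: "\<And>k x. (g k has_vector_derivative g (Suc k) x) (at x)"
    and M: "M \<ge> 1" "\<And>k x. k \<le> Suc n \<Longrightarrow> norm (g k x) \<le> M"
    and H: "\<And>x. x \<ge> a \<Longrightarrow> H x > 0" "\<And>x y. a \<le> x \<Longrightarrow> x \<le> y \<Longrightarrow> H y \<le> H x"
    and small: "\<And>x. x \<ge> a \<Longrightarrow> norm (g 0 x) \<le> H x ^ (2 ^ n)"
    and "k \<le> n" "x \<ge> a"
  shows "norm (g k x) \<le> (3 * M) ^ k * H x ^ (2 ^ (n - k))"
  using assms(7,8)
proof (induction k arbitrary: x)
  case 0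
  then show ?case using small by simp
next
  case (Suc k)
  \<comment> \<open>The step is the square root of the bound for \<open>g k\<close> (up to its
    constant), which balances the terms \<open>t\<^sup>2 / t\<close> and
    \<open>M * t\<close>.\<close>
  define t where "t = H x ^ (2 ^ (n - Suc k))"
  have "n - k = Suc (n - Suc k)" using Suc.prems by simp
  then have t2: "H y ^ (2 ^ (n - k)) = (H y ^ (2 ^ (n - Suc k)))\<^sup>2" for y
    by (simp add: power_mult[symmetric] mult.commute)
  have t: "t > 0" using H Suc.prems by (simp add: t_def)
  have M3: "1 \<le> (3 * M) ^ k" using M(1) by (intro one_le_power) simp
  have near: "norm (g k y) \<le> (3 * M) ^ k * t\<^sup>2" if "y \<ge> x" for y
  proof -
    have "norm (g k y) \<le> (3 * M) ^ k * H y ^ (2 ^ (n - k))"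
      using Suc that by simp
    also have "H y ^ (2 ^ (n - k)) \<le> H x ^ (2 ^ (n - k))"
      using H(2)[of x y] H(1)[of y] Suc.prems that by (intro power_mono) auto
    finally show ?thesis using M(1) by (simp add: t2 t_def mult_left_mono)
  qed
  have "norm (g (Suc k) x) \<le> (norm (g k (x + t)) + norm (g k x)) / t + M * t"
    by (rule derivative_interpolation[OF g g _ t]) (use M Suc.prems in auto)
  also have "\<dots> \<le> (2 * ((3 * M) ^ k * t\<^sup>2)) / t + M * t"
    using near[of "x + t"] near[of x] t by (intro add_right_mono divide_right_mono) auto
  also have "\<dots> = (2 * (3 * M) ^ k + M) * t"
    using t by (simp add: power2_eq_square algebra_simps)
  also have "\<dots> \<le> (3 * M) ^ Suc k * t"
  proof (intro mult_right_mono)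
    have "(3 * M) ^ k * 1 \<le> (3 * M) ^ k * M" using M M3 by (intro mult_left_mono) auto
    moreover have "1 * M \<le> (3 * M) ^ k * M" using M M3 by (intro mult_right_mono) auto
    ultimately show "2 * (3 * M) ^ k + M \<le> (3 * M) ^ Suc k" by (simp add: algebra_simps)
  qed (use t in simp)
  finally show ?case by (simp add: t_def)
qed

lemma derivatives_small_both:
  fixes g :: "nat \<Rightarrow> real \<Rightarrow> complex"
  assumes g: "\<And>k x. (g k has_vector_derivative g (Suc k) x) (at x)"
    and M: "M \<ge> 1" "\<And>k x. k \<le> Suc n \<Longrightarrow> norm (g k x) \<le> M"
    and H: "\<And>x. x \<ge> a \<Longrightarrow> H x > 0" "\<And>x y. a \<le> x \<Longrightarrow> x \<le> y \<Longrightarrow> H y \<le> H x"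
    and small: "\<And>x. \<bar>x\<bar> \<ge> a \<Longrightarrow> norm (g 0 x) \<le> H \<bar>x\<bar> ^ (2 ^ n)"
    and k: "k \<le> n" and x: "\<bar>x\<bar> \<ge> a" and a: "a \<ge> 0"
  shows "norm (g k x) \<le> (3 * M) ^ k * H \<bar>x\<bar> ^ (2 ^ (n - k))"
proof (cases "x \<ge> 0")
  case True
  have "norm (g k x) \<le> (3 * M) ^ k * H x ^ (2 ^ (n - k))"
  proof (rule derivatives_small[where a = a and g = g])
    show "norm (g 0 y) \<le> H y ^ (2 ^ n)" if "y \<ge> a" for y
      using small[of y] that a by simp
  qed (use g M H k x True in auto)
  then show ?thesis using True by simp
next
  case False
  \<comment> \<open>Reflection carries the negative half-line to the positive one; the sign keeps
    \<open>g'\<close> a sequence of successive derivatives.\<close>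
  define g' where "g' = (\<lambda>k y. (- 1) ^ k * g k (- y))"
  have "norm (g' k (- x)) \<le> (3 * M) ^ k * H (- x) ^ (2 ^ (n - k))"
  proof (rule derivatives_small[where a = a and g = g'])
    show "(g' k has_vector_derivative g' (Suc k) x) (at x)" for k x
    proof -
      have "((g k \<circ> uminus) has_vector_derivative (- 1) *\<^sub>R g (Suc k) (- x)) (at x)"
        by (rule vector_diff_chain_at[OF _ g]) (auto intro!: derivative_eq_intros)
      then have "((\<lambda>y. (- 1) ^ k * g k (- y)) has_vector_derivative (- 1) ^ k * ((- 1) *\<^sub>R g (Suc k) (- x))) (at x)"
        by (intro has_vector_derivative_mult_right) (simp add: o_def)
      then show ?thesis by (simp add: g'_def)
    qed
    show "M \<ge> 1" by (rule M)
    show "norm (g' k y) \<le> M" if "k \<le> Suc n" for k y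
      using M(2)[OF that] by (simp add: g'_def norm_mult norm_power)
    show "norm (g' 0 y) \<le> H y ^ (2 ^ n)" if "y \<ge> a" for y
      using small[of "- y"] that a by (simp add: g'_def)
  qed (use H k x False in auto)
  then show ?thesis using False by (simp add: g'_def norm_mult norm_power)
qed

lemma count_fn_finiteD:
  assumes "count_fn J mu R \<le> ereal c"
  shows "finite {j\<in>J. \<bar>mu j\<bar> \<le> R}" "real (card {j\<in>J. \<bar>mu j\<bar> \<le> R}) \<le> c"
  using assms by (auto simp: count_fn_def split: if_splits)

text \<open>Unit shells: at most a constant times \<open>(k + 1) powr L\<close> nodes have modulus
  between \<open>k\<close> and \<open>k + 1\<close>, each of weight at most
  \<open>(k + 1) powr (- (L + 2))\<close>. What remains is the series of inverse squares.\<close>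

lemma summable_polynomial_growth:
  fixes mu :: "'j \<Rightarrow> real"
  assumes "eventually (\<lambda>R. count_fn J mu R \<le> ereal (R powr L)) at_top" and L: "L > 0"
  shows "(\<lambda>j. (1 + \<bar>mu j\<bar>) powr (- (L + 2))) summable_on J"
proof -
  obtain R0 where R0: "\<And>R. R \<ge> R0 \<Longrightarrow> count_fn J mu R \<le> ereal (R powr L)"
    using assms(1) by (auto simp: eventually_at_top_linorder)
  define T where "T = (\<lambda>R. {j\<in>J. \<bar>mu j\<bar> \<le> R})"
  define R1 where "R1 = max R0 1"
  have finT: "finite (T R)" for R
  proof -
    have "finite (T (max R R0))"
      using count_fn_finiteD(1)[OF R0, of "max R R0"] by (simp add: T_def)
    moreover have "T R \<subseteq> T (max R R0)" by (auto simp: T_def)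
    ultimately show ?thesis using finite_subset by blast
  qed
  \<comment> \<open>The growth bound holds only from \<open>R0\<close> on; below it the nodes
    counted lie in the finite set \<open>T R1\<close>, whose size is absorbed in
    \<open>A\<close>.\<close>
  define A where "A = max 1 (real (card (T R1)))"
  have cardT: "real (card (T (real k + 1))) \<le> A * (real k + 1) powr L" for k :: nat
  proof (cases "real k + 1 \<ge> R0")
    case True
    then have "real (card (T (real k + 1))) \<le> (real k + 1) powr L"
      using count_fn_finiteD(2)[OF R0] by (simp add: T_def)
    also have "\<dots> \<le> A * (real k + 1) powr L" by (simp add: A_def mult_le_cancel_right1)
    finally show ?thesis .
  next
    case False
    then have "T (real k + 1) \<subseteq> T R1" by (auto simp: T_def R1_def)
    then have "card (T (real k + 1)) \<le> card (T R1)" by (intro card_mono finT)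
    then have "real (card (T (real k + 1))) \<le> A" by (simp add: A_def)
    also have "\<dots> \<le> A * (real k + 1) powr L"
      using L by (simp add: A_def mult_le_cancel_left1 ge_one_powr_ge_zero)
    finally show ?thesis .
  qed
  have sq: "summable (\<lambda>k. 1 / (real k + 1)\<^sup>2)"
    using inverse_power_summable[of 2, where 'a=real] summable_Suc_iff[of "\<lambda>n. inverse ((of_nat n :: real)\<^sup>2)"]
    by (simp add: inverse_eq_divide add.commute)
  define h where "h = (\<lambda>j. (1 + \<bar>mu j\<bar>) powr (- (L + 2)))"
  have "sum h F \<le> A * (\<Sum>k. 1 / (real k + 1)\<^sup>2)" if F: "F \<subseteq> J" "finite F" for F
  proof -
    define fl where "fl = (\<lambda>j. nat \<lfloor>\<bar>mu j\<bar>\<rfloor>)"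
    have "sum h F = (\<Sum>k\<in>fl ` F. \<Sum>j\<in>{j\<in>F. fl j = k}. h j)"
      using F by (intro sum.group[symmetric]) auto
    also have "\<dots> \<le> (\<Sum>k\<in>fl ` F. A * (1 / (real k + 1)\<^sup>2))"
    proof (intro sum_mono)
      fix k
      have le: "real k \<le> \<bar>mu j\<bar> \<and> \<bar>mu j\<bar> \<le> real k + 1" if "fl j = k" for j
        using that unfolding fl_def by linarith
      have "(\<Sum>j\<in>{j\<in>F. fl j = k}. h j) \<le> of_nat (card {j\<in>F. fl j = k}) * (real k + 1) powr (- (L + 2))"
        using le L by (intro sum_bounded_above) (auto simp: h_def intro!: powr_mono2')
      also have "\<dots> \<le> (A * (real k + 1) powr L) * (real k + 1) powr (- (L + 2))"
      proof (intro mult_right_mono)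
        have "card {j\<in>F. fl j = k} \<le> card (T (real k + 1))"
          using F le by (intro card_mono finT) (auto simp: T_def)
        then show "real (card {j\<in>F. fl j = k}) \<le> A * (real k + 1) powr L"
          using cardT[of k] by linarith
      qed simp
      also have "\<dots> = A * (real k + 1) powr (- 2)"
        by (simp add: powr_add[symmetric] mult.assoc)
      also have "(real k + 1) powr (- 2) = 1 / (real k + 1)\<^sup>2"
        by (simp add: powr_minus_divide)
      finally show "(\<Sum>j\<in>{j\<in>F. fl j = k}. h j) \<le> A * (1 / (real k + 1)\<^sup>2)" .
    qed
    also have "\<dots> = A * (\<Sum>k\<in>fl ` F. 1 / (real k + 1)\<^sup>2)" by (simp add: sum_distrib_left)
    also have "\<dots> \<le> A * (\<Sum>k. 1 / (real k + 1)\<^sup>2)"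
      using sq F by (intro mult_left_mono sum_le_suminf) (auto simp: A_def)
    finally show ?thesis .
  qed
  then have "h summable_on J"
    by (intro nonneg_bdd_above_summable_on bdd_aboveI2) (auto simp: h_def)
  then show ?thesis by (simp add: h_def)
qed

section \<open>Wave packet sums concentrated in frequency\<close>

text \<open>\<open>D\<close> will be \<open>4 * R1 * R2\<close> rounded up, and all estimates are in
  powers of \<open>D\<close>. The bound on \<open>n0\<close> keeps every packet inside
  \<open>[-R1, R1]\<close>; \<open>outer_small\<close> runs over the grid frequencies outside
  \<open>[-R2, R2]\<close>, taken modulo one period; the conditions on \<open>B\<close> and
  \<open>C\<close> let \<open>D\<close> dominate the constants of the bump.\<close>

locale packet_sum =
  fixes D q n0 Q :: nat and R1 R2 B C a :: real and c :: "nat \<Rightarrow> complex"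
  assumes D8: "D \<ge> 8" and R1: "R1 > 1" and R2: "R2 > 1" and area: "4 * R1 * R2 \<le> real D"
    and n0: "real n0 \<le> 2 * (real D)\<^sup>2 * (R1 - 1 / (4 * real D))"
    and normalized: "(\<Sum>n<2*n0+1. (norm (c n))\<^sup>2) = 1"
    and q: "q = 4 * Q + 5"
    and outer_small: "(\<Sum>g\<in>{nat \<lfloor>R2 * real D ^ q\<rfloor> + 1..<2 * D ^ (q + 2) - nat \<lfloor>R2 * real D ^ q\<rfloor>}.
        (norm (dft (2 * D ^ (q + 2)) (2*n0+1) c g))\<^sup>2) \<le> (1 / real D ^ q)\<^sup>2"
    and B: "\<And>x. norm (cbump 0 x) \<le> B" "2 * B \<le> real D"
    and C: "\<And>u. \<bar>u\<bar> ^ (2 * (2 * Q + 2)) * norm (fmom 1 (cbump 0) 0 u) \<le> C" "C * 16 ^ (2 * Q + 2) \<le> real D"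
    and a: "a > 0" "\<And>u. \<bar>u\<bar> \<le> 1/6 \<Longrightarrow> a \<le> norm (fmom 1 (cbump 0) 0 u)"
begin

definition "N = 2 * n0 + 1"
definition "M = 2 * D ^ (q + 2)"
definition "K = nat \<lfloor>R2 * real D ^ q\<rfloor>"
definition "s = 1 / (4 * real D)"
text \<open>The time step \<open>1 / (2 * (real D)\<^sup>2)\<close> gives \<open>p\<close> the
  period \<open>2 * (real D)\<^sup>2\<close>. Its product with the frequency step
  \<open>1 / real D ^ q\<close> is \<open>1 / real M\<close>, so sampling \<open>p\<close> on the
  frequency grid is a discrete Fourier transform of length \<open>M\<close>.\<close>

definition t :: "nat \<Rightarrow> real" where "t n = (real n - real n0) / (2 * (real D)\<^sup>2)"
definition p :: "real \<Rightarrow> complex" where "p \<xi> = (\<Sum>n<N. c n * fker (t n) \<xi>)"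
definition f :: "nat \<Rightarrow> real \<Rightarrow> complex" where "f m x = (\<Sum>n<N. c n * packet s (t n) m x)"

lemma D_pos: "real D > 0" "real D \<ge> 8"
  using D8 by simp_all

lemma s_pos: "s > 0"
  using D_pos by (simp add: s_def)

lemma s_le_1: "s \<le> 1"
  using D_pos by (simp add: s_def divide_le_eq)

lemma R1_le: "4 * R1 \<le> real D"
proof -
  have "4 * R1 * 1 \<le> 4 * R1 * R2" using R1 R2 by (intro mult_left_mono) auto
  then show ?thesis using area by simp
qed

lemma R2_le: "4 * R2 \<le> real D"
proof -
  have "4 * R2 * 1 \<le> 4 * R2 * R1" using R1 R2 by (intro mult_left_mono) auto
  then show ?thesis using area by (simp add: mult_ac)
qed

lemma t_bound: "n < N \<Longrightarrow> \<bar>t n\<bar> \<le> R1 - s"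
proof -
  assume "n < N"
  then have "\<bar>real n - real n0\<bar> \<le> real n0" by (simp add: N_def)
  also have "\<dots> \<le> 2 * (real D)\<^sup>2 * (R1 - s)" using n0 by (simp add: s_def)
  finally show ?thesis using D_pos by (simp add: t_def abs_divide divide_le_eq mult.commute)
qed

lemma N_le: "real N \<le> real D ^ 4"
proof -
  have "real n0 \<le> 2 * (real D)\<^sup>2 * (real D / 4)"
  proof (rule order_trans[OF n0])
    have "R1 - 1 / (4 * real D) \<le> real D / 4" using R1_le D_pos by (simp add: diff_le_eq add_increasing2)
    then show "2 * (real D)\<^sup>2 * (R1 - 1 / (4 * real D)) \<le> 2 * (real D)\<^sup>2 * (real D / 4)"
      by (intro mult_left_mono) auto
  qed
  then have "real N \<le> real D ^ 3 + 1" by (simp add: N_def power2_eq_square power3_eq_cube)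
  also have "\<dots> \<le> 2 * real D ^ 3" using D_pos one_le_power[of "real D" 3] by simp
  also have "\<dots> \<le> real D * real D ^ 3" using D_pos by (intro mult_right_mono) auto
  finally show ?thesis by (simp flip: power_Suc)
qed

lemma sum_norm_c: "(\<Sum>n<N. norm (c n)) \<le> (real D)\<^sup>2"
proof -
  have "(\<Sum>n<N. norm (c n))\<^sup>2 \<le> real N"
    using Cauchy_Schwarz_ineq_sum[of "\<lambda>_. 1" "\<lambda>n. norm (c n)" "{..<N}"] normalized
    by (simp add: N_def)
  also have "\<dots> \<le> ((real D)\<^sup>2)\<^sup>2" using N_le by (simp flip: power_mult)
  finally show ?thesis by (rule power2_le_imp_le) simp
qed

lemma f_deriv: "(f m has_vector_derivative f (Suc m) x) (at x)"
  unfolding f_def[abs_def]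
  by (intro has_vector_derivative_sum has_vector_derivative_mult_right packet_deriv)

lemma continuous_f: "continuous_on A (f m)"
  by (intro continuous_at_imp_continuous_on ballI has_vector_derivative_continuous[OF f_deriv])

lemma f_eq_0: "\<bar>x\<bar> \<ge> R1 \<Longrightarrow> f m x = 0"
  unfolding f_def
proof (intro sum.neutral ballI)
  fix n assume x: "\<bar>x\<bar> \<ge> R1" and "n \<in> {..<N}"
  then have "\<bar>x - t n\<bar> \<ge> s" using t_bound[of n] by auto
  then show "c n * packet s (t n) m x = 0" using packet_eq_0 s_pos by simp
qed

lemma packet_support: "n < N \<Longrightarrow> \<bar>x\<bar> \<ge> R1 \<Longrightarrow> packet s (t n) m x = 0"
  using t_bound[of n] by (intro packet_eq_0 s_pos) auto

lemma smooth_f: "smooth_fun (f 0)"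
  by (rule smooth_funI) (rule f_deriv)

lemma nth_deriv_f: "nth_deriv m (f 0) = f m"
  by (rule nth_deriv_eqI) (rule f_deriv)

lemma compact_support_f: "compact_support (f 0)"
proof -
  have "{x. f 0 x \<noteq> 0} \<subseteq> {-R1..R1}" using f_eq_0[of _ 0] by (auto simp: not_le abs_le_iff) (smt (verit))+
  then have "bounded {x. f 0 x \<noteq> 0}" using bounded_subset bounded_closed_interval by blast
  then show ?thesis by (simp add: compact_support_def compact_closure)
qed

lemma nth_deriv_fourier_f: "nth_deriv k (fourier (f 0)) = fmom R1 (f 0) k"
  by (rule nth_deriv_fourier) (auto simp: continuous_f f_eq_0)

lemma fmom_f: "fmom R1 (f 0) k \<xi> = (\<Sum>n<N. c n * fmom R1 (packet s (t n) 0) k \<xi>)"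
  unfolding f_def[abs_def] by (rule fmom_sum) (auto simp: continuous_packet)

lemma fmom_f_0: "fmom R1 (f 0) 0 \<xi> = s * fmom 1 (cbump 0) 0 (s * \<xi>) * p \<xi>"
proof -
  have "fmom R1 (packet s (t n) 0) 0 \<xi> = s * fker (t n) \<xi> * fmom 1 (cbump 0) 0 (s * \<xi>)" if "n < N" for n
    using fourier_packet[OF s_pos, of "t n" \<xi>]
      fourier_eq_fmom[OF continuous_packet, of R1 s "t n" 0 \<xi>] packet_support[OF that] by simp
  then show ?thesis
    unfolding fmom_f p_def by (simp add: sum_distrib_left mult_ac)
qed

section \<open>The trigonometric polynomial at and between grid frequencies\<close>

lemma norm_p_le: "norm (p \<xi>) \<le> (real D)\<^sup>2"
proof -
  have "norm (p \<xi>) \<le> (\<Sum>n<N. norm (c n * fker (t n) \<xi>))" unfolding p_def by (rule norm_sum)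
  then show ?thesis using sum_norm_c by (simp add: norm_mult)
qed

text \<open>Carries bounds from the grid to the real line. Its three powers of \<open>D\<close> are
  harmless against the frequency step \<open>1 / real D ^ q\<close>.\<close>

lemma p_lipschitz: "norm (p x - p y) \<le> 2 * pi * real D ^ 3 * \<bar>x - y\<bar>"
proof -
  have fk: "norm (fker u x - fker u y) \<le> 2 * pi * \<bar>u\<bar> * \<bar>x - y\<bar>" for u
  proof -
    have on: "onorm (\<lambda>h::real. h *\<^sub>R v) = norm v" for v :: complex
      using onorm_scaleR_left[OF bounded_linear_ident, of v] by (simp add: onorm_id)
    have "norm (fker u x - fker u y) \<le> (2 * pi * \<bar>u\<bar>) * norm (x - y)"
    proof (rule differentiable_bound[of UNIV])
      show "(fker u has_derivative (\<lambda>h. h *\<^sub>R ((- 2 * pi * \<i> * u) * fker u \<xi>))) (at \<xi> within UNIV)" for \<xi>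
        using fker_deriv_right unfolding has_vector_derivative_def .
      show "onorm (\<lambda>h. h *\<^sub>R ((- 2 * pi * \<i> * u) * fker u \<xi>)) \<le> 2 * pi * \<bar>u\<bar>" for \<xi>
        unfolding on by (simp add: norm_mult)
    qed auto
    then show ?thesis by simp
  qed
  have "norm (p x - p y) = norm (\<Sum>n<N. c n * (fker (t n) x - fker (t n) y))"
    by (simp add: p_def sum_subtractf right_diff_distrib)
  also have "\<dots> \<le> (\<Sum>n<N. norm (c n * (fker (t n) x - fker (t n) y)))" by (rule norm_sum)
  also have "\<dots> \<le> (\<Sum>n<N. norm (c n) * (2 * pi * real D * \<bar>x - y\<bar>))"
  proof (intro sum_mono)
    fix n assume "n \<in> {..<N}"
    then have "\<bar>t n\<bar> \<le> real D" using t_bound[of n] R1_le R1 s_pos by auto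
    then have "2 * pi * \<bar>t n\<bar> * \<bar>x - y\<bar> \<le> 2 * pi * real D * \<bar>x - y\<bar>"
      by (intro mult_right_mono mult_left_mono) auto
    then have "norm (fker (t n) x - fker (t n) y) \<le> 2 * pi * real D * \<bar>x - y\<bar>"
      using fk[of "t n"] by linarith
    then show "norm (c n * (fker (t n) x - fker (t n) y)) \<le> norm (c n) * (2 * pi * real D * \<bar>x - y\<bar>)"
      unfolding norm_mult by (intro mult_left_mono) auto
  qed
  also have "\<dots> = (\<Sum>n<N. norm (c n)) * (2 * pi * real D * \<bar>x - y\<bar>)"
    by (simp add: sum_distrib_right)
  also have "\<dots> \<le> (real D)\<^sup>2 * (2 * pi * real D * \<bar>x - y\<bar>)"
    by (intro mult_right_mono sum_norm_c) auto
  finally show ?thesis by (simp add: power3_eq_cube power2_eq_square mult_ac)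
qed

lemma M_pos: "M > 0"
  using D8 by (simp add: M_def)

lemma norm_p_grid: "norm (p (of_int g / real D ^ q)) = norm (\<Sum>n<N. c n * unity_pow M (- (g * int n)))"
proof -
  have "fker (t n) (of_int g / real D ^ q) = unity_pow M (g * int n0) * unity_pow M (- (g * int n))" for n
  proof -
    have phase: "2 * pi * t n * (of_int g / real D ^ q) = 2 * pi * of_int (g * int n - g * int n0) / real M"
      using D_pos by (simp add: t_def M_def power_add field_simps power2_eq_square)
    have "fker (t n) (of_int g / real D ^ q) = unity_pow M (- (g * int n - g * int n0))"
      unfolding fker_cis phase by (simp only: unity_pow_def of_int_minus mult_minus_right divide_minus_left)
    then show ?thesis by (simp flip: unity_pow_add)
  qed
  then have "p (of_int g / real D ^ q) = unity_pow M (g * int n0) * (\<Sum>n<N. c n * unity_pow M (- (g * int n)))"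
    by (simp add: p_def sum_distrib_left mult_ac)
  then show ?thesis by (simp add: norm_mult)
qed

lemma norm_p_grid_pos: "norm (p (real g / real D ^ q)) = norm (dft M N c g)"
  using norm_p_grid[of "int g"] by (simp add: dft_def)

text \<open>By periodicity the frequency index \<open>- g\<close> is represented by
  \<open>M - g\<close>, so the range \<open>{K+1..<M-K}\<close> covers both signs
  symmetrically.\<close>

lemma norm_p_grid_neg:
  assumes "g \<le> M"
  shows "norm (p (- (real g / real D ^ q))) = norm (dft M N c (M - g))"
proof -
  have "unity_pow M (int g * int n) = unity_pow M (- (int (M - g) * int n))" for n
  proof -
    have "unity_pow M (- (int M * int n)) = 1"
      by (subst unity_pow_eq_1) (auto simp: M_pos)
    moreover have "- (int (M - g) * int n) = - (int M * int n) + int g * int n"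
      using assms by (simp add: of_nat_diff algebra_simps)
    ultimately show ?thesis by (simp only: unity_pow_add mult_1)
  qed
  then show ?thesis using norm_p_grid[of "- int g"] by (simp add: dft_def)
qed

lemma K_le: "4 * K \<le> D ^ (q + 1)"
proof -
  have "real K \<le> R2 * real D ^ q" using R2 by (simp add: K_def)
  also have "\<dots> \<le> real D / 4 * real D ^ q" using R2_le by (intro mult_right_mono) auto
  finally have "real (4 * K) \<le> real (D ^ (q + 1))" by simp
  then show ?thesis by (simp only: of_nat_le_iff)
qed

lemma dft_outer: "g \<in> {K+1..<M-K} \<Longrightarrow> norm (dft M N c g) \<le> 1 / real D ^ q"
proof -
  assume g: "g \<in> {K+1..<M-K}"
  have "(norm (dft M N c g))\<^sup>2 \<le> (\<Sum>g\<in>{K+1..<M-K}. (norm (dft M N c g))\<^sup>2)"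
    using g by (intro member_le_sum) auto
  also have "\<dots> \<le> (1 / real D ^ q)\<^sup>2" using outer_small by (simp add: M_def N_def K_def)
  finally show ?thesis by (rule power2_le_imp_le) simp
qed

lemma norm_p_outer:
  assumes "R2 \<le> \<bar>x\<bar>" "\<bar>x\<bar> \<le> (real D)\<^sup>2"
  shows "norm (p x) \<le> real D ^ 4 / real D ^ q"
proof -
  \<comment> \<open>The added 1 rounds away from 0, so that a point with \<open>R2 \<le> |x|\<close>
    is compared with a grid index beyond \<open>K\<close>. The assumed upper bound on
    \<open>|x|\<close>, half a period, keeps \<open>g\<close> below \<open>M - K\<close>.\<close>
  define g where "g = nat \<lfloor>\<bar>x\<bar> * real D ^ q\<rfloor> + 1"
  define y where "y = (if x \<ge> 0 then real g / real D ^ q else - (real g / real D ^ q))"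
  have Dq: "real D ^ q > 0" using D_pos by simp
  have "K \<le> nat \<lfloor>\<bar>x\<bar> * real D ^ q\<rfloor>"
    unfolding K_def using assms(1) by (intro nat_mono floor_mono mult_right_mono) auto
  then have gK: "g \<ge> K + 1" by (simp add: g_def)
  have "\<lfloor>\<bar>x\<bar> * real D ^ q\<rfloor> \<le> \<lfloor>(real D)\<^sup>2 * real D ^ q\<rfloor>"
    using assms(2) by (intro floor_mono mult_right_mono) auto
  also have "(real D)\<^sup>2 * real D ^ q = real (D ^ (q + 2))"
    by (simp add: power_add power2_eq_square)
  finally have "\<lfloor>\<bar>x\<bar> * real D ^ q\<rfloor> \<le> int (D ^ (q + 2))" by (simp only: floor_of_nat)
  then have "g \<le> D ^ (q + 2) + 1" unfolding g_def by linarith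
  moreover have "K + 2 \<le> D ^ (q + 2)"
  proof -
    have "1 \<le> D ^ (q + 1)" using D8 by simp
    moreover have "D ^ (q + 2) = D * D ^ (q + 1)" by simp
    moreover have "8 * D ^ (q + 1) \<le> D * D ^ (q + 1)" using D8 by (intro mult_right_mono) auto
    ultimately show ?thesis using K_le by linarith
  qed
  ultimately have gM: "g < M - K" unfolding M_def by linarith
  have "M - g \<in> {K+1..<M-K}" using gK gM by auto
  then have "norm (p y) \<le> 1 / real D ^ q"
    using dft_outer[of g] dft_outer[of "M - g"] norm_p_grid_pos[of g] norm_p_grid_neg[of g] gK gM
    by (auto simp: y_def)
  moreover have "\<bar>x - y\<bar> \<le> 1 / real D ^ q"
  proof -
    have "\<bar>x\<bar> * real D ^ q \<ge> 0" by simp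
    then have "\<bar>\<bar>x\<bar> * real D ^ q - real g\<bar> \<le> 1" unfolding g_def by linarith
    then have "\<bar>\<bar>x\<bar> * real D ^ q - real g\<bar> / real D ^ q \<le> 1 / real D ^ q"
      using Dq by (intro divide_right_mono) auto
    moreover have "\<bar>\<bar>x\<bar> * real D ^ q - real g\<bar> / real D ^ q = \<bar>\<bar>x\<bar> - real g / real D ^ q\<bar>"
    proof -
      have "\<bar>x\<bar> - real g / real D ^ q = (\<bar>x\<bar> * real D ^ q - real g) / real D ^ q"
        using Dq by (simp add: diff_divide_distrib)
      then show ?thesis using Dq by (simp add: abs_divide)
    qed
    moreover have "\<bar>\<bar>x\<bar> - real g / real D ^ q\<bar> = \<bar>x - y\<bar>" by (auto simp: y_def)
    ultimately show ?thesis by simp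
  qed
  then have "2 * pi * real D ^ 3 * \<bar>x - y\<bar> \<le> 2 * pi * real D ^ 3 * (1 / real D ^ q)"
    by (intro mult_left_mono) auto
  moreover have "norm (p x) \<le> norm (p y) + norm (p x - p y)"
    using norm_triangle_sub by blast
  ultimately have "norm (p x) \<le> 1 / real D ^ q + 2 * pi * real D ^ 3 * (1 / real D ^ q)"
    using p_lipschitz[of x y] by linarith
  also have "\<dots> = (1 + 2 * pi * real D ^ 3) / real D ^ q" by (simp add: add_divide_distrib)
  also have "\<dots> \<le> real D ^ 4 / real D ^ q"
  proof (intro divide_right_mono)
    have "pi \<le> 3.2" using pi_approx by simp
    then have "2 * pi * real D ^ 3 \<le> 6.4 * real D ^ 3" by (intro mult_right_mono) auto
    moreover have "1 \<le> real D ^ 3" using D_pos by (intro one_le_power) auto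
    moreover have "8 * real D ^ 3 \<le> real D * real D ^ 3" using D_pos by (intro mult_right_mono) auto
    moreover have "real D * real D ^ 3 = real D ^ 4" by (simp flip: power_Suc)
    ultimately show "1 + 2 * pi * real D ^ 3 \<le> real D ^ 4" by linarith
  qed (use Dq in simp)
  finally show ?thesis .
qed

text \<open>Up to half a period \<open>p\<close> is small and the transform of the bump merely
  bounded. Farther out \<open>p\<close> may be large again, but there
  \<open>|s * x|\<^sup>2 \<ge> |x| / 16\<close> and the transform of the bump has decayed. The bound
  is shaped to fit both ranges and to decrease in \<open>|x|\<close>, as
  \<open>derivatives_small_both\<close> requires.\<close>

lemma fourier_f_outer:
  assumes "R2 \<le> \<bar>x\<bar>"
  shows "norm (fmom R1 (f 0) 0 x) \<le> (1 / (real D * (1 + \<bar>x\<bar>))) ^ Q"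
proof -
  have eq: "norm (fmom R1 (f 0) 0 x) = s * norm (fmom 1 (cbump 0) 0 (s * x)) * norm (p x)"
    unfolding fmom_f_0 using s_pos by (simp add: norm_mult)
  have pos: "real D * (1 + \<bar>x\<bar>) > 0" using D_pos by (simp add: add_pos_nonneg)
  show ?thesis
  proof (cases "\<bar>x\<bar> \<le> (real D)\<^sup>2")
    case True
    have "norm (fmom 1 (cbump 0) 0 (s * x)) \<le> real D"
      using norm_fmom_le[OF continuous_cbump B(1), of 1 0 "s * x"] B(2) by simp
    then have bump_le: "s * norm (fmom 1 (cbump 0) 0 (s * x)) \<le> 1 * real D"
      using s_le_1 s_pos by (intro mult_mono) auto
    then have "norm (fmom R1 (f 0) 0 x) \<le> (1 * real D) * (real D ^ 4 / real D ^ q)"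
      unfolding eq using norm_p_outer[OF assms True] by (intro mult_mono[OF bump_le]) auto
    also have "\<dots> = real D ^ 5 / real D ^ q" by (simp add: eval_nat_numeral)
    \<comment> \<open>The origin of \<open>q = 4 * Q + 5\<close>: five powers of \<open>D\<close>
      pay for the bump factor and the step off the grid, and \<open>real D ^ 4\<close> dominates
      \<open>real D * (1 + |x|)\<close> in this range.\<close>
    also have "\<dots> = 1 / (real D ^ 4) ^ Q"
      using D_pos by (simp add: q power_add power_mult)
    also have "\<dots> \<le> 1 / (real D * (1 + \<bar>x\<bar>)) ^ Q"
    proof (intro divide_left_mono power_mono mult_pos_pos zero_less_power pos)
      have "1 \<le> (real D)\<^sup>2" using D_pos by (intro one_le_power) auto
      then have "1 + \<bar>x\<bar> \<le> 2 * (real D)\<^sup>2" using True by simp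
      also have "\<dots> \<le> real D * (real D)\<^sup>2" using D_pos by (intro mult_right_mono) auto
      finally have "real D * (1 + \<bar>x\<bar>) \<le> real D * (real D * (real D)\<^sup>2)" using D_pos by (intro mult_left_mono) auto
      then show "real D * (1 + \<bar>x\<bar>) \<le> real D ^ 4" by (simp add: eval_nat_numeral mult_ac)
    qed (use pos D_pos in auto)
    finally show ?thesis by (simp add: power_one_over)
  next
    case False
    \<comment> \<open>Of the \<open>2 * m\<close> powers of \<open>s * x\<close> half are lost to
      the dilation, leaving \<open>|x| ^ m\<close>. Two of these pay for the cube of
      \<open>D\<close>, and the remaining \<open>2 * Q\<close> dominate the target.\<close>
    define m where "m = 2 * Q + 2"
    have x1: "\<bar>x\<bar> > (real D)\<^sup>2" using False by simp
    have D2: "(real D)\<^sup>2 \<ge> 1" using D_pos by (intro one_le_power) auto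
    have sx: "\<bar>x\<bar> / 16 \<le> \<bar>s * x\<bar>\<^sup>2"
    proof -
      have "\<bar>x\<bar> * (real D)\<^sup>2 \<le> \<bar>x\<bar> * \<bar>x\<bar>" using x1 by (intro mult_left_mono) auto
      then show ?thesis using D_pos by (simp add: s_def power_divide power_mult_distrib field_simps power2_eq_square)
    qed
    have xpos: "\<bar>x\<bar> / 16 > 0" using x1 D2 by linarith
    have "(\<bar>x\<bar> / 16) ^ m * norm (fmom 1 (cbump 0) 0 (s * x)) \<le> (\<bar>s * x\<bar>\<^sup>2) ^ m * norm (fmom 1 (cbump 0) 0 (s * x))"
      using sx by (intro mult_right_mono power_mono) auto
    also have "\<dots> \<le> C" using C(1)[of "s * x"] by (simp only: m_def power_mult)
    finally have "norm (fmom 1 (cbump 0) 0 (s * x)) \<le> C / (\<bar>x\<bar> / 16) ^ m"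
      using xpos by (simp add: pos_le_divide_eq mult.commute)
    also have "\<dots> = C * 16 ^ m / \<bar>x\<bar> ^ m" by (simp add: power_divide)
    also have "\<dots> \<le> real D / \<bar>x\<bar> ^ m" using C(2) by (intro divide_right_mono) (auto simp: m_def)
    finally have bump_le: "s * norm (fmom 1 (cbump 0) 0 (s * x)) \<le> 1 * (real D / \<bar>x\<bar> ^ m)"
      using s_le_1 s_pos by (intro mult_mono) auto
    then have "norm (fmom R1 (f 0) 0 x) \<le> (1 * (real D / \<bar>x\<bar> ^ m)) * (real D)\<^sup>2"
      unfolding eq using norm_p_le by (intro mult_mono[OF bump_le]) auto
    also have "\<dots> = real D * (real D)\<^sup>2 / \<bar>x\<bar> ^ m" by simp
    also have "\<dots> \<le> \<bar>x\<bar>\<^sup>2 / \<bar>x\<bar> ^ m"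
    proof (intro divide_right_mono)
      have "real D * 1 \<le> real D * real D" using D_pos by (intro mult_left_mono) auto
      then have "real D \<le> \<bar>x\<bar>" using x1 by (simp add: power2_eq_square)
      then have "real D * (real D)\<^sup>2 \<le> \<bar>x\<bar> * \<bar>x\<bar>" using x1 by (intro mult_mono) auto
      then show "real D * (real D)\<^sup>2 \<le> \<bar>x\<bar>\<^sup>2" by (simp only: power2_eq_square)
    qed simp
    also have "\<dots> = 1 / (\<bar>x\<bar>\<^sup>2) ^ Q"
    proof -
      have "\<bar>x\<bar> ^ m = (\<bar>x\<bar>\<^sup>2) ^ Q * \<bar>x\<bar>\<^sup>2"
        by (simp only: m_def power_add power_mult)
      moreover have "\<bar>x\<bar>\<^sup>2 \<noteq> 0" using xpos by simp
      ultimately show ?thesis by (metis nonzero_divide_mult_cancel_right)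
    qed
    also have "\<dots> \<le> 1 / (real D * (1 + \<bar>x\<bar>)) ^ Q"
    proof (intro divide_left_mono power_mono mult_pos_pos zero_less_power pos)
      have "1 \<le> \<bar>x\<bar>" using x1 D2 by linarith
      then have "real D * (1 + \<bar>x\<bar>) \<le> real D * (2 * \<bar>x\<bar>)" by (intro mult_left_mono) auto
      also have "\<dots> = (2 * real D) * \<bar>x\<bar>" by simp
      also have "\<dots> \<le> (real D * real D) * \<bar>x\<bar>" using D_pos by (intro mult_right_mono) auto
      also have "\<dots> \<le> \<bar>x\<bar> * \<bar>x\<bar>" using x1 by (intro mult_right_mono) (auto simp: power2_eq_square)
      finally show "real D * (1 + \<bar>x\<bar>) \<le> \<bar>x\<bar>\<^sup>2" by (simp only: power2_eq_square abs_mult)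
    qed (use pos xpos D8 in auto)
    finally show ?thesis by (simp add: power_one_over)
  qed
qed

lemma norm_f_le: "norm (f 0 x) \<le> real D ^ 3"
proof -
  have "norm (f 0 x) \<le> (\<Sum>n<N. norm (c n * packet s (t n) 0 x))" unfolding f_def by (rule norm_sum)
  also have "\<dots> \<le> (\<Sum>n<N. norm (c n) * real D)"
  proof (intro sum_mono)
    fix n
    have "B \<ge> 0" using B(1)[of 0] norm_ge_zero order_trans by blast
    then have "norm (packet s (t n) 0 x) \<le> real D"
      using B(1)[of "(x - t n) / s"] B(2) by (simp add: packet_def)
    then show "norm (c n * packet s (t n) 0 x) \<le> norm (c n) * real D"
      unfolding norm_mult by (intro mult_left_mono) auto
  qed
  also have "\<dots> = (\<Sum>n<N. norm (c n)) * real D" by (simp add: sum_distrib_right)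
  also have "\<dots> \<le> (real D)\<^sup>2 * real D" by (intro mult_right_mono sum_norm_c) auto
  finally show ?thesis by (simp add: eval_nat_numeral)
qed

lemma norm_fmom_f_le:
  assumes "k \<le> n + 1"
  shows "norm (fmom R1 (f 0) k x) \<le> real D ^ (2 * n + 6)"
proof -
  have pi4: "pi \<le> 4" using pi_approx by simp
  have "2 * pi * R1 \<le> 2 * 4 * R1" using pi4 R1 by (intro mult_right_mono) auto
  also have "\<dots> \<le> 2 * real D" using R1_le by simp
  also have "\<dots> \<le> real D * real D" using D_pos by (intro mult_right_mono) auto
  finally have base: "2 * pi * R1 \<le> (real D)\<^sup>2" by (simp add: power2_eq_square)
  have "norm (fmom R1 (f 0) k x) \<le> (2 * pi * R1) ^ k * real D ^ 3 * (2 * R1)"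
    by (rule norm_fmom_le) (use R1 norm_f_le continuous_f in auto)
  also have "\<dots> \<le> ((real D)\<^sup>2) ^ (n + 1) * real D ^ 3 * real D"
  proof (intro mult_mono)
    have "(2 * pi * R1) ^ k \<le> ((real D)\<^sup>2) ^ k" using base R1 by (intro power_mono) auto
    also have "\<dots> \<le> ((real D)\<^sup>2) ^ (n + 1)"
      using assms D_pos by (intro power_increasing) (auto intro!: one_le_power)
    finally show "(2 * pi * R1) ^ k \<le> ((real D)\<^sup>2) ^ (n + 1)" .
  qed (use R1 R1_le in auto)
  also have "\<dots> = real D ^ (2 * n + 6)"
    by (simp add: power_add power_mult eval_nat_numeral power_mult_distrib mult_ac)
  finally show ?thesis .
qed

text \<open>Since \<open>Q = P * 2 ^ n\<close>, the bound for order 0 is the \<open>2 ^ n\<close>-th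
  power of the last factor here, and at least its first power survives \<open>k \<le> n\<close>
  derivatives. The front factor comes from the constants \<open>3 * M\<close> in
  \<open>derivatives_small_both\<close>, with \<open>3 \<le> real D\<close>.\<close>

lemma fourier_deriv_f_outer:
  assumes Q: "Q = P * 2 ^ n" and k: "k \<le> n" and x: "R2 \<le> \<bar>x\<bar>"
  shows "norm (fmom R1 (f 0) k x) \<le> real D ^ ((2 * n + 7) * n) * (1 / (real D * (1 + \<bar>x\<bar>))) ^ P"
proof -
  define H where "H = (\<lambda>y. (1 / (real D * (1 + y))) ^ P)"
  have D1: "real D \<ge> 1" using D_pos by simp
  have base: "0 < 1 / (real D * (1 + y))" "1 / (real D * (1 + y)) \<le> 1" if "y \<ge> R2" for y
  proof -
    have "real D * (1 + y) \<ge> 1 * 1" using D1 that R2 by (intro mult_mono) auto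
    then show "0 < 1 / (real D * (1 + y))" "1 / (real D * (1 + y)) \<le> 1" by auto
  qed
  have "norm (fmom R1 (f 0) k x) \<le> (3 * real D ^ (2 * n + 6)) ^ k * H \<bar>x\<bar> ^ (2 ^ (n - k))"
  proof (rule derivatives_small_both[where a = R2 and g = "fmom R1 (f 0)" and H = H])
    show "(fmom R1 (f 0) k has_vector_derivative fmom R1 (f 0) (Suc k) x) (at x)" for k x
      by (rule fmom_deriv) (rule continuous_f)
    show "1 \<le> real D ^ (2 * n + 6)" using D1 by (rule one_le_power)
    show "norm (fmom R1 (f 0) k x) \<le> real D ^ (2 * n + 6)" if "k \<le> Suc n" for k x
      using that by (intro norm_fmom_f_le) simp
    show "H y > 0" if "y \<ge> R2" for y using base[OF that] by (simp add: H_def)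
    show "H y \<le> H z" if "R2 \<le> z" "z \<le> y" for z y
      unfolding H_def using that R2 D_pos
      by (intro power_mono divide_left_mono mult_left_mono mult_pos_pos) auto
    show "norm (fmom R1 (f 0) 0 y) \<le> H \<bar>y\<bar> ^ (2 ^ n)" if "R2 \<le> \<bar>y\<bar>" for y
      using fourier_f_outer[OF that] by (simp add: H_def Q power_mult)
  qed (use k x R2 in auto)
  also have "\<dots> \<le> real D ^ ((2 * n + 7) * n) * H \<bar>x\<bar>"
  proof (intro mult_mono)
    have "3 * real D ^ (2 * n + 6) \<le> real D * real D ^ (2 * n + 6)"
      using D_pos by (intro mult_right_mono) auto
    also have "real D * real D ^ (2 * n + 6) = real D ^ (2 * n + 7)"
      by (simp add: power_add eval_nat_numeral mult_ac)
    finally have "3 * real D ^ (2 * n + 6) \<le> real D ^ (2 * n + 7)" .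
    then have "(3 * real D ^ (2 * n + 6)) ^ k \<le> (real D ^ (2 * n + 7)) ^ k"
      by (intro power_mono) auto
    also have "\<dots> \<le> (real D ^ (2 * n + 7)) ^ n"
      using k D1 by (intro power_increasing one_le_power) auto
    finally show "(3 * real D ^ (2 * n + 6)) ^ k \<le> real D ^ ((2 * n + 7) * n)" by (simp add: power_mult)
    have "0 \<le> H \<bar>x\<bar>" "H \<bar>x\<bar> \<le> 1" unfolding H_def using base[OF x] by (auto intro!: power_le_one)
    then have "H \<bar>x\<bar> ^ 2 ^ (n - k) \<le> H \<bar>x\<bar> ^ 1" by (intro power_decreasing) auto
    then show "H \<bar>x\<bar> ^ 2 ^ (n - k) \<le> H \<bar>x\<bar>" by simp
    show "0 \<le> H \<bar>x\<bar> ^ 2 ^ (n - k)" using \<open>0 \<le> H \<bar>x\<bar>\<close> by simp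
  qed simp
  finally show ?thesis by (simp add: H_def)
qed

section \<open>Lower bounds for the test function\<close>

text \<open>By Parseval the \<open>M\<close> samples have energy \<open>M\<close>, of which the
  outer ones hold at most 1; so some inner sample has modulus at least \<open>1/2\<close>. At inner
  frequencies \<open>|s * x| \<le> 1/16\<close>, where the transform of the bump is at least
  \<open>a\<close>. The 8 combines this \<open>1/2\<close> with
  \<open>s = 1 / (4 * real D)\<close>.\<close>

lemma fourier_f_lower: "\<exists>x. a / (8 * real D) \<le> norm (fmom R1 (f 0) 0 x)"
proof -
  have NM: "N \<le> M"
  proof -
    have "D ^ 4 \<le> D ^ (q + 2)" using D8 by (intro power_increasing) (auto simp: q)
    moreover have "N \<le> D ^ 4" using N_le by (simp flip: of_nat_power)
    ultimately show ?thesis by (simp add: M_def)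
  qed
  have M4: "real M \<ge> 4"
  proof -
    have "real D ^ 1 \<le> real D ^ (q + 2)" using D_pos by (intro power_increasing) auto
    moreover have "real M = 2 * real D ^ (q + 2)" by (simp add: M_def)
    ultimately show ?thesis using D_pos by (simp only: power_one_right)
  qed
  have total: "(\<Sum>g<M. (norm (dft M N c g))\<^sup>2) = real M"
    using dft_parseval[OF NM, of c] normalized by (simp add: N_def)
  have "\<exists>g<M. g \<notin> {K+1..<M-K} \<and> (norm (dft M N c g))\<^sup>2 \<ge> 1/4"
  proof (rule ccontr)
    assume "\<not> ?thesis"
    then have small: "\<And>g. g \<in> {..<M} - {K+1..<M-K} \<Longrightarrow> (norm (dft M N c g))\<^sup>2 \<le> 1/4" by force
    have "(\<Sum>g<M. (norm (dft M N c g))\<^sup>2)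
       = (\<Sum>g\<in>{..<M} - {K+1..<M-K}. (norm (dft M N c g))\<^sup>2) + (\<Sum>g\<in>{K+1..<M-K}. (norm (dft M N c g))\<^sup>2)"
      by (rule sum.subset_diff) auto
    also have "(\<Sum>g\<in>{K+1..<M-K}. (norm (dft M N c g))\<^sup>2) \<le> (1 / real D ^ q)\<^sup>2"
      using outer_small by (simp add: M_def N_def K_def)
    also have "(1 / real D ^ q)\<^sup>2 \<le> 1"
      using D_pos by (intro power_le_one) (auto simp: divide_le_eq intro!: one_le_power)
    also have "(\<Sum>g\<in>{..<M} - {K+1..<M-K}. (norm (dft M N c g))\<^sup>2) \<le> of_nat (card ({..<M} - {K+1..<M-K})) * (1/4)"
      by (intro sum_bounded_above small)
    also have "\<dots> \<le> real M * (1/4)"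
      using card_mono[of "{..<M}" "{..<M} - {K+1..<M-K}"] by (intro mult_right_mono) auto
    finally show False using total M4 by simp
  qed
  then obtain g where g: "g < M" "g \<notin> {K+1..<M-K}" "(1/2)\<^sup>2 \<le> (norm (dft M N c g))\<^sup>2"
    by (auto simp: power2_eq_square)
  have half: "1/2 \<le> norm (dft M N c g)" using g(3) by (rule power2_le_imp_le) simp
  have KR: "real K / real D ^ q \<le> real D / 4"
  proof -
    have "real K \<le> R2 * real D ^ q" using R2 by (simp add: K_def)
    then have "real K / real D ^ q \<le> R2" using D_pos by (simp add: divide_le_eq)
    then show ?thesis using R2_le by linarith
  qed
  have "\<exists>x. \<bar>x\<bar> \<le> real D / 4 \<and> 1/2 \<le> norm (p x)"
  proof (cases "g \<le> K")
    case True
    then have "real g / real D ^ q \<le> real K / real D ^ q" by (intro divide_right_mono) auto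
    moreover have "0 \<le> real g / real D ^ q" by simp
    ultimately have "\<bar>real g / real D ^ q\<bar> \<le> real D / 4" using KR by linarith
    then show ?thesis using half norm_p_grid_pos[of g] by metis
  next
    case False
    then have gK: "M - g \<le> K" using g by simp
    then have "real (M - g) / real D ^ q \<le> real K / real D ^ q" by (intro divide_right_mono) auto
    moreover have "0 \<le> real (M - g) / real D ^ q" by simp
    ultimately have "\<bar>- (real (M - g) / real D ^ q)\<bar> \<le> real D / 4" using KR by linarith
    moreover have "M - (M - g) = g" "M - g \<le> M" using g(1) by simp_all
    ultimately show ?thesis using half norm_p_grid_neg[of "M - g"] by metis
  qed
  then obtain x where x: "\<bar>x\<bar> \<le> real D / 4" "1/2 \<le> norm (p x)" by blast
  have "\<bar>s * x\<bar> \<le> 1/6"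
  proof -
    have "s * \<bar>x\<bar> \<le> s * (real D / 4)" using x s_pos by (intro mult_left_mono) auto
    also have "\<dots> = 1/16" using D_pos by (simp add: s_def)
    finally show ?thesis using s_pos by (simp add: abs_mult)
  qed
  then have "a \<le> norm (fmom 1 (cbump 0) 0 (s * x))" by (rule a)
  then have "s * a * (1/2) \<le> s * norm (fmom 1 (cbump 0) 0 (s * x)) * norm (p x)"
    using s_pos a x by (intro mult_mono) auto
  also have "\<dots> = norm (fmom R1 (f 0) 0 x)"
    unfolding fmom_f_0 using s_pos by (simp add: norm_mult)
  finally show ?thesis by (intro exI[of _ x]) (simp add: s_def)
qed

text \<open>The transform is at most the length of the support,
  \<open>2 * R1 \<le> real D / 2\<close>, times the supremum of \<open>f\<close>.\<close>

lemma f_large: "\<exists>x. \<bar>x\<bar> \<le> R1 \<and> a / (8 * (real D)\<^sup>2) \<le> norm (f 0 x)"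
proof (rule ccontr)
  assume "\<not> ?thesis"
  then have le: "norm (f 0 x) \<le> a / (8 * (real D)\<^sup>2)" for x
    using f_eq_0[of x 0] a by (cases "\<bar>x\<bar> \<le> R1") auto
  obtain x where "a / (8 * real D) \<le> norm (fmom R1 (f 0) 0 x)" using fourier_f_lower by blast
  also have "\<dots> \<le> (2 * pi * R1) ^ 0 * (a / (8 * (real D)\<^sup>2)) * (2 * R1)"
    by (rule norm_fmom_le) (use R1 le continuous_f in auto)
  also have "\<dots> \<le> 1 * (a / (8 * (real D)\<^sup>2)) * (real D / 2)"
    using R1_le R1 a by (intro mult_mono) auto
  also have "\<dots> = a / (8 * real D) / 2" using D_pos by (simp add: power2_eq_square)
  finally show False using a D_pos by (simp add: field_simps)
qed

end

section \<open>Counting nodes\<close>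

context packet_sum
begin

text \<open>Nodes \<open>lam i\<close> beyond \<open>R1\<close> drop out because \<open>f\<close>
  and its derivatives vanish there, so \<open>f\<close> is represented by the tail over
  \<open>|mu j| > R2\<close> alone. That tail is of order \<open>1 / real D ^ 3\<close>, too small
  for the point supplied by \<open>f_large\<close>.\<close>

lemma interpolation_contradiction:
  fixes I :: "'i set" and lam :: "'i \<Rightarrow> real" and r :: "'i \<Rightarrow> nat" and \<alpha> :: "'i \<Rightarrow> real \<Rightarrow> complex"
    and J :: "'j set" and mu :: "'j \<Rightarrow> real" and k :: "'j \<Rightarrow> nat" and b :: "'j \<Rightarrow> real \<Rightarrow> complex"
    and L U \<kappa> :: real and n P :: nat
  assumes interp: "\<And>f x. smooth_fun f \<Longrightarrow> compact_support f \<Longrightarrow>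
        (\<lambda>i. nth_deriv (r i) f (lam i) * \<alpha> i x) summable_on I \<and>
        (\<lambda>j. nth_deriv (k j) (fourier f) (mu j) * b j x) summable_on J \<and>
        f x = (\<Sum>\<^sub>\<infinity>i\<in>I. nth_deriv (r i) f (lam i) * \<alpha> i x)
            + (\<Sum>\<^sub>\<infinity>j\<in>J. nth_deriv (k j) (fourier f) (mu j) * b j x)"
    and k: "\<And>j. j \<in> J \<Longrightarrow> k j \<le> n"
    and w: "(\<lambda>j. (1 + \<bar>mu j\<bar>) powr (- (L + 2))) summable_on J"
    and b: "\<And>j x. j \<in> J \<Longrightarrow> norm (b j x) \<le> \<kappa> * (1 + \<bar>x\<bar>) powr U * (1 + \<bar>mu j\<bar>) powr U"
    and \<kappa>: "\<kappa> > 0" and U: "U > 0" and L: "L > 0"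
    and P: "P = (2 * n + 7) * n + nat \<lceil>U\<rceil> + nat \<lceil>L\<rceil> + 6" and Q: "Q = P * 2 ^ n"
    and zero_lam: "\<And>i. i \<in> I \<Longrightarrow> \<bar>lam i\<bar> \<le> R1 \<Longrightarrow> f (r i) (lam i) = 0"
    and zero_mu: "\<And>j. j \<in> J \<Longrightarrow> \<bar>mu j\<bar> \<le> R2 \<Longrightarrow> fmom R1 (f 0) (k j) (mu j) = 0"
    and D: "a * real D > 8 * (\<kappa> * (\<Sum>\<^sub>\<infinity>j\<in>J. (1 + \<bar>mu j\<bar>) powr (- (L + 2))))"
  shows False
proof -
  define W where "W = (\<lambda>j. (1 + \<bar>mu j\<bar>) powr (- (L + 2)))"
  define E where "E = (2 * n + 7) * n"
  obtain x where x: "\<bar>x\<bar> \<le> R1" "a / (8 * (real D)\<^sup>2) \<le> norm (f 0 x)" using f_large by blast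
  have D1: "real D \<ge> 1" using D_pos by simp
  \<comment> \<open>The point lies inside \<open>[-R1, R1]\<close>, so the growth of
    \<open>b\<close> in \<open>x\<close> costs only a fixed power of \<open>D\<close>.\<close>
  have xD: "1 + \<bar>x\<bar> \<le> real D" using x(1) R1_le D_pos by linarith
  define h where "h = (\<lambda>j. fmom R1 (f 0) (k j) (mu j) * b j x)"
  have sum_h: "h summable_on J" and fx: "f 0 x = (\<Sum>\<^sub>\<infinity>j\<in>J. h j)"
  proof -
    have "f (r i) (lam i) * \<alpha> i x = 0" if "i \<in> I" for i
      using zero_lam[OF that] f_eq_0[of "lam i" "r i"] by (cases "\<bar>lam i\<bar> \<le> R1") auto
    then have "(\<Sum>\<^sub>\<infinity>i\<in>I. f (r i) (lam i) * \<alpha> i x) = 0" by (rule infsum_0)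
    then show "h summable_on J" "f 0 x = (\<Sum>\<^sub>\<infinity>j\<in>J. h j)"
      using interp[OF smooth_f compact_support_f, of x]
      by (simp_all add: nth_deriv_f nth_deriv_fourier_f h_def)
  qed
  have term_le: "norm (h j) \<le> \<kappa> / real D ^ 3 * W j" if j: "j \<in> J" for j
  proof (cases "\<bar>mu j\<bar> \<le> R2")
    case True
    then show ?thesis using zero_mu[OF j] \<kappa> by (simp add: h_def W_def)
  next
    case False
    define y where "y = 1 + \<bar>mu j\<bar>"
    have y: "y \<ge> 1" by (simp add: y_def)
    have "norm (fmom R1 (f 0) (k j) (mu j)) \<le> real D ^ E * (1 / (real D * y)) ^ P"
      unfolding E_def y_def using False by (intro fourier_deriv_f_outer[OF Q k[OF j]]) auto
    moreover have "norm (b j x) \<le> \<kappa> * real D ^ nat \<lceil>U\<rceil> * y powr U"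
    proof -
      have "(1 + \<bar>x\<bar>) powr U \<le> real D powr U" using xD U by (intro powr_mono2) auto
      also have "\<dots> \<le> real D powr real (nat \<lceil>U\<rceil>)" using D1 U by (intro powr_mono) linarith+
      also have "\<dots> = real D ^ nat \<lceil>U\<rceil>" using D_pos by (simp add: powr_realpow)
      finally have "\<kappa> * (1 + \<bar>x\<bar>) powr U * y powr U \<le> \<kappa> * real D ^ nat \<lceil>U\<rceil> * y powr U"
        using \<kappa> by (intro mult_right_mono mult_left_mono) auto
      then show ?thesis using b[OF j, of x] by (simp add: y_def)
    qed
    ultimately have "norm (h j) \<le> (real D ^ E * (1 / (real D * y)) ^ P) * (\<kappa> * real D ^ nat \<lceil>U\<rceil> * y powr U)"
      unfolding h_def norm_mult using y by (intro mult_mono) auto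
    also have "\<dots> = \<kappa> * (real D ^ (E + nat \<lceil>U\<rceil>) / real D ^ P) * (y powr U / y ^ P)"
      using y D_pos by (simp add: power_add power_divide power_mult_distrib)
    also have "\<dots> \<le> \<kappa> * (1 / real D ^ 3) * W j"
    proof (intro mult_mono mult_left_mono)
      \<comment> \<open>The budget of \<open>P\<close>: \<open>E\<close> for the derivative
        constants, \<open>nat \<lceil>U\<rceil>\<close> for the growth of \<open>b\<close> in
        \<open>x\<close>, the rest for the gain of \<open>real D ^ 3\<close>. The same
        \<open>P\<close> covers \<open>U + L + 2\<close> powers of
        \<open>1 + |mu j|\<close>.\<close>
      have "P = (E + nat \<lceil>U\<rceil>) + (nat \<lceil>L\<rceil> + 6)" by (simp add: P E_def)
      then have "real D ^ (E + nat \<lceil>U\<rceil>) / real D ^ P = 1 / real D ^ (nat \<lceil>L\<rceil> + 6)"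
        using D_pos by (simp add: power_add)
      also have "\<dots> \<le> 1 / real D ^ 3"
        using D1 D_pos by (intro divide_left_mono power_increasing) auto
      finally show "real D ^ (E + nat \<lceil>U\<rceil>) / real D ^ P \<le> 1 / real D ^ 3" .
      have "U + L + 2 \<le> real P"
      proof -
        have "U \<le> real (nat \<lceil>U\<rceil>)" "L \<le> real (nat \<lceil>L\<rceil>)" by linarith+
        moreover have "real P = real E + real (nat \<lceil>U\<rceil>) + real (nat \<lceil>L\<rceil>) + 6"
          by (simp only: P E_def of_nat_add of_nat_numeral)
        ultimately show ?thesis by linarith
      qed
      then have "y powr (U - real P) \<le> y powr (- (L + 2))" using y by (intro powr_mono) auto
      then show "y powr U / y ^ P \<le> W j"
        using y by (simp add: W_def y_def[symmetric] powr_diff powr_realpow)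
    qed (use \<kappa> y in auto)
    finally show ?thesis by simp
  qed
  have sW: "(\<lambda>j. \<kappa> / real D ^ 3 * W j) summable_on J"
    using w unfolding W_def by (rule summable_on_cmult_right)
  have habs: "(\<lambda>j. norm (h j)) summable_on J"
    using sum_h summable_on_iff_abs_summable_on_complex by blast
  have "norm (f 0 x) \<le> (\<Sum>\<^sub>\<infinity>j\<in>J. norm (h j))"
    unfolding fx by (rule norm_infsum_bound) (rule habs)
  also have "\<dots> \<le> (\<Sum>\<^sub>\<infinity>j\<in>J. \<kappa> / real D ^ 3 * W j)"
    by (rule infsum_mono[OF habs sW term_le])
  also have "\<dots> = \<kappa> / real D ^ 3 * (\<Sum>\<^sub>\<infinity>j\<in>J. W j)" by (rule infsum_cmult_right')
  finally have "a / (8 * (real D)\<^sup>2) \<le> \<kappa> / real D ^ 3 * (\<Sum>\<^sub>\<infinity>j\<in>J. W j)" using x(2) by linarith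
  then have "a / (8 * (real D)\<^sup>2) * (8 * real D ^ 3) \<le> \<kappa> / real D ^ 3 * (\<Sum>\<^sub>\<infinity>j\<in>J. W j) * (8 * real D ^ 3)"
    by (intro mult_right_mono) auto
  then have "a * real D \<le> 8 * (\<kappa> * (\<Sum>\<^sub>\<infinity>j\<in>J. W j))"
    using D_pos by (simp add: power2_eq_square power3_eq_cube mult_ac)
  then show False using D by (simp add: W_def)
qed

end

section \<open>Numerical choice of the parameters\<close>

text \<open>The main term is \<open>N * (2 * K + 1) / M\<close>. The deficit 4 is one each for the
  factor \<open>1 / (1 - \<delta>)\<close>, the rounding of \<open>K\<close>, the margin
  \<open>1 / (4 * real D)\<close> at the ends of the time interval, and the rounding of
  \<open>n0\<close>.\<close>

lemma main_term_estimate: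
  fixes D q n0 :: nat and R1 R2 :: real
  defines "N \<equiv> 2 * n0 + 1" and "M \<equiv> 2 * D ^ (q + 2)" and "K \<equiv> nat \<lfloor>R2 * real D ^ q\<rfloor>"
  assumes D: "D \<ge> 8" and q: "q \<ge> 2" and R: "R1 > 1" "R2 > 1" "4 * R1 * R2 \<le> real D"
    and n0: "n0 = nat \<lfloor>2 * (real D)\<^sup>2 * (R1 - 1 / (4 * real D))\<rfloor>"
    and \<delta>: "\<delta> = 1 / (2 * real D ^ (3 * q + 2))"
  shows "N \<le> D ^ 4" "N \<le> M" "2 * (K + 1) \<le> M"
    "real N - real N * real (M - K - (K + 1)) / real M / (1 - \<delta>) \<ge> 4 * R1 * R2 - 4"
proof -
  have D8: "real D \<ge> 8" using D by simp
  have R1_le: "4 * R1 \<le> real D"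
  proof -
    have "4 * R1 * 1 \<le> 4 * R1 * R2" using R by (intro mult_left_mono) auto
    then show ?thesis using R by linarith
  qed
  have R2_le: "4 * R2 \<le> real D"
  proof -
    have "4 * 1 * R2 \<le> 4 * R1 * R2" using R by (intro mult_right_mono mult_left_mono) auto
    then show ?thesis using R by linarith
  qed
  define Z where "Z = 2 * (real D)\<^sup>2 * (R1 - 1 / (4 * real D))"
  have Zle: "Z \<le> real D ^ 3 / 2"
  proof -
    have "R1 - 1 / (4 * real D) \<le> real D / 4" using R1_le D8 by (simp add: diff_le_eq add_increasing2)
    then have "Z \<le> 2 * (real D)\<^sup>2 * (real D / 4)" unfolding Z_def by (intro mult_left_mono) auto
    then show ?thesis by (simp add: power2_eq_square power3_eq_cube)
  qed
  have "1 / (4 * real D) \<le> 1" using D8 by (simp add: divide_le_eq)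
  then have Z0: "Z \<ge> 0" unfolding Z_def using R by (intro mult_nonneg_nonneg) auto
  have n0Z: "real n0 \<le> Z" "real n0 \<ge> Z - 1" using Z0 unfolding n0 Z_def[symmetric] by linarith+
  have "real N \<le> real D ^ 3 + 1" using n0Z Zle by (simp add: N_def)
  also have "\<dots> \<le> 2 * real D ^ 3" using D8 one_le_power[of "real D" 3] by simp
  also have "\<dots> \<le> real D * real D ^ 3" using D8 by (intro mult_right_mono) auto
  finally have "real N \<le> real (D ^ 4)" by (simp flip: power_Suc)
  then show N4: "N \<le> D ^ 4" by (simp only: of_nat_le_iff)
  have "D ^ 4 \<le> D ^ (q + 2)" using D q by (intro power_increasing) auto
  then show NM: "N \<le> M" using N4 by (simp add: M_def)
  have KR: "real K \<le> R2 * real D ^ q" "real K \<ge> R2 * real D ^ q - 1"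
  proof -
    have "R2 * real D ^ q \<ge> 0" using R by simp
    then show "real K \<le> R2 * real D ^ q" "real K \<ge> R2 * real D ^ q - 1" unfolding K_def by linarith+
  qed
  have "real (4 * (K + 1)) \<le> 4 * R2 * real D ^ q + 4" using KR by simp
  also have "4 * R2 * real D ^ q \<le> real D * real D ^ q" using R2_le by (intro mult_right_mono) auto
  also have "real D * real D ^ q + 4 \<le> 2 * (real D * real D ^ q)"
  proof -
    have "8 * 1 \<le> real D * real D ^ q" using D8 by (intro mult_mono one_le_power) auto
    then show ?thesis by linarith
  qed
  also have "\<dots> \<le> real D * (real D * real D ^ q)" using D8 by (intro mult_right_mono) auto
  also have "\<dots> = real (D ^ (q + 2))" by (simp add: power_add power2_eq_square)
  finally have "4 * (K + 1) \<le> D ^ (q + 2)" by (simp only: of_nat_le_iff)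
  then show KM: "2 * (K + 1) \<le> M" by (simp add: M_def)
  have Mpos: "real M > 0" using D by (simp add: M_def)
  define y where "y = real (M - K - (K + 1)) / real M"
  have yM: "real (M - K - (K + 1)) = real M - (2 * real K + 1)" using KM by (simp add: of_nat_diff)
  have y: "0 \<le> y" "y \<le> 1" using Mpos by (auto simp: y_def divide_le_eq)
  have \<delta>1: "0 < \<delta>" "\<delta> \<le> 1/2"
  proof -
    have "1 \<le> real D ^ (3 * q + 2)" using D8 by (intro one_le_power) auto
    then show "0 < \<delta>" "\<delta> \<le> 1/2" by (auto simp: \<delta> divide_le_eq)
  qed
  have "1 / (1 - \<delta>) \<le> 1 + 2 * \<delta>"
  proof -
    have "\<delta> * \<delta> \<le> \<delta> * (1/2)" using \<delta>1 by (intro mult_left_mono) auto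
    then have "1 \<le> (1 + 2 * \<delta>) * (1 - \<delta>)" by (simp add: algebra_simps)
    then show ?thesis using \<delta>1 by (simp add: pos_divide_le_eq)
  qed
  then have "y * (1 / (1 - \<delta>)) \<le> y * (1 + 2 * \<delta>)" using y by (intro mult_left_mono) auto
  also have "\<dots> \<le> y + 2 * \<delta>"
    using mult_right_mono[OF y(2), of "2 * \<delta>"] \<delta>1 by (simp add: algebra_simps)
  finally have "real N * (y / (1 - \<delta>)) \<le> real N * (y + 2 * \<delta>)" by (intro mult_left_mono) auto
  moreover have "real N * (2 * \<delta>) \<le> 1"
  proof -
    have "D ^ 4 \<le> D ^ (3 * q + 2)" using D q by (intro power_increasing) auto
    then have "N \<le> D ^ (3 * q + 2)" using N4 by linarith
    then have "real N \<le> real (D ^ (3 * q + 2))" by (simp only: of_nat_le_iff)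
    then show ?thesis using D8 by (simp add: \<delta> divide_le_eq)
  qed
  ultimately have A: "real N * (y / (1 - \<delta>)) \<le> real N * y + 1" by (simp add: algebra_simps)
  have B: "real N - real N * y = real N * (2 * real K + 1) / real M"
    using Mpos unfolding y_def yM by (simp add: field_simps)
  have "real N * (2 * (R2 * real D ^ q) - 1) / real M \<le> real N * (2 * real K + 1) / real M"
    using KR by (intro divide_right_mono mult_left_mono) auto
  moreover have "real N * (2 * (R2 * real D ^ q) - 1) / real M = real N * R2 / (real D)\<^sup>2 - real N / real M"
    using D8 by (simp add: M_def field_simps power_add power2_eq_square)
  moreover have "real N / real M \<le> 1" using NM Mpos by simp
  moreover have "real N * R2 / (real D)\<^sup>2 \<ge> 4 * R1 * R2 - 2"
  proof -
    have "real N \<ge> 2 * Z - 1" using n0Z by (simp add: N_def)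
    then have "(2 * Z - 1) * R2 / (real D)\<^sup>2 \<le> real N * R2 / (real D)\<^sup>2"
      using R by (intro divide_right_mono mult_right_mono) auto
    moreover have "(2 * Z - 1) * R2 / (real D)\<^sup>2 = 4 * R1 * R2 - R2 / real D - R2 / (real D)\<^sup>2"
      using D8 by (simp add: Z_def field_simps power2_eq_square)
    moreover have "R2 / real D \<le> 1" using R2_le R D8 by (simp add: divide_le_eq)
    moreover have "R2 / (real D)\<^sup>2 \<le> 1"
    proof -
      have "1 * real D \<le> real D * real D" using D8 by (intro mult_right_mono) auto
      then have "R2 \<le> (real D)\<^sup>2" unfolding power2_eq_square using R2_le R by linarith
      then show ?thesis using D8 by (simp add: divide_le_eq)
    qed
    ultimately show ?thesis by linarith
  qed
  ultimately have "real N * (2 * real K + 1) / real M \<ge> 4 * R1 * R2 - 3" by linarith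
  then have "real N - real N * (y / (1 - \<delta>)) \<ge> 4 * R1 * R2 - 4" using A B by linarith
  then show "real N - real N * real (M - K - (K + 1)) / real M / (1 - \<delta>) \<ge> 4 * R1 * R2 - 4"
    by (simp add: y_def)
qed

text \<open>\<open>4 ^ l\<close> has to beat \<open>real D ^ (4 * q + 10)\<close>:
  \<open>M * N\<close> contributes \<open>q + 6\<close> powers of \<open>D\<close>,
  \<open>\<delta>\<close> another \<open>3 * q + 2\<close>, and the constant 8 is paid by two more.
  The constant 1008 is \<open>4 * 3 * 21 * 4\<close>, the last 4 from squaring
  \<open>ln (real D) \<le> 2 * ln W\<close>.\<close>

lemma log_term_estimate:
  fixes D q N M :: nat
  assumes D: "D \<ge> 8" and W: "real D \<le> W + 1" "W > 4" and N: "0 < N" "N \<le> D ^ 4"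
    and M: "M = 2 * D ^ (q + 2)" and \<delta>: "\<delta> = 1 / (2 * real D ^ (3 * q + 2))"
    and l: "l = (4 * q + 10) * (nat \<lceil>ln (real D)\<rceil> + 1)"
  shows "real M * (real N * (1/4) ^ l) < \<delta> / 2"
    "real (4 * l * (nat \<lfloor>log (5/4) (real N)\<rfloor> + 1)) \<le> 1008 * real (4 * q + 10) * (ln W)\<^sup>2"
proof -
  have D8: "real D \<ge> 8" using D by simp
  define b where "b = nat \<lceil>ln (real D)\<rceil> + 1"
  have e3: "exp 1 \<le> (3::real)" by (rule exp_le)
  have lnD1: "ln (real D) \<ge> 1"
    using e3 D8 by (subst ln_ge_iff) linarith+
  have Db: "real D < 4 ^ b"
  proof -
    have "ln (real D) < real b" unfolding b_def by linarith
    then have "real D < exp (real b)" using D8 by (metis exp_less_mono exp_ln order_less_le_trans zero_less_numeral)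
    also have "\<dots> = exp 1 ^ b" by (simp flip: exp_of_nat_mult)
    also have "\<dots> \<le> 4 ^ b" using e3 by (intro power_mono) auto
    finally show ?thesis .
  qed
  have "real M * real N \<le> 2 * real D ^ (q + 2) * real D ^ 4"
  proof (rule mult_mono)
    have "real N \<le> real (D ^ 4)" using N by (simp only: of_nat_le_iff)
    then show "real N \<le> real D ^ 4" by simp
  qed (auto simp: M)
  also have "\<dots> * (4 * real D ^ (3 * q + 2)) = 8 * real D ^ (4 * q + 8)"
  proof -
    have "real D ^ (q + 2) * real D ^ 4 * real D ^ (3 * q + 2) = real D ^ ((q + 2) + 4 + (3 * q + 2))"
      by (simp only: power_add)
    also have "(q + 2) + 4 + (3 * q + 2) = 4 * q + 8" by simp
    finally show ?thesis by (simp add: mult_ac)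
  qed
  finally have "real M * real N * (4 * real D ^ (3 * q + 2)) \<le> 8 * real D ^ (4 * q + 8)"
    by (simp add: mult_right_mono)
  also have "\<dots> \<le> (real D * real D) * real D ^ (4 * q + 8)"
    using D8 mult_mono[of 1 "real D" 8 "real D"] by (intro mult_right_mono) auto
  also have "\<dots> = real D ^ (4 * q + 10)" by (simp add: power_add eval_nat_numeral mult_ac)
  also have "\<dots> < (4 ^ b) ^ (4 * q + 10)" using Db by (intro power_strict_mono) auto
  also have "\<dots> = 4 ^ l"
    unfolding l b_def[symmetric] by (subst power_mult[symmetric]) (simp only: mult.commute)
  finally have "real M * real N * (4 * real D ^ (3 * q + 2)) < 4 ^ l" .
  then show "real M * (real N * (1/4) ^ l) < \<delta> / 2"
    using D8 by (simp add: \<delta> power_one_over field_simps)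
  have lnDW: "ln (real D) \<le> 2 * ln W"
  proof -
    have "4 * W \<le> W * W" using W by (intro mult_right_mono) auto
    then have "real D \<le> W ^ 2" unfolding power2_eq_square using W by linarith
    then have "ln (real D) \<le> ln (W ^ 2)" using D8 by (intro ln_mono) auto
    then show ?thesis using W by (simp add: ln_realpow)
  qed
  have "real b \<le> 3 * ln (real D)" unfolding b_def using lnD1 by linarith
  moreover have "real (nat \<lfloor>log (5/4) (real N)\<rfloor> + 1) \<le> 21 * ln (real D)"
  proof -
    \<comment> \<open>With \<open>ln (real N) \<le> 4 * ln (real D)\<close> this gives the factor
      20; the extra level makes it 21.\<close>
    have ln54: "ln (5/4 :: real) \<ge> 1/5"
      using ln_le_minus_one[of "4/5 :: real"] by (simp add: ln_div)
    have "ln (real N) \<le> ln (real (D ^ 4))" using N D by (subst ln_le_cancel_iff) (auto simp del: of_nat_power)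
    also have "\<dots> = 4 * ln (real D)" using D8 by (simp add: ln_realpow)
    finally have "ln (real N) \<le> 4 * ln (real D)" .
    moreover have "ln (real N) \<ge> 0" using N by simp
    ultimately have "log (5/4) (real N) \<le> 4 * ln (real D) / (1/5)"
      unfolding log_def using ln54 by (intro frac_le) auto
    then have "log (5/4) (real N) \<le> 20 * ln (real D)" by simp
    moreover have "log (5/4) (real N) \<ge> 0" using N by (intro zero_le_log_cancel_iff[THEN iffD2]) auto
    ultimately show ?thesis using lnD1 by linarith
  qed
  ultimately have "real b * real (nat \<lfloor>log (5/4) (real N)\<rfloor> + 1) \<le> (3 * ln (real D)) * (21 * ln (real D))"
    using lnD1 by (intro mult_mono) auto
  also have "\<dots> = 63 * (ln (real D))\<^sup>2" by (simp add: power2_eq_square)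
  also have "\<dots> \<le> 63 * (2 * ln W)\<^sup>2" using lnDW lnD1 by (intro mult_left_mono power_mono) auto
  finally have "real b * real (nat \<lfloor>log (5/4) (real N)\<rfloor> + 1) \<le> 252 * (ln W)\<^sup>2" by simp
  then have "4 * real (4 * q + 10) * (real b * real (nat \<lfloor>log (5/4) (real N)\<rfloor> + 1)) \<le> 4 * real (4 * q + 10) * (252 * (ln W)\<^sup>2)"
    by (intro mult_left_mono) auto
  then show "real (4 * l * (nat \<lfloor>log (5/4) (real N)\<rfloor> + 1)) \<le> 1008 * real (4 * q + 10) * (ln W)\<^sup>2"
    unfolding l b_def[symmetric] of_nat_mult by (simp add: mult_ac)
qed

lemma normalized_solution:
  fixes A :: "'e \<Rightarrow> 'i \<Rightarrow> complex"
  assumes "finite E" "finite S" "card E < card S"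
  shows "\<exists>d. (\<Sum>i\<in>S. (norm (d i))\<^sup>2) = 1 \<and> (\<forall>e\<in>E. (\<Sum>i\<in>S. A e i * d i) = 0)"
proof -
  obtain c where c: "\<exists>i\<in>S. c i \<noteq> 0" "\<forall>e\<in>E. (\<Sum>i\<in>S. A e i * c i) = 0"
    using homogeneous_system[OF assms, of A] by blast
  define s where "s = (\<Sum>i\<in>S. (norm (c i))\<^sup>2)"
  obtain i0 where "i0 \<in> S" "c i0 \<noteq> 0" using c(1) by blast
  then have s: "s > 0" unfolding s_def using assms by (intro sum_pos2[of _ i0]) auto
  define d where "d = (\<lambda>i. c i / of_real (sqrt s))"
  have "(\<Sum>i\<in>S. (norm (d i))\<^sup>2) = (\<Sum>i\<in>S. (norm (c i))\<^sup>2) / s"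
    using s by (simp add: d_def norm_divide power_divide sum_divide_distrib)
  moreover have "(\<Sum>i\<in>S. A e i * d i) = (\<Sum>i\<in>S. A e i * c i) / of_real (sqrt s)" for e
    by (simp add: d_def sum_divide_distrib)
  ultimately show ?thesis using c(2) s by (intro exI[of _ d]) (simp add: s_def)
qed

lemma counting_lower_bound_log_squared:
  fixes I :: "'i set" and lam :: "'i \<Rightarrow> real" and r :: "'i \<Rightarrow> nat"
    and \<alpha> :: "'i \<Rightarrow> real \<Rightarrow> complex"
    and J :: "'j set" and mu :: "'j \<Rightarrow> real" and k :: "'j \<Rightarrow> nat"
    and b :: "'j \<Rightarrow> real \<Rightarrow> complex"
    and L :: real
  assumes L: "L > 0"
    and interp: "\<And>f x. smooth_fun f \<Longrightarrow> compact_support f \<Longrightarrow>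
        (\<lambda>i. nth_deriv (r i) f (lam i) * \<alpha> i x) summable_on I \<and>
        (\<lambda>j. nth_deriv (k j) (fourier f) (mu j) * b j x) summable_on J \<and>
        f x = (\<Sum>\<^sub>\<infinity>i\<in>I. nth_deriv (r i) f (lam i) * \<alpha> i x)
            + (\<Sum>\<^sub>\<infinity>j\<in>J. nth_deriv (k j) (fourier f) (mu j) * b j x)"
    and k_bound: "\<And>j. j \<in> J \<Longrightarrow> real (k j) \<le> L"
    and growth: "eventually (\<lambda>R. count_fn J mu R \<le> ereal (R powr L)) at_top"
    and b_bound: "\<exists>K U. K > 0 \<and> U > 0 \<and> (\<forall>j\<in>J. \<forall>x.
        norm (b j x) \<le> K * (1 + \<bar>x\<bar>) powr U * (1 + \<bar>mu j\<bar>) powr U)"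
  shows "\<exists>C D0. \<forall>R1 R2. R1 > 1 \<longrightarrow> R2 > 1 \<longrightarrow> 4 * R1 * R2 \<ge> D0 \<longrightarrow>
           count_fn I lam R1 + count_fn J mu R2
             \<ge> ereal (4 * R1 * R2 - 4 - C * (ln (4 * R1 * R2))\<^sup>2)"
proof -
  obtain \<kappa> U where \<kappa>: "\<kappa> > 0" and U: "U > 0"
    and b: "\<And>j x. j \<in> J \<Longrightarrow> norm (b j x) \<le> \<kappa> * (1 + \<bar>x\<bar>) powr U * (1 + \<bar>mu j\<bar>) powr U"
    using b_bound by blast
  define n where "n = nat \<lfloor>L\<rfloor>"
  have k: "k j \<le> n" if "j \<in> J" for j
    using k_bound[OF that] L unfolding n_def by linarith
  define P where "P = (2 * n + 7) * n + nat \<lceil>U\<rceil> + nat \<lceil>L\<rceil> + 6"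
  define Q where "Q = P * 2 ^ n"
  define q where "q = 4 * Q + 5"
  define \<Sigma> where "\<Sigma> = (\<Sum>\<^sub>\<infinity>j\<in>J. (1 + \<bar>mu j\<bar>) powr (- (L + 2)))"
  have w: "(\<lambda>j. (1 + \<bar>mu j\<bar>) powr (- (L + 2))) summable_on J"
    using growth L by (rule summable_polynomial_growth)
  obtain B where B: "\<And>x. norm (cbump 0 x) \<le> B" using cbump_bounded by blast
  obtain C where C: "\<And>u. \<bar>u\<bar> ^ (2 * (2 * Q + 2)) * norm (fmom 1 (cbump 0) 0 u) \<le> C"
    using fmom_cbump_decay by blast
  obtain a where a: "a > 0" "\<And>u. \<bar>u\<bar> \<le> 1/6 \<Longrightarrow> a \<le> norm (fmom 1 (cbump 0) 0 u)"
    using fmom_cbump_lower by blast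
  \<comment> \<open>This threshold depends on the formula only. It exceeds the constants of the bump
    demanded by \<open>packet_sum\<close> and the value beyond which the final contradiction
    holds.\<close>
  define D0 where "D0 = Max {8, 2 * B, C * 16 ^ (2 * Q + 2), 8 * (\<kappa> * \<Sigma>) / a + 1}"
  have D0: "8 \<le> D0" "2 * B \<le> D0" "C * 16 ^ (2 * Q + 2) \<le> D0" "8 * (\<kappa> * \<Sigma>) / a < D0"
  proof -
    have "8 * (\<kappa> * \<Sigma>) / a + 1 \<le> D0" unfolding D0_def by (rule Max_ge) auto
    then show "8 * (\<kappa> * \<Sigma>) / a < D0" by linarith
  qed (auto simp: D0_def)
  define C1 where "C1 = 1008 * real (4 * q + 10)"
  have "count_fn I lam R1 + count_fn J mu R2 \<ge> ereal (4 * R1 * R2 - 4 - C1 * (ln (4 * R1 * R2))\<^sup>2)"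
    if R1: "R1 > 1" and R2: "R2 > 1" and large: "4 * R1 * R2 \<ge> D0" for R1 R2
  proof -
    define W where "W = 4 * R1 * R2"
    define D where "D = nat \<lceil>W\<rceil>"
    have W8: "W \<ge> 8" using large D0(1) by (simp add: W_def)
    have DW: "W \<le> real D" "real D \<le> W + 1" using W8 unfolding D_def by linarith+
    have D8: "D \<ge> 8" using DW W8 by linarith
    define n0 where "n0 = nat \<lfloor>2 * (real D)\<^sup>2 * (R1 - 1 / (4 * real D))\<rfloor>"
    define N where "N = 2 * n0 + 1"
    define M where "M = 2 * D ^ (q + 2)"
    define K where "K = nat \<lfloor>R2 * real D ^ q\<rfloor>"
    define \<delta> where "\<delta> = 1 / (2 * real D ^ (3 * q + 2))"
    define l where "l = (4 * q + 10) * (nat \<lceil>ln (real D)\<rceil> + 1)"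
    note main = main_term_estimate[OF D8 _ R1 R2 _ n0_def \<delta>_def, folded N_def M_def K_def]
    have est: "N \<le> D ^ 4" "N \<le> M" "2 * (K + 1) \<le> M"
      "real N - real N * real (M - K - (K + 1)) / real M / (1 - \<delta>) \<ge> W - 4"
      using main DW by (simp_all add: q_def W_def)
    have N0: "0 < N" by (simp add: N_def)
    have D1: "real D ^ j \<ge> 1" for j using D8 by (intro one_le_power) auto
    have \<delta>: "0 < \<delta>" "\<delta> \<le> 1/2" using D1[of "3 * q + 2"] by (auto simp: \<delta>_def divide_le_eq)
    have W4: "W > 4" using W8 by simp
    note logs = log_term_estimate[OF D8 DW(2) W4 N0 est(1) M_def \<delta>_def l_def]
    obtain S :: "nat set" and u where S: "finite S" and on: "orthonormal N S u"
      and cardS: "real (card S) \<ge> real N - real N * real (M - K - (K + 1)) / real M / (1 - \<delta>)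
          - real (4 * l * (nat \<lfloor>log (5/4) (real N)\<rfloor> + 1))"
      and outer: "\<And>d. (\<Sum>g\<in>{K+1..<M-K}. (norm (dft M N (\<lambda>m. \<Sum>i\<in>S. d i * u i m) g))\<^sup>2)
          \<le> real M * (\<delta> * (\<Sum>i\<in>S. (norm (d i))\<^sup>2))"
      using time_frequency_subspace[OF N0 est(2,3) \<delta> logs(1)] by blast
    have cardS': "real (card S) \<ge> W - 4 - C1 * (ln W)\<^sup>2"
      using cardS est(4) logs(2) by (simp add: C1_def)
    define A where "A = {i\<in>I. \<bar>lam i\<bar> \<le> R1}"
    define A' where "A' = {j\<in>J. \<bar>mu j\<bar> \<le> R2}"
    show ?thesis
    proof (cases "finite A \<and> finite A'")
      \<comment> \<open>Infinitely many nodes in a window make the left-hand side infinite.\<close>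
      case False
      then show ?thesis by (auto simp: count_fn_def A_def A'_def)
    next
      case True
      then have fin: "finite A" "finite A'" by auto
      have "card S \<le> card A + card A'"
      proof (rule ccontr)
        assume "\<not> ?thesis"
        then have card: "card (A <+> A') < card S" using fin by (simp add: card_Plus)
        define s where "s = 1 / (4 * real D)"
        define t where "t = (\<lambda>n. (real n - real n0) / (2 * (real D)\<^sup>2))"
        \<comment> \<open>One linear functional per node, evaluated on the \<open>m\<close>-th
          packet. Indexing by \<open>i\<close> and \<open>j\<close> rather than by points respects
          multiplicity, and the disjoint sum keeps the two families apart.\<close>
        define \<Phi> where "\<Phi> = (\<lambda>e. case e of
            Inl i \<Rightarrow> (\<lambda>m. packet s (t m) (r i) (lam i))
          | Inr j \<Rightarrow> (\<lambda>m. fmom R1 (packet s (t m) 0) (k j) (mu j)))"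
        obtain d where d1: "(\<Sum>i\<in>S. (norm (d i))\<^sup>2) = 1"
          and d: "\<And>e. e \<in> A <+> A' \<Longrightarrow> (\<Sum>i\<in>S. (\<Sum>m<N. \<Phi> e m * u i m) * d i) = 0"
          using normalized_solution[OF _ S card, of "\<lambda>e i. \<Sum>m<N. \<Phi> e m * u i m"] fin by auto
        define c where "c = (\<lambda>m. \<Sum>i\<in>S. d i * u i m)"
        have c: "(\<Sum>m<N. c m * \<Phi> e m) = 0" if "e \<in> A <+> A'" for e
        proof -
          have "(\<Sum>m<N. c m * \<Phi> e m) = (\<Sum>m<N. \<Sum>i\<in>S. \<Phi> e m * u i m * d i)"
            by (simp add: c_def sum_distrib_left sum_distrib_right mult_ac)
          also have "\<dots> = (\<Sum>i\<in>S. (\<Sum>m<N. \<Phi> e m * u i m) * d i)"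
            unfolding sum_distrib_right by (rule sum.swap)
          finally show ?thesis using d[OF that] by simp
        qed
        have "1 / (4 * real D) \<le> 1" using D8 by (simp add: divide_le_eq)
        then have R1D: "R1 \<ge> 1 / (4 * real D)" using R1 by linarith
        interpret ps: packet_sum D q n0 Q R1 R2 B C a c
        proof
          show "real n0 \<le> 2 * (real D)\<^sup>2 * (R1 - 1 / (4 * real D))"
            unfolding n0_def using R1D by (simp add: of_nat_floor)
          show "(\<Sum>n<2 * n0 + 1. (norm (c n))\<^sup>2) = 1"
            unfolding N_def[symmetric] c_def orthonormal_norm_comb[OF S on] by (rule d1)
          \<comment> \<open>\<open>\<delta>\<close> was set so that the eigenvalue bound on the
            outer energy is exactly the square of the tolerance per grid point.\<close>
          have "real M * (\<delta> * 1) = (1 / real D ^ q)\<^sup>2"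
            using D8 by (simp add: M_def \<delta>_def power_divide field_simps flip: power_add power_mult)
          then show "(\<Sum>g\<in>{nat \<lfloor>R2 * real D ^ q\<rfloor> + 1..<2 * D ^ (q + 2) - nat \<lfloor>R2 * real D ^ q\<rfloor>}.
              (norm (dft (2 * D ^ (q + 2)) (2 * n0 + 1) c g))\<^sup>2) \<le> (1 / real D ^ q)\<^sup>2"
            using outer[of d] unfolding d1 c_def N_def M_def K_def by simp
          show "2 * B \<le> real D" "C * 16 ^ (2 * Q + 2) \<le> real D"
            using D0 large DW by (simp_all add: W_def)
          show "4 * R1 * R2 \<le> real D" using DW by (simp add: W_def)
        qed (use D8 R1 R2 B C a in \<open>auto simp: q_def\<close>)
        have sN: "packet_sum.N n0 = N" "packet_sum.s D = s" "packet_sum.t D n0 = t"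
          by (simp_all add: ps.N_def ps.s_def ps.t_def N_def s_def t_def fun_eq_iff)
        show False
        proof (rule ps.interpolation_contradiction[OF interp k w b \<kappa> U L P_def Q_def])
          show "ps.f (r i) (lam i) = 0" if "i \<in> I" "\<bar>lam i\<bar> \<le> R1" for i
            using c[OF InlI, of i] that by (simp add: ps.f_def sN \<Phi>_def A_def)
          show "fmom R1 (ps.f 0) (k j) (mu j) = 0" if "j \<in> J" "\<bar>mu j\<bar> \<le> R2" for j
            using c[OF InrI, of j] that by (simp add: ps.fmom_f sN \<Phi>_def A'_def)
          have "8 * (\<kappa> * \<Sigma>) / a < real D" using D0(4) large DW by (simp add: W_def)
          then show "a * real D > 8 * (\<kappa> * (\<Sum>\<^sub>\<infinity>j\<in>J. (1 + \<bar>mu j\<bar>) powr (- (L + 2))))"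
            using a(1) by (simp add: \<Sigma>_def pos_divide_less_eq mult.commute)
        qed
      qed
      then have "W - 4 - C1 * (ln W)\<^sup>2 \<le> real (card A) + real (card A')"
        using cardS' by linarith
      then show ?thesis
        using fin by (simp add: count_fn_def A_def[symmetric] A'_def[symmetric] W_def)
    qed
  qed
  then show ?thesis by blast
qed

theorem theorem1:
  fixes I :: "'i set" and lam :: "'i \<Rightarrow> real" and r :: "'i \<Rightarrow> nat"
    and a :: "'i \<Rightarrow> real \<Rightarrow> complex"
    and J :: "'j set" and mu :: "'j \<Rightarrow> real" and k :: "'j \<Rightarrow> nat"
    and b :: "'j \<Rightarrow> real \<Rightarrow> complex"
    and L :: real
  assumes L_pos: "L > 0"
    and interp: "\<And>f x. smooth_fun f \<Longrightarrow> compact_support f \<Longrightarrow>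
        (\<lambda>i. nth_deriv (r i) f (lam i) * a i x) summable_on I \<and>
        (\<lambda>j. nth_deriv (k j) (fourier f) (mu j) * b j x) summable_on J \<and>
        f x = (\<Sum>\<^sub>\<infinity>i\<in>I. nth_deriv (r i) f (lam i) * a i x)
            + (\<Sum>\<^sub>\<infinity>j\<in>J. nth_deriv (k j) (fourier f) (mu j) * b j x)"
    and k_bound: "\<And>j. j \<in> J \<Longrightarrow> real (k j) \<le> L"
    and M_growth: "eventually (\<lambda>R. count_fn J mu R \<le> ereal (R powr L)) at_top"
    and b_bound: "\<exists>K U. K > 0 \<and> U > 0 \<and> (\<forall>j\<in>J. \<forall>x.
        norm (b j x) \<le> K * (1 + \<bar>x\<bar>) powr U * (1 + \<bar>mu j\<bar>) powr U)"
  shows "\<forall>\<epsilon>>0. \<exists>C>0. \<forall>R1 R2. R1 > 1 \<longrightarrow> R2 > 1 \<longrightarrow>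
           count_fn I lam R1 + count_fn J mu R2
             \<ge> ereal (4 * R1 * R2 - C * (ln (4 * R1 * R2)) powr (2 + \<epsilon>))"
proof (intro allI impI)
  fix \<epsilon> :: real assume \<epsilon>: "\<epsilon> > 0"
  obtain C0 D0 where bound: "\<And>R1 R2. R1 > 1 \<Longrightarrow> R2 > 1 \<Longrightarrow> 4 * R1 * R2 \<ge> D0 \<Longrightarrow>
           count_fn I lam R1 + count_fn J mu R2
             \<ge> ereal (4 * R1 * R2 - 4 - C0 * (ln (4 * R1 * R2))\<^sup>2)"
    using counting_lower_bound_log_squared[OF assms] by blast
  \<comment> \<open>The summands pay separately: 4 for the additive loss, \<open>|C0|\<close> for
    the logarithmic term, \<open>|D0|\<close> for the range \<open>W < D0\<close>, where the lower
    bound becomes nonpositive because \<open>z \<ge> 1\<close>.\<close>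
  define C where "C = 4 + \<bar>C0\<bar> + \<bar>D0\<bar>"
  have "count_fn I lam R1 + count_fn J mu R2 \<ge> ereal (4 * R1 * R2 - C * (ln (4 * R1 * R2)) powr (2 + \<epsilon>))"
    if R1: "R1 > 1" and R2: "R2 > 1" for R1 R2
  proof -
    define W where "W = 4 * R1 * R2"
    define z where "z = ln W powr (2 + \<epsilon>)"
    have "1 * 1 \<le> R1 * R2" using R1 R2 by (intro mult_mono) auto
    then have W4: "W \<ge> 4" by (simp add: W_def)
    have ln1: "ln W \<ge> 1"
      using exp_le W4 by (subst ln_ge_iff) linarith+
    have sq: "(ln W)\<^sup>2 \<le> z"
    proof -
      have "ln W powr 2 \<le> z" unfolding z_def using ln1 \<epsilon> by (intro powr_mono) auto
      then show ?thesis using ln1 by simp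
    qed
    have z1: "z \<ge> 1" unfolding z_def using ln1 \<epsilon> by (intro ge_one_powr_ge_zero) auto
    show ?thesis
    proof (cases "W \<ge> D0")
      case True
      have "C0 * (ln W)\<^sup>2 \<le> \<bar>C0\<bar> * z" using sq by (intro mult_mono) auto
      moreover have "4 \<le> 4 * z" "0 \<le> \<bar>D0\<bar> * z" using z1 by auto
      ultimately have "W - C * z \<le> W - 4 - C0 * (ln W)\<^sup>2" unfolding C_def distrib_right by linarith
      then show ?thesis
        using bound[OF R1 R2] True unfolding W_def[symmetric] z_def[symmetric]
        by (metis ereal_less_eq(3) order_trans)
    next
      case False
      have "\<bar>D0\<bar> * 1 \<le> \<bar>D0\<bar> * z" using z1 by (intro mult_left_mono) auto
      moreover have "0 \<le> 4 * z" "0 \<le> \<bar>C0\<bar> * z" using z1 by auto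
      ultimately have "W - C * z \<le> 0" using False unfolding C_def distrib_right by linarith
      then have "ereal (W - C * z) \<le> 0" by simp
      also have "0 \<le> count_fn I lam R1 + count_fn J mu R2"
        by (intro add_nonneg_nonneg) (auto simp: count_fn_def)
      finally show ?thesis unfolding W_def[symmetric] z_def[symmetric] .
    qed
  qed
  moreover have "C > 0" by (simp add: C_def)
  ultimately show "\<exists>C>0. \<forall>R1 R2. R1 > 1 \<longrightarrow> R2 > 1 \<longrightarrow>
           count_fn I lam R1 + count_fn J mu R2
             \<ge> ereal (4 * R1 * R2 - C * (ln (4 * R1 * R2)) powr (2 + \<epsilon>))" by blast
qed

end
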